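(* Let $b:\mathbb{R}_+\times\mathbb{B}\to E$ and $\sigma:\mathbb{R}_+\times\mathbb{B}\to L_2(U,H)$ satisfy the measurability assumptions listed in the context, and consider the stochastic evolution equation $$X_t = X_0 + \int_0^t b(s,X)\,ds+\int_0^t\sigma(s,X)\,dW_s,\qquad t\ge 0,$$ driven by standard $\mathbb{R}^\infty$-Wiener processes $W$. If this equation has a strong solution and joint uniqueness in law given $\mu$ holds for some probability measure $\mu$ on $\mathcal{B}(H)$, then pathwise uniqueness given $\mu$ holds as well. In particular, the existence of a strong solution and joint uniqueness in law imply pathwise uniqueness.
   Context: **Spaces.** $H$ and $U$ are real separable infinite-dimensional Hilbert spaces; $V$ and $E$ are real separable Banach spaces with $V\subseteq H\subseteq E$ continuously and densely. Put $\|x\|_V:=+\infty$ for $x\in H\setminus V$. $L_2(U,H)$ is the separable Hilbert space of Hilbert-Schmidt operators from $U$ to $H$. The path space is $$\mathbb{B}:=\Big\{\omega\in C(\mathbb{R}_+;H)\ \Big|\ \int_0^T\|\omega(s)\|_V\,ds<\infty\ \text{for all }T\ge 0\Big\},$$ a complete separable metric space with metric $\rho(\omega_1,\omega_2)=\sum_{k\ge1}2^{-k}\big[\big(\int_0^k\|\omega_2(s)-\omega_1(s)\|_V ds+\sup_{t\in[0,k]}\|\omega_2(t)-\omega_1(t)\|_H\big)\wedge1\big]$; $\mathcal{B}(\mathbb{B})$ is its Borel $\sigma$-algebra and $\mathcal{B}_t(\mathbb{B}):=\sigma(\pi_s\mid 0\le s\le t)$, where $\pi_s(\omega)=\omega(s)$.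 **Stochastic basis.** $(\Omega,\mathcal{F},(\mathcal{F}_t)_{t\ge0},\mathbb{P})$ where $\mathcal{F}$ is $\mathbb{P}$-complete and $(\mathcal{F}_t)$ is right-continuous with all $\mathbb{P}$-zero sets in $\mathcal{F}_0$. **Wiener processes.** Fix an orthonormal basis $(e_k)_{k\in\mathbb{N}}$ of $U$, a separable Hilbert space $\bar U$ and a one-to-one Hilbert-Schmidt map $J:U\to\bar U$; set $\bar Q:=JJ^*$. A standard $(\mathcal{F}_t)$-$\mathbb{R}^\infty$-Wiener process is a family $W=(\beta_k)_{k\in\mathbb{N}}$ of independent real-valued $(\mathcal{F}_t)$-Brownian motions (formally $W_t=\sum_k\beta_k(t)e_k$). Its associated cylindrical Wiener process is $\bar W_t:=\sum_k\beta_k(t)Je_k$, a $\bar U$-valued $\bar Q$-Wiener process with paths in $\mathbb{W}_0:=\{\omega\in C(\mathbb{R}_+;\bar U)\mid\omega(0)=0\}$ (topology of locally uniform convergence, Borel $\sigma$-algebra $\mathcal{B}(\mathbb{W}_0)$, $\mathcal{B}_t(\mathbb{W}_0):=\sigma(\pi_s\mid 0\le s\le t)$). $\mathbb{P}^{\bar Q}$ denotes the law of $\bar W$ on $\mathcal{B}(\mathbb{W}_0)$. The stochastic integral is $\int_0^t\sigma(s,X)\,dW_s:=\int_0^t\sigma(s,X)\circ J^{-1}\,d\bar W_s$ ($H$-valued It\^o integral); the $ds$-integral is a pathwise $E$-valued Bochner integral. **Assumptions on the coefficients.** $b$ is $\mathcal{B}(\mathbb{R}_+)\otimes\mathcal{B}(\mathbb{B})/\mathcal{B}(E)$-measurable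 and $b(t,\cdot)$ is $\mathcal{B}_t(\mathbb{B})/\mathcal{B}(E)$-measurable for all $t\ge0$; $\sigma$ is $\mathcal{B}(\mathbb{R}_+)\otimes\mathcal{B}(\mathbb{B})/\mathcal{B}(L_2(U,H))$-measurable and $\sigma(t,\cdot)$ is $\mathcal{B}_t(\mathbb{B})/\mathcal{B}(L_2(U,H))$-measurable for all $t\ge0$. **Weak solution.** A pair $(X,W)$ on some stochastic basis, where $X=(X_t)_{t\ge0}$ is $(\mathcal{F}_t)$-adapted with paths in $\mathbb{B}$ and $W$ is a standard $(\mathcal{F}_t)$-$\mathbb{R}^\infty$-Wiener process, such that $\int_0^T\|b(s,X)\|_E\,ds+\int_0^T\|\sigma(s,X)\|_{L_2(U,H)}^2\,ds<\infty$ $\mathbb{P}$-a.s. for every $T\ge0$, and $\mathbb{P}$-a.s. $X_t=X_0+\int_0^tb(s,X)\,ds+\int_0^t\sigma(s,X)\,dW_s$ for every $t\ge0$ as an equation in $E$. **Uniqueness.** *Joint uniqueness in law*: for any two weak solutions $(X,W^1)$, $(Y,W^2)$ on possibly different stochastic bases (with measures $\mathbb{P},\mathbb{P}'$), $\mathbb{P}\circ X_0^{-1}=\mathbb{P}'\circ Y_0^{-1}$ implies $\mathbb{P}\circ(X,\bar W^1)^{-1}=\mathbb{P}'\circ(Y,\bar W^2)^{-1}$ on $\mathcal{B}(\mathbb{B})\otimes\mathcal{B}(\mathbb{W}_0)$. *Joint uniqueness in law given $\mu$*: this implication holds at least for all weak solutions with initial distribution $\mu$. *Pathwise uniqueness*: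 for any two weak solutions $(X,W)$, $(Y,W)$ on a common stochastic basis with a common $W$, $X_0=Y_0$ $\mathbb{P}$-a.s. implies $X_t=Y_t$ for all $t\ge0$ $\mathbb{P}$-a.s. *Pathwise uniqueness given $\mu$*: this implication holds at least for all such weak solutions with $\mathbb{P}\circ X_0^{-1}=\mu=\mathbb{P}\circ Y_0^{-1}$. **Strong solution.** Let $\hat{\mathcal{E}}$ be the set of maps $F:H\times\mathbb{W}_0\to\mathbb{B}$ such that for each probability measure $\mu$ on $\mathcal{B}(H)$ there is a map $F_\mu:H\times\mathbb{W}_0\to\mathbb{B}$, measurable from the $\mu\otimes\mathbb{P}^{\bar Q}$-completion of $\mathcal{B}(H)\otimes\mathcal{B}(\mathbb{W}_0)$ to $\mathcal{B}(\mathbb{B})$, such that for $\mu$-a.a. $h\in H$, $F(h,\omega)=F_\mu(h,\omega)$ for $\mathbb{P}^{\bar Q}$-a.a. $\omega$. The equation has a strong solution if there is $F\in\hat{\mathcal{E}}$ such that: for all $h\in H$ and $t\ge0$, $\omega\mapsto F(h,\omega)$ is measurable from the $\mathbb{P}^{\bar Q}$-completion of $\mathcal{B}_t(\mathbb{W}_0)$ to $\mathcal{B}_t(\mathbb{B})$; and for every standard $(\mathcal{F}_t)$-$\mathbb{R}^\infty$-Wiener process $W$ on any stochastic basis and any $\mathcal{F}_0/\mathcal{B}(H)$-measurable $\xi:\Omega\to H$, the process $X:=F_{\mathbb{P}\circ\xi^{-1}}(\xi,\bar W)$ is such that $(X,W)$ is a weak solution with $X_0=\xi$ $\mathbb{P}$-a.s.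 *)

theory Defs
  imports "HOL-Probability.Probability"
begin

section \<open>Borel and coordinate sigma-algebras\<close>

text \<open>
  Borel sigma-algebra of the metric space (S, d), with the metric topology spelled out. This is
  \<^const>\<open>Metric_space.mtopology\<close> without the detour through a proof of the metric axioms.
\<close>
definition metric_borel :: "'a set \<Rightarrow> ('a \<Rightarrow> 'a \<Rightarrow> real) \<Rightarrow> 'a measure" where
  "metric_borel S d =
     sigma S {U. U \<subseteq> S \<and> (\<forall>x\<in>U. \<exists>r>0. \<forall>y\<in>S. d x y < r \<longrightarrow> y \<in> U)}"

definition coordinate_algebra :: "(real \<Rightarrow> 'a::topological_space) set \<Rightarrow> real \<Rightarrow> (real \<Rightarrow> 'a) measure" where
  "coordinate_algebra S t =
     sigma S {(\<lambda>\<omega>. \<omega> s) -` A \<inter> S |s A. s \<in> {0..t} \<and> A \<in> sets borel}"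

section \<open>Spaces\<close>

text \<open>Inclusions of Banach spaces are represented by injective bounded linear maps.\<close>
definition dense_continuous_embedding :: "('a::real_normed_vector \<Rightarrow> 'b::real_normed_vector) \<Rightarrow> bool" where
  "dense_continuous_embedding i \<longleftrightarrow> bounded_linear i \<and> inj i \<and> closure (range i) = UNIV"

definition orthonormal_basis :: "(nat \<Rightarrow> 'u::real_inner) \<Rightarrow> bool" where
  "orthonormal_basis e \<longleftrightarrow>
     (\<forall>j k. e j \<bullet> e k = (if j = k then 1 else 0)) \<and> closure (span (range e)) = UNIV"

text \<open>Squared Hilbert-Schmidt norm, computed along the orthonormal basis e.\<close>
definition hs_norm_sq :: "(nat \<Rightarrow> 'u) \<Rightarrow> ('u \<Rightarrow> 'h::real_normed_vector) \<Rightarrow> ennreal" where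
  "hs_norm_sq e L = (\<Sum>k. ennreal ((norm (L (e k)))\<^sup>2))"

definition hs_operators :: "(nat \<Rightarrow> 'u::real_inner) \<Rightarrow> ('u \<Rightarrow>\<^sub>L 'h::real_inner) set" where
  "hs_operators e = {L. hs_norm_sq e (blinfun_apply L) < \<infinity>}"

definition hs_dist :: "(nat \<Rightarrow> 'u::real_inner) \<Rightarrow> ('u \<Rightarrow>\<^sub>L 'h::real_inner) \<Rightarrow> ('u \<Rightarrow>\<^sub>L 'h) \<Rightarrow> real" where
  "hs_dist e L L' = sqrt (enn2real (hs_norm_sq e (blinfun_apply (L - L'))))"

definition hs_borel :: "(nat \<Rightarrow> 'u::real_inner) \<Rightarrow> ('u \<Rightarrow>\<^sub>L 'h::real_inner) measure" where
  "hs_borel e = metric_borel (hs_operators e) (hs_dist e)"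

text \<open>The V-norm on H, equal to infinity outside the image of V.\<close>
definition vnorm :: "('v::real_normed_vector \<Rightarrow> 'h) \<Rightarrow> 'h \<Rightarrow> ennreal" where
  "vnorm iV x = (if x \<in> range iV then ennreal (norm (inv iV x)) else \<infinity>)"

text \<open>
  Paths indexed by the nonnegative reals are functions on the reals that are \<^const>\<open>undefined\<close> at
  negative times, so that two paths are equal iff they agree on the nonnegative reals.
\<close>
definition path_space :: "('v::real_normed_vector \<Rightarrow> 'h::real_normed_vector) \<Rightarrow> (real \<Rightarrow> 'h) set" where
  "path_space iV = {\<omega> \<in> extensional {0..}. continuous_on {0..} \<omega> \<and>
     (\<forall>T\<ge>0. (\<integral>\<^sup>+s\<in>{0..T}. vnorm iV (\<omega> s) \<partial>lborel) < \<infinity>)}"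

definition path_dist :: "('v::real_normed_vector \<Rightarrow> 'h::real_normed_vector) \<Rightarrow> (real \<Rightarrow> 'h) \<Rightarrow> (real \<Rightarrow> 'h) \<Rightarrow> real" where
  "path_dist iV \<omega>1 \<omega>2 = (\<Sum>j. let k = Suc j in (1/2)^k *
     min 1 (enn2real (\<integral>\<^sup>+s\<in>{0..real k}. vnorm iV (\<omega>2 s - \<omega>1 s) \<partial>lborel)
            + (SUP t\<in>{0..real k}. norm (\<omega>2 t - \<omega>1 t))))"

definition path_borel :: "('v::real_normed_vector \<Rightarrow> 'h::real_normed_vector) \<Rightarrow> (real \<Rightarrow> 'h) measure" where
  "path_borel iV = metric_borel (path_space iV) (path_dist iV)"

definition wiener_space :: "(real \<Rightarrow> 'k::real_normed_vector) set" where
  "wiener_space = {w \<in> extensional {0..}. continuous_on {0..} w \<and> w 0 = 0}"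

text \<open>A metric for locally uniform convergence.\<close>
definition wiener_dist :: "(real \<Rightarrow> 'k::real_normed_vector) \<Rightarrow> (real \<Rightarrow> 'k) \<Rightarrow> real" where
  "wiener_dist w1 w2 = (\<Sum>j. let k = Suc j in (1/2)^k *
     min 1 (SUP t\<in>{0..real k}. norm (w2 t - w1 t)))"

definition wiener_borel :: "(real \<Rightarrow> 'k::real_normed_vector) measure" where
  "wiener_borel = metric_borel wiener_space wiener_dist"

section \<open>Stochastic bases and Wiener processes\<close>

text \<open>Filtrations are only used at nonnegative times, and only through their space and sets.\<close>
definition stochastic_basis :: "'w measure \<Rightarrow> (real \<Rightarrow> 'w measure) \<Rightarrow> bool" where
  "stochastic_basis M F \<longleftrightarrow>
     prob_space M \<and> complete_measure M \<and>
     (\<forall>t\<ge>0. space (F t) = space M \<and> sets (F t) \<subseteq> sets M) \<and>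
     (\<forall>s\<ge>0. \<forall>t\<ge>s. sets (F s) \<subseteq> sets (F t)) \<and>
     (\<forall>t\<ge>0. sets (F t) = (\<Inter>u\<in>{t<..}. sets (F u))) \<and>
     null_sets M \<subseteq> sets (F 0)"

definition brownian_motion :: "'w measure \<Rightarrow> (real \<Rightarrow> 'w measure) \<Rightarrow> (real \<Rightarrow> 'w \<Rightarrow> real) \<Rightarrow> bool" where
  "brownian_motion M F B \<longleftrightarrow>
     (\<forall>t\<ge>0. B t \<in> borel_measurable (F t)) \<and>
     (\<forall>\<omega>\<in>space M. B 0 \<omega> = 0 \<and> continuous_on {0..} (\<lambda>t. B t \<omega>)) \<and>
     (\<forall>s\<ge>0. \<forall>t>s.
        distributed M lborel (\<lambda>\<omega>. B t \<omega> - B s \<omega>) (normal_density 0 (sqrt (t - s))) \<and>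
        prob_space.indep_set M (sets (F s))
          {(\<lambda>\<omega>. B t \<omega> - B s \<omega>) -` A \<inter> space M |A. A \<in> sets borel})"

text \<open>The second conjunct is independence of the family of processes, not only of their values
  at each fixed time.\<close>
definition wiener_process :: "'w measure \<Rightarrow> (real \<Rightarrow> 'w measure) \<Rightarrow> (nat \<Rightarrow> real \<Rightarrow> 'w \<Rightarrow> real) \<Rightarrow> bool" where
  "wiener_process M F W \<longleftrightarrow>
     (\<forall>k. brownian_motion M F (W k)) \<and>
     prob_space.indep_vars M (\<lambda>k. PiM {0..} (\<lambda>t. borel))
       (\<lambda>k \<omega>. \<lambda>t\<in>{0..}. W k t \<omega>) UNIV"

text \<open>
  The path of the cylindrical process associated with W, namely the sum over k of W k t times
  J (e k). For a Wiener process this series converges locally uniformly in t almost surely;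
  the zero path is used on the remaining null set.
\<close>
definition cyl_limit :: "('u \<Rightarrow> 'k::real_normed_vector) \<Rightarrow> (nat \<Rightarrow> 'u) \<Rightarrow> (nat \<Rightarrow> real \<Rightarrow> 'w \<Rightarrow> real) \<Rightarrow> 'w \<Rightarrow> (real \<Rightarrow> 'k) \<Rightarrow> bool" where
  "cyl_limit J e W \<omega> w \<longleftrightarrow> w \<in> wiener_space \<and>
     (\<forall>T\<ge>0. uniform_limit {0..T} (\<lambda>n t. \<Sum>k<n. W k t \<omega> *\<^sub>R J (e k)) w sequentially)"

definition cyl_wiener :: "('u \<Rightarrow> 'k::real_normed_vector) \<Rightarrow> (nat \<Rightarrow> 'u) \<Rightarrow> (nat \<Rightarrow> real \<Rightarrow> 'w \<Rightarrow> real) \<Rightarrow> 'w \<Rightarrow> real \<Rightarrow> 'k" where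
  "cyl_wiener J e W \<omega> =
     (if \<exists>w. cyl_limit J e W \<omega> w then THE w. cyl_limit J e W \<omega> w else (\<lambda>t\<in>{0..}. 0))"

text \<open>
  The law of the cylindrical process. It does not depend on the stochastic basis; here it is read
  off from bases over the sample type of real sequences of paths, which carries the canonical one.
\<close>
definition wiener_law :: "('u \<Rightarrow> 'k::real_normed_vector) \<Rightarrow> (nat \<Rightarrow> 'u) \<Rightarrow> (real \<Rightarrow> 'k) measure" where
  "wiener_law J e = (THE P. \<exists>(M :: (nat \<Rightarrow> real \<Rightarrow> real) measure) F W.
     stochastic_basis M F \<and> wiener_process M F W \<and> P = distr M wiener_borel (cyl_wiener J e W))"

section \<open>The stochastic integral\<close>

text \<open>
  Elementary integrands: the operator \<Phi> m, which is measurable at time \<tau> m and takes finitely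
  many values, is used on the interval from \<tau> m (excluded) to \<tau> (m + 1) (included), for m < n.
\<close>
definition elementary_integrand ::
  "(real \<Rightarrow> 'w measure) \<Rightarrow> nat \<Rightarrow> (nat \<Rightarrow> real) \<Rightarrow>
   (nat \<Rightarrow> 'w \<Rightarrow> ('k::real_inner \<Rightarrow>\<^sub>L 'h::real_inner)) \<Rightarrow> bool" where
  "elementary_integrand F n \<tau> \<Phi> \<longleftrightarrow>
     0 \<le> \<tau> 0 \<and> (\<forall>m<n. \<tau> m < \<tau> (Suc m)) \<and> (\<forall>m<n. simple_function (F (\<tau> m)) (\<Phi> m))"

definition elementary_value ::
  "nat \<Rightarrow> (nat \<Rightarrow> real) \<Rightarrow> (nat \<Rightarrow> 'w \<Rightarrow> ('k::real_inner \<Rightarrow>\<^sub>L 'h::real_inner)) \<Rightarrow>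
   real \<Rightarrow> 'w \<Rightarrow> ('k \<Rightarrow>\<^sub>L 'h)" where
  "elementary_value n \<tau> \<Phi> s \<omega> = (\<Sum>m<n. indicat_real {\<tau> m<..\<tau> (Suc m)} s *\<^sub>R \<Phi> m \<omega>)"

definition elementary_integral ::
  "('w \<Rightarrow> real \<Rightarrow> 'k) \<Rightarrow> nat \<Rightarrow> (nat \<Rightarrow> real) \<Rightarrow>
   (nat \<Rightarrow> 'w \<Rightarrow> ('k::real_inner \<Rightarrow>\<^sub>L 'h::real_inner)) \<Rightarrow> real \<Rightarrow> 'w \<Rightarrow> 'h" where
  "elementary_integral Wb n \<tau> \<Phi> t \<omega> =
     (\<Sum>m<n. blinfun_apply (\<Phi> m \<omega>) (Wb \<omega> (min (\<tau> (Suc m)) t) - Wb \<omega> (min (\<tau> m) t)))"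

text \<open>
  I is (a version, unique up to indistinguishability, of) the Ito integral process of \<Psi> against
  the Q-Wiener process Wb with Q = J J*: the limit of integrals of elementary integrands, locally
  uniformly in time in probability, where the elementary integrands converge to \<Psi> in probability
  in the space of square integrable functions on bounded time intervals with values in the
  Hilbert-Schmidt operators on the Cameron-Martin space. The latter is the range of the square root
  of Q, with orthonormal basis (J (e k)); it equals the range of J, so \<Psi> s \<omega> is only evaluated there.
\<close>
definition is_ito_integral ::
  "'w measure \<Rightarrow> (real \<Rightarrow> 'w measure) \<Rightarrow> ('u \<Rightarrow> 'k::real_inner) \<Rightarrow> (nat \<Rightarrow> 'u) \<Rightarrow>
   ('w \<Rightarrow> real \<Rightarrow> 'k) \<Rightarrow> (real \<Rightarrow> 'w \<Rightarrow> 'k \<Rightarrow> 'h::real_inner) \<Rightarrow> (real \<Rightarrow> 'w \<Rightarrow> 'h) \<Rightarrow> bool" where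
  "is_ito_integral M F J e Wb \<Psi> I \<longleftrightarrow>
     (\<forall>t\<ge>0. I t \<in> borel_measurable (F t)) \<and>
     (\<forall>\<omega>\<in>space M. continuous_on {0..} (\<lambda>t. I t \<omega>)) \<and>
     (\<exists>n \<tau> \<Phi>. (\<forall>j. elementary_integrand F (n j) (\<tau> j) (\<Phi> j)) \<and>
       (\<forall>T\<ge>0. \<forall>\<epsilon>>0.
         (\<lambda>j. measure M {\<omega>\<in>space M. ennreal \<epsilon> <
            (\<integral>\<^sup>+s\<in>{0..T}. hs_norm_sq (\<lambda>k. J (e k))
               (\<lambda>x. blinfun_apply (elementary_value (n j) (\<tau> j) (\<Phi> j) s \<omega>) x - \<Psi> s \<omega> x) \<partial>lborel)})
           \<longlonglongrightarrow> 0 \<and>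
         (\<lambda>j. measure M {\<omega>\<in>space M. \<epsilon> <
            (SUP t\<in>{0..T}. norm (elementary_integral Wb (n j) (\<tau> j) (\<Phi> j) t \<omega> - I t \<omega>))})
           \<longlonglongrightarrow> 0))"

section \<open>The equation\<close>

definition admissible_drift ::
  "('v::real_normed_vector \<Rightarrow> 'h::real_normed_vector) \<Rightarrow> (real \<Rightarrow> (real \<Rightarrow> 'h) \<Rightarrow> 'e::real_normed_vector) \<Rightarrow> bool" where
  "admissible_drift iV b \<longleftrightarrow>
     (\<lambda>(t, \<omega>). b t \<omega>) \<in> restrict_space borel {0..} \<Otimes>\<^sub>M path_borel iV \<rightarrow>\<^sub>M borel \<and>
     (\<forall>t\<ge>0. b t \<in> coordinate_algebra (path_space iV) t \<rightarrow>\<^sub>M borel)"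

definition admissible_diffusion ::
  "('v::real_normed_vector \<Rightarrow> 'h::real_inner) \<Rightarrow> (nat \<Rightarrow> 'u::real_inner) \<Rightarrow>
   (real \<Rightarrow> (real \<Rightarrow> 'h) \<Rightarrow> ('u \<Rightarrow>\<^sub>L 'h)) \<Rightarrow> bool" where
  "admissible_diffusion iV e \<sigma> \<longleftrightarrow>
     (\<lambda>(t, \<omega>). \<sigma> t \<omega>) \<in> restrict_space borel {0..} \<Otimes>\<^sub>M path_borel iV \<rightarrow>\<^sub>M hs_borel e \<and>
     (\<forall>t\<ge>0. \<sigma> t \<in> coordinate_algebra (path_space iV) t \<rightarrow>\<^sub>M hs_borel e)"

definition weak_solution ::
  "('v::real_normed_vector \<Rightarrow> 'h::real_inner) \<Rightarrow>
   ('h \<Rightarrow> 'e::{banach, second_countable_topology}) \<Rightarrow>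
   ('u::real_inner \<Rightarrow> 'k::real_inner) \<Rightarrow> (nat \<Rightarrow> 'u) \<Rightarrow>
   (real \<Rightarrow> (real \<Rightarrow> 'h) \<Rightarrow> 'e) \<Rightarrow> (real \<Rightarrow> (real \<Rightarrow> 'h) \<Rightarrow> ('u \<Rightarrow>\<^sub>L 'h)) \<Rightarrow>
   'w measure \<Rightarrow> (real \<Rightarrow> 'w measure) \<Rightarrow> ('w \<Rightarrow> real \<Rightarrow> 'h) \<Rightarrow> (nat \<Rightarrow> real \<Rightarrow> 'w \<Rightarrow> real) \<Rightarrow> bool" where
  "weak_solution iV iE J e b \<sigma> M F X W \<longleftrightarrow>
     stochastic_basis M F \<and> wiener_process M F W \<and>
     (\<forall>\<omega>\<in>space M. X \<omega> \<in> path_space iV) \<and>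
     (\<forall>t\<ge>0. (\<lambda>\<omega>. X \<omega> t) \<in> borel_measurable (F t)) \<and>
     (\<forall>T\<ge>0. AE \<omega> in M.
        (\<integral>\<^sup>+s\<in>{0..T}. ennreal (norm (b s (X \<omega>))) \<partial>lborel)
        + (\<integral>\<^sup>+s\<in>{0..T}. hs_norm_sq e (blinfun_apply (\<sigma> s (X \<omega>))) \<partial>lborel) < \<infinity>) \<and>
     (\<exists>I. is_ito_integral M F J e (cyl_wiener J e W) (\<lambda>s \<omega>. blinfun_apply (\<sigma> s (X \<omega>)) \<circ> inv J) I \<and>
        (AE \<omega> in M. \<forall>t\<ge>0.
           iE (X \<omega> t) = iE (X \<omega> 0) + (LINT s:{0..t}|lborel. b s (X \<omega>)) + iE (I t \<omega>)))"

section \<open>Uniqueness and strong solutions\<close>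

text \<open>
  The notions below quantify over all stochastic bases whose sample space is contained in the
  type 'w, which is passed as a type argument. Two bases over different types can be pulled back
  to their product type, so a single type loses nothing.
\<close>

text \<open>The law is stated as a set function, for processes given as maps into the path space.\<close>
definition joint_law ::
  "('u \<Rightarrow> 'k::real_normed_vector) \<Rightarrow> (nat \<Rightarrow> 'u) \<Rightarrow> 'w measure \<Rightarrow> ('w \<Rightarrow> real \<Rightarrow> 'h) \<Rightarrow>
   (nat \<Rightarrow> real \<Rightarrow> 'w \<Rightarrow> real) \<Rightarrow> ((real \<Rightarrow> 'h) \<times> (real \<Rightarrow> 'k)) set \<Rightarrow> ennreal" where
  "joint_law J e M X W A = emeasure M ((\<lambda>\<omega>. (X \<omega>, cyl_wiener J e W \<omega>)) -` A \<inter> space M)"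

definition joint_uniqueness_given ::
  "'w itself \<Rightarrow> ('v::real_normed_vector \<Rightarrow> 'h::real_inner) \<Rightarrow>
   ('h \<Rightarrow> 'e::{banach, second_countable_topology}) \<Rightarrow>
   ('u::real_inner \<Rightarrow> 'k::real_inner) \<Rightarrow> (nat \<Rightarrow> 'u) \<Rightarrow>
   (real \<Rightarrow> (real \<Rightarrow> 'h) \<Rightarrow> 'e) \<Rightarrow> (real \<Rightarrow> (real \<Rightarrow> 'h) \<Rightarrow> ('u \<Rightarrow>\<^sub>L 'h)) \<Rightarrow> 'h measure \<Rightarrow> bool" where
  "joint_uniqueness_given (_ :: 'w itself) iV iE J e b \<sigma> \<mu> \<longleftrightarrow>
     (\<forall>(M :: 'w measure) F X W (M' :: 'w measure) F' Y W'.
        weak_solution iV iE J e b \<sigma> M F X W \<and> weak_solution iV iE J e b \<sigma> M' F' Y W' \<and>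
        distr M borel (\<lambda>\<omega>. X \<omega> 0) = \<mu> \<and> distr M' borel (\<lambda>\<omega>. Y \<omega> 0) = \<mu> \<longrightarrow>
        (\<forall>A \<in> sets (path_borel iV \<Otimes>\<^sub>M wiener_borel).
           joint_law J e M X W A = joint_law J e M' Y W' A))"

definition joint_uniqueness ::
  "'w itself \<Rightarrow> ('v::real_normed_vector \<Rightarrow> 'h::real_inner) \<Rightarrow>
   ('h \<Rightarrow> 'e::{banach, second_countable_topology}) \<Rightarrow>
   ('u::real_inner \<Rightarrow> 'k::real_inner) \<Rightarrow> (nat \<Rightarrow> 'u) \<Rightarrow>
   (real \<Rightarrow> (real \<Rightarrow> 'h) \<Rightarrow> 'e) \<Rightarrow> (real \<Rightarrow> (real \<Rightarrow> 'h) \<Rightarrow> ('u \<Rightarrow>\<^sub>L 'h)) \<Rightarrow> bool" where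
  "joint_uniqueness (_ :: 'w itself) iV iE J e b \<sigma> \<longleftrightarrow>
     (\<forall>(M :: 'w measure) F X W (M' :: 'w measure) F' Y W'.
        weak_solution iV iE J e b \<sigma> M F X W \<and> weak_solution iV iE J e b \<sigma> M' F' Y W' \<and>
        distr M borel (\<lambda>\<omega>. X \<omega> 0) = distr M' borel (\<lambda>\<omega>. Y \<omega> 0) \<longrightarrow>
        (\<forall>A \<in> sets (path_borel iV \<Otimes>\<^sub>M wiener_borel).
           joint_law J e M X W A = joint_law J e M' Y W' A))"

definition pathwise_uniqueness_given ::
  "'w itself \<Rightarrow> ('v::real_normed_vector \<Rightarrow> 'h::real_inner) \<Rightarrow>
   ('h \<Rightarrow> 'e::{banach, second_countable_topology}) \<Rightarrow>
   ('u::real_inner \<Rightarrow> 'k::real_inner) \<Rightarrow> (nat \<Rightarrow> 'u) \<Rightarrow>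
   (real \<Rightarrow> (real \<Rightarrow> 'h) \<Rightarrow> 'e) \<Rightarrow> (real \<Rightarrow> (real \<Rightarrow> 'h) \<Rightarrow> ('u \<Rightarrow>\<^sub>L 'h)) \<Rightarrow> 'h measure \<Rightarrow> bool" where
  "pathwise_uniqueness_given (_ :: 'w itself) iV iE J e b \<sigma> \<mu> \<longleftrightarrow>
     (\<forall>(M :: 'w measure) F X Y W.
        weak_solution iV iE J e b \<sigma> M F X W \<and> weak_solution iV iE J e b \<sigma> M F Y W \<and>
        distr M borel (\<lambda>\<omega>. X \<omega> 0) = \<mu> \<and> distr M borel (\<lambda>\<omega>. Y \<omega> 0) = \<mu> \<and>
        (AE \<omega> in M. X \<omega> 0 = Y \<omega> 0) \<longrightarrow>
        (AE \<omega> in M. \<forall>t\<ge>0. X \<omega> t = Y \<omega> t))"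

definition pathwise_uniqueness ::
  "'w itself \<Rightarrow> ('v::real_normed_vector \<Rightarrow> 'h::real_inner) \<Rightarrow>
   ('h \<Rightarrow> 'e::{banach, second_countable_topology}) \<Rightarrow>
   ('u::real_inner \<Rightarrow> 'k::real_inner) \<Rightarrow> (nat \<Rightarrow> 'u) \<Rightarrow>
   (real \<Rightarrow> (real \<Rightarrow> 'h) \<Rightarrow> 'e) \<Rightarrow> (real \<Rightarrow> (real \<Rightarrow> 'h) \<Rightarrow> ('u \<Rightarrow>\<^sub>L 'h)) \<Rightarrow> bool" where
  "pathwise_uniqueness (_ :: 'w itself) iV iE J e b \<sigma> \<longleftrightarrow>
     (\<forall>(M :: 'w measure) F X Y W.
        weak_solution iV iE J e b \<sigma> M F X W \<and> weak_solution iV iE J e b \<sigma> M F Y W \<and>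
        (AE \<omega> in M. X \<omega> 0 = Y \<omega> 0) \<longrightarrow>
        (AE \<omega> in M. \<forall>t\<ge>0. X \<omega> t = Y \<omega> t))"

text \<open>
  S is a map in the class in which strong solutions are sought, S' a choice of the maps associated
  with it, one for each initial law \<mu>.
\<close>
definition solution_map ::
  "('v::real_normed_vector \<Rightarrow> 'h::real_inner) \<Rightarrow> ('u \<Rightarrow> 'k::real_inner) \<Rightarrow> (nat \<Rightarrow> 'u) \<Rightarrow>
   ('h \<Rightarrow> (real \<Rightarrow> 'k) \<Rightarrow> real \<Rightarrow> 'h) \<Rightarrow> ('h measure \<Rightarrow> 'h \<Rightarrow> (real \<Rightarrow> 'k) \<Rightarrow> real \<Rightarrow> 'h) \<Rightarrow> bool" where
  "solution_map iV J e S S' \<longleftrightarrow>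
     (\<forall>h. \<forall>w\<in>wiener_space. S h w \<in> path_space iV) \<and>
     (\<forall>\<mu>. prob_space \<mu> \<and> sets \<mu> = sets borel \<longrightarrow>
        (\<lambda>(h, w). S' \<mu> h w) \<in> completion (\<mu> \<Otimes>\<^sub>M wiener_law J e) \<rightarrow>\<^sub>M path_borel iV \<and>
        (AE h in \<mu>. AE w in wiener_law J e. S h w = S' \<mu> h w))"

text \<open>The completion of the coordinate sigma-algebra at time t by all null sets of the law P on
  the full Borel sigma-algebra.\<close>
definition completed_wiener_algebra :: "(real \<Rightarrow> 'k::real_normed_vector) measure \<Rightarrow> real \<Rightarrow> (real \<Rightarrow> 'k) measure" where
  "completed_wiener_algebra P t =
     sigma wiener_space (sets (coordinate_algebra wiener_space t) \<union> null_sets (completion P))"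

definition has_strong_solution ::
  "'w itself \<Rightarrow> ('v::real_normed_vector \<Rightarrow> 'h::real_inner) \<Rightarrow>
   ('h \<Rightarrow> 'e::{banach, second_countable_topology}) \<Rightarrow>
   ('u::real_inner \<Rightarrow> 'k::real_inner) \<Rightarrow> (nat \<Rightarrow> 'u) \<Rightarrow>
   (real \<Rightarrow> (real \<Rightarrow> 'h) \<Rightarrow> 'e) \<Rightarrow> (real \<Rightarrow> (real \<Rightarrow> 'h) \<Rightarrow> ('u \<Rightarrow>\<^sub>L 'h)) \<Rightarrow> bool" where
  "has_strong_solution (_ :: 'w itself) iV iE J e b \<sigma> \<longleftrightarrow>
     (\<exists>S S'. solution_map iV J e S S' \<and>
        (\<forall>h. \<forall>t\<ge>0. S h \<in> completed_wiener_algebra (wiener_law J e) t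
                       \<rightarrow>\<^sub>M coordinate_algebra (path_space iV) t) \<and>
        (\<forall>(M :: 'w measure) F W \<xi>.
           stochastic_basis M F \<and> wiener_process M F W \<and> \<xi> \<in> borel_measurable (F 0) \<longrightarrow>
           (let X = (\<lambda>\<omega>. S' (distr M borel \<xi>) (\<xi> \<omega>) (cyl_wiener J e W \<omega>)) in
             weak_solution iV iE J e b \<sigma> M F X W \<and> (AE \<omega> in M. X \<omega> 0 = \<xi> \<omega>))))"

end

theory Submission
  imports Defs
begin

text \<open>
  Why the theorem holds. Let \<open>X\<close> be a weak solution with initial law \<open>\<mu>\<close>, driven by \<open>W\<close>, let
  \<open>\<xi> = X 0\<close>, let \<open>C\<close> be the cylindrical process of \<open>W\<close>, and let \<open>Z = S \<xi> C\<close> be the strong solution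
  built from the same initial value and the same noise. Both \<open>(X, W)\<close> and \<open>(Z, W)\<close> are weak solutions
  with initial law \<open>\<mu>\<close>, so joint uniqueness in law gives \<open>(X, C)\<close> and \<open>(Z, C)\<close> the same law. But \<open>Z\<close>
  is almost surely a function of \<open>(Z 0, C)\<close>, and this is a property of the law of \<open>(Z, C)\<close>; hence \<open>X\<close>
  is almost surely the same function of \<open>(X 0, C)\<close>, that is \<open>X = Z\<close>. A second solution \<open>Y\<close> with the
  same noise and the same initial value equals the same \<open>Z\<close>, so \<open>X = Y\<close>
  (\<open>weak_solution_eq_functional\<close>).

  To make this precise, the solution map has to be evaluated along \<open>(\<xi>, C)\<close>, although it is only
  measurable for the completion of \<open>\<mu> \<Otimes> P\<close>, where \<open>P\<close> is the Wiener law. One therefore needs that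
  \<open>(\<xi>, C)\<close> has law \<open>\<mu> \<Otimes> P\<close> (\<open>law_initial_cyl_wiener\<close>, \<open>wiener_law_eq\<close>). This takes most of the work.

  The definition of a Wiener process asks that each single \<open>W k\<close> be a Brownian motion for the filtration
  and that the \<open>W k\<close> be independent of each other; it does not ask that the whole family be independent
  of the past. That stronger property is derived as in Levy's characterisation. Conditionally on the
  past, increments of \<open>W k\<close> and \<open>W l\<close> over the same interval are uncorrelated, because their product has
  the same conditional mean as the sum of products over a fine partition, which is small in mean square
  (\<open>orthogonal_increments\<close>). A second order expansion of the characteristic function on each interval
  of a fine partition then yields the conditional joint characteristic function of the increments
  (\<open>joint_char_increments\<close>), and Levy's uniqueness theorem turns it into a product formula for
  probabilities (\<open>indep_step\<close>). Iterating over the dyadic grid determines the law of all dyadic values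
  of \<open>W\<close>, also after conditioning on an event at time zero (\<open>gaussian_grid_conditioned\<close>,
  \<open>law_dyadic_values_unique\<close>); and the cylindrical process is a measurable function of those values
  (\<open>path_sum_preimage\<close>).

  The Wiener law is a definite description over bases on one fixed sample type. It is
  matched with the law of \<open>C\<close> by transporting the given basis to that type along \<open>W\<close>
  (\<open>canonical_wiener_basis\<close>) and by the uniqueness of the law.
\<close>

section \<open>Measurability of maps into the Wiener path space\<close>

lemma dyadic_approx:
  fixes t :: real
  assumes "0 \<le> t"
  shows "(\<lambda>l. real (nat \<lfloor>t * 2 ^ l\<rfloor>) / 2 ^ l) \<longlonglongrightarrow> t"
    and "real (nat \<lfloor>t * 2 ^ l\<rfloor>) / 2 ^ l \<le> t"
proof -
  have eq: "real (nat \<lfloor>t * 2 ^ l\<rfloor>) = of_int \<lfloor>t * 2 ^ l\<rfloor>" for l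
    using assms by simp
  have up: "real (nat \<lfloor>t * 2 ^ l\<rfloor>) / 2 ^ l \<le> t" for l
    unfolding eq by (simp add: pos_divide_le_eq)
  then show "real (nat \<lfloor>t * 2 ^ l\<rfloor>) / 2 ^ l \<le> t" .
  have low: "t - (1 / 2) ^ l \<le> real (nat \<lfloor>t * 2 ^ l\<rfloor>) / 2 ^ l" for l
  proof -
    have "t * 2 ^ l - 1 \<le> of_int \<lfloor>t * 2 ^ l\<rfloor>" by linarith
    then have "(t * 2 ^ l - 1) / 2 ^ l \<le> real (nat \<lfloor>t * 2 ^ l\<rfloor>) / 2 ^ l"
      unfolding eq by (intro divide_right_mono) auto
    then show ?thesis by (simp add: diff_divide_distrib power_divide)
  qed
  have lim: "(\<lambda>l. t - (1 / 2) ^ l) \<longlonglongrightarrow> t"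
    using tendsto_diff[OF tendsto_const LIMSEQ_power_zero, of "1 / 2 :: real" t] by simp
  show "(\<lambda>l. real (nat \<lfloor>t * 2 ^ l\<rfloor>) / 2 ^ l) \<longlonglongrightarrow> t"
    by (rule tendsto_sandwich[OF always_eventually always_eventually lim tendsto_const]) (use low up in auto)
qed

text \<open>
  Bounds on continuous functions only need to be checked at dyadic times. This is the bridge between
  path properties and countably many coordinates.
\<close>
lemma le_from_dyadic:
  fixes f :: "real \<Rightarrow> real"
  assumes f: "continuous_on {0..} f" and le: "\<And>l j. real j / 2 ^ l \<le> T \<Longrightarrow> f (real j / 2 ^ l) \<le> c"
    and t: "0 \<le> t" "t \<le> T"
  shows "f t \<le> c"
proof (rule LIMSEQ_le_const2)
  show "(\<lambda>l. f (real (nat \<lfloor>t * 2 ^ l\<rfloor>) / 2 ^ l)) \<longlonglongrightarrow> f t"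
    using t by (intro continuous_on_tendsto_compose[OF f dyadic_approx(1)]) auto
  show "\<exists>N. \<forall>l\<ge>N. f (real (nat \<lfloor>t * 2 ^ l\<rfloor>) / 2 ^ l) \<le> c"
    using order_trans[OF dyadic_approx(2)[OF t(1)] t(2)] le by blast
qed

lemma continuous_on_halfline:
  fixes f :: "real \<Rightarrow> 'a::topological_space"
  assumes "\<And>T. 0 \<le> T \<Longrightarrow> continuous_on {0..T} f"
  shows "continuous_on {0..} f"
  unfolding continuous_on_def
proof
  fix t :: real assume t: "t \<in> {0..}"
  have "at t within {0..} = at t within {0..t+1}"
    by (rule at_within_nhd[of _ "{..<t+1}"]) auto
  moreover have "(f \<longlongrightarrow> f t) (at t within {0..t+1})"
    using assms[of "t+1"] t by (auto simp: continuous_on_def)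
  ultimately show "(f \<longlongrightarrow> f t) (at t within {0..})" by simp
qed

text \<open>
  Paths that are uniformly close on a long interval are close; the time after \<open>m\<close> contributes at most
  the tail of the geometric series.
\<close>
lemma wiener_dist_le:
  fixes w w' :: "real \<Rightarrow> 'k::real_normed_vector"
  assumes w: "w \<in> wiener_space" "w' \<in> wiener_space"
    and le: "\<And>t. 0 \<le> t \<Longrightarrow> t \<le> real m \<Longrightarrow> norm (w' t - w t) \<le> \<delta>"
  shows "wiener_dist w w' \<le> \<delta> + (1 / 2) ^ m"
proof -
  define s where "s k = (SUP t\<in>{0..real k}. norm (w' t - w t))" for k :: nat
  define a where "a j = (1/2) ^ Suc j * min 1 (s (Suc j))" for j
  have \<delta>: "0 \<le> \<delta>" using order_trans[OF norm_ge_zero le[of 0]] by simp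
  have bdd: "bdd_above ((\<lambda>t. norm (w' t - w t)) ` {0..real k})" for k
  proof -
    have "continuous_on {0..real k} (\<lambda>t. norm (w' t - w t))"
      using w unfolding wiener_space_def
      by (intro continuous_intros) (auto intro: continuous_on_subset)
    then have "compact ((\<lambda>t. norm (w' t - w t)) ` {0..real k})"
      by (rule compact_continuous_image) simp
    then show ?thesis by (rule bounded_imp_bdd_above[OF compact_imp_bounded])
  qed
  have s0: "0 \<le> s k" for k
  proof -
    have "norm (w' 0 - w 0) \<le> s k"
      unfolding s_def by (rule cSUP_upper[OF _ bdd]) simp
    then show ?thesis by (rule order_trans[OF norm_ge_zero])
  qed
  have s1: "s k \<le> \<delta>" if "k \<le> m" for k
    unfolding s_def using that by (intro cSUP_least le) auto
  have a0: "0 \<le> a j" and a1: "a j \<le> (1/2) ^ Suc j" for j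
    using s0[of "Suc j"] unfolding a_def by (auto intro!: mult_left_le)
  have half: "(\<lambda>j. (1/2 :: real) ^ Suc j) sums 1" by (rule power_half_series)
  have sa: "summable a"
    using a0 a1 by (intro summable_comparison_test'[OF sums_summable[OF half], of 0]) auto
  have "wiener_dist w w' = suminf a"
    unfolding wiener_dist_def a_def s_def Let_def ..
  also have "\<dots> = (\<Sum>j. a (j + m)) + (\<Sum>j<m. a j)"
    by (rule suminf_split_initial_segment[OF sa])
  also have "(\<Sum>j<m. a j) \<le> (\<Sum>j<m. (1/2) ^ Suc j * \<delta>)"
    unfolding a_def using s1 by (intro sum_mono mult_left_mono) (auto intro: min.coboundedI2)
  also have "\<dots> \<le> 1 * \<delta>"
    unfolding sum_distrib_right[symmetric]
  proof (rule mult_right_mono[OF _ \<delta>])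
    have "(\<Sum>j<m. (1/2 :: real) ^ Suc j) \<le> (\<Sum>j. (1/2) ^ Suc j)"
      by (rule sum_le_suminf[OF sums_summable[OF half]]) simp_all
    then show "(\<Sum>j<m. (1/2 :: real) ^ Suc j) \<le> 1" using sums_unique[OF half] by simp
  qed
  also have "(\<Sum>j. a (j + m)) \<le> (\<Sum>j. (1/2) ^ m * (1/2) ^ Suc j)"
  proof (rule suminf_le)
    show "a (j + m) \<le> (1/2) ^ m * (1/2) ^ Suc j" for j
      using a1[of "j + m"] by (simp add: power_add algebra_simps)
    show "summable (\<lambda>j. a (j + m))" using sa by (simp add: summable_iff_shift)
    show "summable (\<lambda>j. (1/2 :: real) ^ m * (1/2) ^ Suc j)"
      using half by (intro summable_mult) (simp add: sums_iff)
  qed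
  also have "\<dots> = (1/2) ^ m"
    using sums_mult[OF half, of "(1/2) ^ m"] by (simp add: sums_iff)
  finally show ?thesis by simp
qed

text \<open>
  The paths whose values on each dyadic interval of length \<open>1 / 2 ^ N\<close> up to time \<open>m\<close> stay within
  \<open>1 / m\<close> of the corresponding entry of \<open>q\<close>. Only dyadic times are tested, so that membership depends
  on countably many coordinates. With \<open>q\<close> ranging over lists in a countable dense set, the tubes form
  a countable family of sets of small diameter that covers the space, and every open set is a union of
  tubes (\<open>tube_diameter\<close>, \<open>in_some_tube\<close>).
\<close>
definition tube :: "nat \<Rightarrow> nat \<Rightarrow> 'k::real_normed_vector list \<Rightarrow> (real \<Rightarrow> 'k) set" where
  "tube m N q = {w \<in> wiener_space. \<forall>i<m * 2 ^ N. \<forall>l j.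
     real i / 2 ^ N \<le> real j / 2 ^ l \<and> real j / 2 ^ l \<le> real (Suc i) / 2 ^ N \<longrightarrow>
     norm (w (real j / 2 ^ l) - q ! i) \<le> 1 / real m}"

lemma tube_diameter:
  assumes m: "m > 0" and w: "w \<in> tube m N q" "w' \<in> tube m N q"
  shows "wiener_dist w w' \<le> 2 / real m + (1 / 2) ^ m"
proof (rule wiener_dist_le)
  show ws: "w \<in> wiener_space" "w' \<in> wiener_space" using w by (auto simp: tube_def)
  fix t :: real assume t: "0 \<le> t" "t \<le> real m"
  show "norm (w' t - w t) \<le> 2 / real m"
  proof (rule le_from_dyadic[where f="\<lambda>t. norm (w' t - w t)", OF _ _ t])
    show "continuous_on {0..} (\<lambda>t. norm (w' t - w t))"
      using ws by (intro continuous_intros) (auto simp: wiener_space_def)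
    fix l j :: nat
    define r where "r = real j / 2 ^ l"
    assume "real j / 2 ^ l \<le> real m"
    then have r: "0 \<le> r" "r \<le> real m" by (auto simp: r_def)
    have "\<exists>i<m * 2 ^ N. real i / 2 ^ N \<le> r \<and> r \<le> real (Suc i) / 2 ^ N"
    proof (cases "r = real m")
      case True
      have "m * 2 ^ N \<noteq> 0" using m by simp
      then obtain i where i: "m * 2 ^ N = Suc i" using not0_implies_Suc by blast
      have "real (m * 2 ^ N) = real (Suc i)" using i by simp
      then have "real m * 2 ^ N = real (Suc i)" by simp
      then have "r = real (Suc i) / 2 ^ N" by (simp add: True field_simps)
      moreover have "real i / 2 ^ N \<le> real (Suc i) / 2 ^ N" by (intro divide_right_mono) auto
      ultimately show ?thesis using i by (intro exI[of _ i]) auto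
    next
      case False
      define i where "i = nat \<lfloor>r * 2 ^ N\<rfloor>"
      have i: "real i \<le> r * 2 ^ N" "r * 2 ^ N \<le> real (Suc i)"
        using r unfolding i_def by (auto simp: of_nat_nat) linarith
      have "r * 2 ^ N < real m * 2 ^ N" using False r by simp
      then have "real i < real m * 2 ^ N" using i(1) by linarith
      then have "real i < real (m * 2 ^ N)" by simp
      then have "i < m * 2 ^ N" by linarith
      then show ?thesis using i by (intro exI[of _ i]) (simp add: field_simps)
    qed
    then obtain i where i: "i < m * 2 ^ N" "real i / 2 ^ N \<le> r" "r \<le> real (Suc i) / 2 ^ N" by blast
    have "norm (w r - q ! i) \<le> 1 / real m" "norm (w' r - q ! i) \<le> 1 / real m"
      using w i unfolding tube_def r_def by blast+
    then have "norm ((w' r - q ! i) - (w r - q ! i)) \<le> 1 / real m + 1 / real m"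
      by (intro norm_triangle_le_diff) linarith
    then show "norm (w' (real j / 2 ^ l) - w (real j / 2 ^ l)) \<le> 2 / real m"
      by (simp add: r_def)
  qed
qed

lemma in_some_tube:
  fixes w :: "real \<Rightarrow> 'k::real_normed_vector"
  assumes m: "m > 0" and w: "w \<in> wiener_space"
    and D: "\<And>X :: 'k set. open X \<Longrightarrow> X \<noteq> {} \<Longrightarrow> \<exists>d\<in>D. d \<in> X"
  shows "\<exists>N. \<exists>q\<in>lists D. w \<in> tube m N q"
proof -
  let ?\<epsilon> = "1 / (2 * real m)"
  have e: "?\<epsilon> > 0" using m by simp
  have "continuous_on {0..real m} w"
    using w by (auto simp: wiener_space_def intro: continuous_on_subset)
  then have "uniformly_continuous_on {0..real m} w"
    by (intro compact_uniformly_continuous) auto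
  then have "\<exists>d>0. \<forall>t\<in>{0..real m}. \<forall>t'\<in>{0..real m}. dist t' t < d \<longrightarrow> dist (w t') (w t) < ?\<epsilon>"
    using e unfolding uniformly_continuous_on_def by simp
  then obtain d where d: "d > 0" "\<And>t t'. t \<in> {0..real m} \<Longrightarrow> t' \<in> {0..real m} \<Longrightarrow> dist t' t < d \<Longrightarrow> dist (w t') (w t) < ?\<epsilon>"
    by blast
  obtain N where N: "(1/2 :: real) ^ N < d" using real_arch_pow_inv[OF d(1), of "1/2"] by auto
  have "\<exists>y\<in>D. dist (w (real i / 2 ^ N)) y < ?\<epsilon>" for i
    using D[of "ball (w (real i / 2 ^ N)) ?\<epsilon>"] e by auto
  then obtain y where y: "\<And>i. y i \<in> D" "\<And>i. dist (w (real i / 2 ^ N)) (y i) < ?\<epsilon>" by metis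
  define q where "q = map y [0..<m * 2 ^ N]"
  have "w \<in> tube m N q"
    unfolding tube_def
  proof (intro CollectI conjI w allI impI)
    fix i l j :: nat
    assume i: "i < m * 2 ^ N" and "real i / 2 ^ N \<le> real j / 2 ^ l \<and> real j / 2 ^ l \<le> real (Suc i) / 2 ^ N"
    moreover define r where "r = real j / 2 ^ l"
    ultimately have r: "real i / 2 ^ N \<le> r" "r \<le> real (Suc i) / 2 ^ N" by auto
    have "real (Suc i) \<le> real (m * 2 ^ N)" using i by (simp only: of_nat_le_iff Suc_le_eq)
    then have "real (Suc i) / 2 ^ N \<le> real m" by (simp add: field_simps)
    then have rm: "r \<in> {0..real m}" "real i / 2 ^ N \<in> {0..real m}"
      using r by (auto simp: r_def) 
    have "r - real i / 2 ^ N \<le> (1/2) ^ N"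
    proof -
      have "real (Suc i) / 2 ^ N = real i / 2 ^ N + (1/2) ^ N"
        by (simp add: add_divide_distrib power_divide)
      then show ?thesis using r(2) by linarith
    qed
    then have "dist r (real i / 2 ^ N) < d"
      using r(1) N by (simp add: dist_real_def)
    then have "dist (w r) (w (real i / 2 ^ N)) < ?\<epsilon>" using d(2) rm by blast
    then have "dist (w r) (y i) \<le> ?\<epsilon> + ?\<epsilon>"
      using dist_triangle[of "w r" "y i" "w (real i / 2 ^ N)"] y(2)[of i] by linarith
    then show "norm (w (real j / 2 ^ l) - q ! i) \<le> 1 / real m"
      using i by (simp add: q_def r_def dist_norm)
  qed
  then show ?thesis using y(1) by (intro exI[of _ N] bexI[of _ q]) (auto simp: q_def lists_eq_set)
qed

lemma space_wiener_borel [simp]: "space wiener_borel = wiener_space"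
  unfolding wiener_borel_def metric_borel_def by (intro space_measure_of) auto

text \<open>
  The Borel sigma-algebra of the path space is generated by the coordinates at dyadic times.
\<close>
lemma measurable_wiener_borel:
  fixes f :: "'a \<Rightarrow> real \<Rightarrow> 'k::{real_normed_vector, second_countable_topology}"
  assumes f: "\<And>x. x \<in> space N \<Longrightarrow> f x \<in> wiener_space"
    and m: "\<And>l j. (\<lambda>x. f x (real j / 2 ^ l)) \<in> borel_measurable N"
  shows "f \<in> N \<rightarrow>\<^sub>M wiener_borel"
  unfolding wiener_borel_def metric_borel_def
proof (rule measurable_measure_of)
  show "f \<in> space N \<rightarrow> wiener_space" using f by auto
  fix U :: "(real \<Rightarrow> 'k) set"
  assume "U \<in> {U. U \<subseteq> wiener_space \<and> (\<forall>x\<in>U. \<exists>r>0. \<forall>y\<in>wiener_space. wiener_dist x y < r \<longrightarrow> y \<in> U)}"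
  then have U: "U \<subseteq> wiener_space" "\<And>x. x \<in> U \<Longrightarrow> \<exists>r>0. \<forall>y\<in>wiener_space. wiener_dist x y < r \<longrightarrow> y \<in> U"
    by auto
  obtain D :: "'k set" where D: "countable D" "\<And>X. open X \<Longrightarrow> X \<noteq> {} \<Longrightarrow> \<exists>d\<in>D. d \<in> X"
    using countable_dense_exists by blast
  define I where "I = {(m, N, q). q \<in> lists D \<and> tube m N q \<subseteq> U}"
  have "I \<subseteq> UNIV \<times> UNIV \<times> lists D" by (auto simp: I_def)
  then have cI: "countable I"
    by (rule countable_subset) (intro countable_SIGMA countable_lists D(1), auto)
  have "U = (\<Union>(m, N, q)\<in>I. tube m N q)"
  proof (intro equalityI subsetI)
    fix w assume w: "w \<in> U"
    from U(2)[OF w] obtain r where r: "r > 0" "\<And>y. y \<in> wiener_space \<Longrightarrow> wiener_dist w y < r \<Longrightarrow> y \<in> U" by blast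
    obtain m where m: "m > 0" "2 / real m + (1 / 2) ^ m < r"
    proof -
      have "(\<lambda>m. 2 / real m + (1 / 2) ^ m) \<longlonglongrightarrow> 0 + 0"
        by (intro tendsto_add LIMSEQ_power_zero tendsto_divide_0[OF tendsto_const]
            filterlim_at_top_imp_at_infinity filterlim_real_sequentially) simp
      then have "\<forall>\<^sub>F m in sequentially. 2 / real m + (1 / 2) ^ m < r"
        using r(1) by (intro order_tendstoD) auto
      then have "\<forall>\<^sub>F m in sequentially. m > 0 \<and> 2 / real m + (1 / 2) ^ m < r"
        using eventually_gt_at_top[of 0] by eventually_elim auto
      then show thesis using that eventually_happens'[OF sequentially_bot] by blast
    qed
    obtain N q where q: "q \<in> lists D" "w \<in> tube m N q"
      using in_some_tube[OF m(1) _ D(2)] w U(1) by blast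
    have "tube m N q \<subseteq> U"
    proof
      fix w' assume w': "w' \<in> tube m N q"
      then show "w' \<in> U"
        using tube_diameter[OF m(1) q(2) w'] m(2) by (intro r(2)) (auto simp: tube_def)
    qed
    then show "w \<in> (\<Union>(m, N, q)\<in>I. tube m N q)" using q by (auto simp: I_def)
  qed (auto simp: I_def)
  then have "f -` U \<inter> space N = (\<Union>(m, N', q)\<in>I. {x \<in> space N. f x \<in> tube m N' q})"
    by auto
  moreover have "{x \<in> space N. f x \<in> tube k N' q} \<in> sets N" for k N' q
  proof -
    note [measurable] = m
    have "{x \<in> space N. f x \<in> tube k N' q} = {x \<in> space N. \<forall>i<k * 2 ^ N'. \<forall>l j.
     real i / 2 ^ N' \<le> real j / 2 ^ l \<and> real j / 2 ^ l \<le> real (Suc i) / 2 ^ N' \<longrightarrow>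
     norm (f x (real j / 2 ^ l) - q ! i) \<le> 1 / real k}"
      using f by (auto simp: tube_def)
    also have "\<dots> \<in> sets N" by measurable
    finally show ?thesis .
  qed
  ultimately show "f -` U \<inter> space N \<in> sets N"
    using cI by (auto intro!: sets.countable_UN')
qed auto

section \<open>The cylindrical process as a function of the driving paths\<close>

text \<open>
  The possible values of a family of driving motions, seen as a function of index and time. Nothing is
  required at negative times.
\<close>
definition start_zero_paths :: "(nat \<Rightarrow> real \<Rightarrow> real) set" where
  "start_zero_paths = {x. \<forall>k. x k 0 = 0 \<and> continuous_on {0..} (x k)}"

text \<open>
  The cylindrical process as a deterministic function of the driving paths: \<open>cyl_wiener\<close> for the
  coordinate process.
\<close>
definition path_sum :: "('u \<Rightarrow> 'k::real_normed_vector) \<Rightarrow> (nat \<Rightarrow> 'u) \<Rightarrow> (nat \<Rightarrow> real \<Rightarrow> real) \<Rightarrow> real \<Rightarrow> 'k" where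
  "path_sum J e x = cyl_wiener J e (\<lambda>k t x. x k t) x"

lemma cyl_wiener_path_sum: "cyl_wiener J e W \<omega> = path_sum J e (\<lambda>k t. W k t \<omega>)"
proof -
  have "cyl_limit J e W \<omega> = cyl_limit J e (\<lambda>k t x. x k t) (\<lambda>k t. W k t \<omega>)"
    by (simp add: cyl_limit_def fun_eq_iff)
  then show ?thesis unfolding path_sum_def cyl_wiener_def by presburger
qed

text \<open>
  Locally uniform convergence of the partial sums is a Cauchy condition at dyadic times, hence an event
  that is determined by countably many coordinates.
\<close>
lemma cyl_limit_iff:
  fixes J :: "'u \<Rightarrow> 'k::banach" and e :: "nat \<Rightarrow> 'u" and x :: "nat \<Rightarrow> real \<Rightarrow> real"
  assumes x: "x \<in> start_zero_paths"
  defines "S \<equiv> \<lambda>n t. \<Sum>k<n. x k t *\<^sub>R J (e k)"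
  shows "cyl_limit J e (\<lambda>k t x. x k t) x w \<longleftrightarrow>
    w = (\<lambda>t\<in>{0..}. lim (\<lambda>n. S n t)) \<and>
    (\<forall>m i :: nat. \<exists>n0. \<forall>n\<ge>n0. \<forall>n'\<ge>n0. \<forall>l j. real j / 2 ^ l \<le> real m \<longrightarrow>
       norm (S n (real j / 2 ^ l) - S n' (real j / 2 ^ l)) \<le> 1 / real (Suc i))"
    (is "_ \<longleftrightarrow> _ \<and> ?C")
proof
  assume "cyl_limit J e (\<lambda>k t x. x k t) x w"
  then have w: "w \<in> wiener_space" and u: "\<And>T. 0 \<le> T \<Longrightarrow> uniform_limit {0..T} S w sequentially"
    unfolding cyl_limit_def S_def by simp_all
  have "lim (\<lambda>n. S n t) = w t" if "0 \<le> t" for t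
    using tendsto_uniform_limitI[OF u[OF that], of t] that by (intro limI) auto
  then have "w = (\<lambda>t\<in>{0..}. lim (\<lambda>n. S n t))"
    using w by (auto simp: wiener_space_def fun_eq_iff extensional_def)
  moreover have ?C
  proof (intro allI)
    fix m i :: nat
    have "uniformly_Cauchy_on {0..real m} S"
      using u[of "real m"] by (auto intro!: uniformly_convergent_Cauchy simp: uniformly_convergent_on_def)
    then obtain n0 where n0: "\<forall>t\<in>{0..real m}. \<forall>n\<ge>n0. \<forall>n'\<ge>n0. dist (S n t) (S n' t) < 1 / real (Suc i)"
      unfolding uniformly_Cauchy_on_def by (metis of_nat_0_less_iff zero_less_Suc zero_less_divide_1_iff)
    show "\<exists>n0. \<forall>n\<ge>n0. \<forall>n'\<ge>n0. \<forall>l j. real j / 2 ^ l \<le> real m \<longrightarrow>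
       norm (S n (real j / 2 ^ l) - S n' (real j / 2 ^ l)) \<le> 1 / real (Suc i)"
      using n0 by (intro exI[of _ n0]) (auto simp: dist_norm intro!: less_imp_le)
  qed
  ultimately show "w = (\<lambda>t\<in>{0..}. lim (\<lambda>n. S n t)) \<and> ?C" by blast
next
  assume R: "w = (\<lambda>t\<in>{0..}. lim (\<lambda>n. S n t)) \<and> ?C"
  have Rw: "w = (\<lambda>t\<in>{0..}. lim (\<lambda>n. S n t))" using R ..
  have contS: "continuous_on {0..} (S n)" for n
    using x unfolding S_def start_zero_paths_def by (intro continuous_intros) auto
  have u: "uniform_limit {0..T} S w sequentially" if "0 \<le> T" for T
  proof -
    obtain m :: nat where m: "T \<le> real m" using real_arch_simple by blast
    have "uniformly_Cauchy_on {0..real m} S"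
      unfolding uniformly_Cauchy_on_def
    proof (intro allI impI)
      fix \<epsilon> :: real assume "\<epsilon> > 0"
      then obtain i where i: "1 / real (Suc i) < \<epsilon>"
        using nat_approx_posE by blast
      from R[THEN conjunct2, THEN spec, of m, THEN spec, of i]
      obtain n0 where "\<forall>n\<ge>n0. \<forall>n'\<ge>n0. \<forall>l j. real j / 2 ^ l \<le> real m \<longrightarrow>
         norm (S n (real j / 2 ^ l) - S n' (real j / 2 ^ l)) \<le> 1 / real (Suc i)" ..
      then have n0: "\<And>n n' l j. n \<ge> n0 \<Longrightarrow> n' \<ge> n0 \<Longrightarrow> real j / 2 ^ l \<le> real m \<Longrightarrow>
         norm (S n (real j / 2 ^ l) - S n' (real j / 2 ^ l)) \<le> 1 / real (Suc i)" by simp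
      have "dist (S n t) (S n' t) < \<epsilon>" if "t \<in> {0..real m}" "n \<ge> n0" "n' \<ge> n0" for n n' t
      proof -
        have "norm (S n t - S n' t) \<le> 1 / real (Suc i)"
        proof (rule le_from_dyadic[where f="\<lambda>t. norm (S n t - S n' t)" and T="real m"])
          show "continuous_on {0..} (\<lambda>t. norm (S n t - S n' t))"
            by (intro continuous_on_norm continuous_on_diff contS)
          show "norm (S n (real j / 2 ^ l) - S n' (real j / 2 ^ l)) \<le> 1 / real (Suc i)"
            if "real j / 2 ^ l \<le> real m" for l j
            using n0 that \<open>n \<ge> n0\<close> \<open>n' \<ge> n0\<close> by blast
        qed (use \<open>t \<in> {0..real m}\<close> in simp_all)
        then show ?thesis using i by (simp add: dist_norm)
      qed
      then show "\<exists>M. \<forall>t\<in>{0..real m}. \<forall>n\<ge>M. \<forall>n'\<ge>M. dist (S n t) (S n' t) < \<epsilon>" by blast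
    qed
    then have "uniformly_convergent_on {0..real m} S" by (rule Cauchy_uniformly_convergent)
    then have "uniform_limit {0..real m} S (\<lambda>t. lim (\<lambda>n. S n t)) sequentially"
      by (simp add: uniformly_convergent_uniform_limit_iff)
    then have "uniform_limit {0..T} S (\<lambda>t. lim (\<lambda>n. S n t)) sequentially"
      by (rule uniform_limit_on_subset) (use m in auto)
    then show ?thesis
      unfolding Rw by (subst uniform_limit_cong'[where g=S and i="\<lambda>t. lim (\<lambda>n. S n t)"]) simp_all
  qed
  have "continuous_on {0..T} w" if "0 \<le> T" for T
    by (rule uniform_limit_theorem[OF _ u[OF that]])
      (auto intro!: always_eventually continuous_on_subset[OF contS])
  then have "continuous_on {0..} w" by (rule continuous_on_halfline)
  moreover have "S n 0 = 0" for n using x by (simp add: S_def start_zero_paths_def)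
  then have "w 0 = 0" by (simp add: Rw)
  ultimately have "w \<in> wiener_space" by (simp add: wiener_space_def Rw)
  then show "cyl_limit J e (\<lambda>k t x. x k t) x w" using u by (simp add: cyl_limit_def S_def)
qed

text \<open>
  The partial sums are locally uniformly Cauchy, expressed at dyadic times.
\<close>
definition path_sum_cauchy :: "('u \<Rightarrow> 'k::real_normed_vector) \<Rightarrow> (nat \<Rightarrow> 'u) \<Rightarrow> (nat \<Rightarrow> real \<Rightarrow> real) \<Rightarrow> bool" where
  "path_sum_cauchy J e x \<longleftrightarrow> (\<forall>m i :: nat. \<exists>n0. \<forall>n\<ge>n0. \<forall>n'\<ge>n0. \<forall>l j. real j / 2 ^ l \<le> real m \<longrightarrow>
     norm ((\<Sum>k<n. x k (real j / 2 ^ l) *\<^sub>R J (e k)) - (\<Sum>k<n'. x k (real j / 2 ^ l) *\<^sub>R J (e k))) \<le> 1 / real (Suc i))"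

lemma
  fixes J :: "'u \<Rightarrow> 'k::banach" and e :: "nat \<Rightarrow> 'u" and x :: "nat \<Rightarrow> real \<Rightarrow> real"
  assumes x: "x \<in> start_zero_paths"
  shows path_sum_in_wiener_space: "path_sum J e x \<in> wiener_space"
    and path_sum_eq: "path_sum J e x = (\<lambda>t\<in>{0..}.
      if path_sum_cauchy J e x then lim (\<lambda>n. \<Sum>k<n. x k t *\<^sub>R J (e k)) else 0)"
proof -
  let ?L = "\<lambda>t\<in>{0..}. lim (\<lambda>n. \<Sum>k<n. x k t *\<^sub>R J (e k))"
  have iff: "cyl_limit J e (\<lambda>k t x. x k t) x w \<longleftrightarrow> w = ?L \<and> path_sum_cauchy J e x" for w
    unfolding path_sum_cauchy_def by (rule cyl_limit_iff[OF x])
  have eq: "path_sum J e x = (if path_sum_cauchy J e x then ?L else (\<lambda>t\<in>{0..}. 0))"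
    unfolding path_sum_def cyl_wiener_def iff by (cases "path_sum_cauchy J e x") simp_all
  then show "path_sum J e x = (\<lambda>t\<in>{0..}. if path_sum_cauchy J e x then lim (\<lambda>n. \<Sum>k<n. x k t *\<^sub>R J (e k)) else 0)"
    by (cases "path_sum_cauchy J e x") simp_all
  show "path_sum J e x \<in> wiener_space"
  proof (cases "path_sum_cauchy J e x")
    case True
    then have "cyl_limit J e (\<lambda>k t x. x k t) x (path_sum J e x)" by (simp add: iff eq)
    then show ?thesis by (simp add: cyl_limit_def)
  next
    case False
    have "continuous_on {0..} (\<lambda>t\<in>{0..}. 0 :: 'k)"
      by (rule continuous_on_eq[OF continuous_on_const]) simp
    then show ?thesis unfolding eq using False by (simp add: wiener_space_def)
  qed
qed

lemma measurable_path_sum: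
  fixes J :: "'u \<Rightarrow> 'k::{banach, second_countable_topology}"
  assumes sp: "space N = start_zero_paths" and m: "\<And>k l j. (\<lambda>x. x k (real j / 2 ^ l)) \<in> borel_measurable N"
  shows "path_sum J e \<in> N \<rightarrow>\<^sub>M wiener_borel"
proof (rule measurable_wiener_borel)
  show "path_sum J e x \<in> wiener_space" if "x \<in> space N" for x
    using that sp path_sum_in_wiener_space by blast
  fix l j :: nat
  note [measurable] = m
  have [measurable]: "Measurable.pred N (path_sum_cauchy J e)"
    unfolding path_sum_cauchy_def[abs_def] by measurable
  have eq: "path_sum J e x (real j / 2 ^ l) =
      (if path_sum_cauchy J e x then lim (\<lambda>n. \<Sum>k<n. x k (real j / 2 ^ l) *\<^sub>R J (e k)) else 0)"
    if "x \<in> space N" for x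
    using that sp by (subst path_sum_eq) simp_all
  show "(\<lambda>x. path_sum J e x (real j / 2 ^ l)) \<in> borel_measurable N"
    by (subst measurable_cong[OF eq]) (assumption, measurable)
qed

section \<open>Factorisation of joint laws by characteristic functions\<close>

text \<open>
  If the characteristic function of \<open>X\<close> under the weight \<open>f\<close> is a multiple of the unweighted one, then
  every event of \<open>X\<close> is uncorrelated with \<open>f\<close>: Levy's uniqueness theorem is applied to the measure with
  normalised density \<open>f\<close>.
\<close>
lemma (in prob_space) weighted_law_eqI:
  fixes f X :: "'a \<Rightarrow> real"
  assumes [measurable]: "X \<in> borel_measurable M" and f: "integrable M f" "\<And>\<omega>. 0 \<le> f \<omega>"
    and char: "\<And>v. (LINT \<omega>|M. complex_of_real (f \<omega>) * iexp (v * X \<omega>)) =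
      complex_of_real (expectation f) * (LINT \<omega>|M. iexp (v * X \<omega>))"
    and B [measurable]: "B \<in> sets borel"
  shows "(LINT \<omega>|M. f \<omega> * indicat_real B (X \<omega>)) = expectation f * prob {\<omega>\<in>space M. X \<omega> \<in> B}"
proof (cases "expectation f = 0")
  case True
  have "AE \<omega> in M. f \<omega> = 0"
    using integral_nonneg_eq_0_iff_AE[OF f(1)] f(2) True by auto
  then have "AE \<omega> in M. f \<omega> * indicat_real B (X \<omega>) = 0"
    by auto
  then have "(LINT \<omega>|M. f \<omega> * indicat_real B (X \<omega>)) = 0"
    using integral_cong_AE[of "\<lambda>\<omega>. f \<omega> * indicat_real B (X \<omega>)" M "\<lambda>_. 0"] f(1) by auto
  then show ?thesis using True by simp
next
  case False
  have [measurable]: "f \<in> borel_measurable M" using f(1) by auto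
  define m where "m = expectation f"
  have m: "m > 0" unfolding m_def
    using False integral_nonneg_AE[of f M] f(2) by (auto simp: less_le)
  define g where "g \<omega> = f \<omega> / m" for \<omega>
  have [measurable]: "g \<in> borel_measurable M" unfolding g_def by measurable
  have g0: "\<And>\<omega>. 0 \<le> g \<omega>" using f(2) m by (auto simp: g_def)
  have gi: "integrable M g" and g1: "expectation g = 1"
    using f(1) m by (auto simp: g_def[abs_def] m_def)
  define Q where "Q = density M g"
  have "prob_space Q"
  proof
    have "emeasure Q (space Q) = (\<integral>\<^sup>+\<omega>. g \<omega> \<partial>M)"
      by (simp add: Q_def emeasure_density indicator_def cong: nn_integral_cong)
    also have "\<dots> = 1" using nn_integral_eq_integral[OF gi] g0 g1 by auto
    finally show "emeasure Q (space Q) = 1" .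
  qed
  then interpret Q: prob_space Q .
  have [measurable]: "X \<in> borel_measurable Q" by (simp add: Q_def)
  have "distr Q borel X = distr M borel X"
  proof (rule Levy_uniqueness)
    show "real_distribution (distr Q borel X)"
      by (simp add: Q.real_distribution_distr)
    show "real_distribution (distr M borel X)"
      by (simp add: real_distribution_distr)
    show "char (distr Q borel X) = char (distr M borel X)"
    proof
      fix v
      have "char (distr Q borel X) v = (LINT \<omega>|Q. iexp (v * X \<omega>))"
        by (simp add: char_def integral_distr)
      also have "\<dots> = (LINT \<omega>|M. g \<omega> *\<^sub>R iexp (v * X \<omega>))"
        unfolding Q_def using g0 by (intro integral_density) auto
      also have "\<dots> = (LINT \<omega>|M. (complex_of_real (f \<omega>) * iexp (v * X \<omega>)) / complex_of_real m)"
        by (intro Bochner_Integration.integral_cong) (auto simp: g_def scaleR_conv_of_real)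
      also have "\<dots> = (LINT \<omega>|M. iexp (v * X \<omega>))"
        unfolding integral_divide_zero char m_def[symmetric] using m by simp
      finally show "char (distr Q borel X) v = char (distr M borel X) v"
        by (simp add: char_def integral_distr)
    qed
  qed
  then have "measure (distr Q borel X) B = measure (distr M borel X) B" by simp
  then have "measure Q {\<omega>\<in>space M. X \<omega> \<in> B} = prob {\<omega>\<in>space M. X \<omega> \<in> B}"
    by (simp add: measure_distr Q_def vimage_def Int_def conj_commute)
  moreover have "measure Q {\<omega>\<in>space M. X \<omega> \<in> B} = (LINT \<omega>|Q. indicat_real {\<omega>\<in>space M. X \<omega> \<in> B} \<omega>)"
    by (simp add: Q_def)
  moreover have "\<dots> = (LINT \<omega>|M. g \<omega> *\<^sub>R indicat_real {\<omega>\<in>space M. X \<omega> \<in> B} \<omega>)"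
    unfolding Q_def using g0 by (intro integral_density) auto
  moreover have "\<dots> = (LINT \<omega>|M. f \<omega> * indicat_real B (X \<omega>) / m)"
    by (intro Bochner_Integration.integral_cong) (auto simp: g_def indicator_def)
  ultimately show ?thesis using m by (simp add: m_def field_simps)
qed

text \<open>
  A family of variables is independent, and independent of an event \<open>A\<close>, if the joint characteristic
  function restricted to \<open>A\<close> factorises into even real factors. The induction replaces \<open>A\<close> by its
  intersection with an event of the last variable; to see that the remaining characteristic function
  still factorises, \<open>weighted_law_eqI\<close> is applied with the nonnegative weights \<open>1 + cos \<theta>\<close> and
  \<open>1 + sin \<theta>\<close> on \<open>A\<close>, where \<open>\<theta>\<close> is the phase contributed by the other variables.
\<close>
lemma (in prob_space) indep_from_joint_char:
  fixes X :: "nat \<Rightarrow> 'a \<Rightarrow> real" and c :: "nat \<Rightarrow> real \<Rightarrow> real"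
  assumes [measurable]: "\<And>k. X k \<in> borel_measurable M"
    and c: "\<And>k v. (LINT \<omega>|M. iexp (v * X k \<omega>)) = complex_of_real (c k v)"
      "\<And>k v. c k (- v) = c k v"
    and A: "A \<in> events"
    and joint: "\<And>u. (LINT \<omega>|M. indicator A \<omega> * iexp (\<Sum>k<n. u k * X k \<omega>)) =
      complex_of_real (prob A * (\<Prod>k<n. c k (u k)))"
    and B: "\<And>k. B k \<in> sets borel"
  shows "prob {\<omega>\<in>A. \<forall>k<n. X k \<omega> \<in> B k} = prob A * (\<Prod>k<n. prob {\<omega>\<in>space M. X k \<omega> \<in> B k})"
  using A joint
proof (induction n arbitrary: A)
  case 0
  then show ?case by simp
next
  case (Suc n)
  note [measurable] = Suc.prems(1) B
  have c0: "c k 0 = 1" for k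
    using c(1)[of 0 k] by (simp add: prob_space)
  let ?A = "{\<omega>\<in>A. X n \<omega> \<in> B n}"
  have AB: "?A = A \<inter> {\<omega>\<in>space M. X n \<omega> \<in> B n}"
    using sets.sets_into_space[OF Suc.prems(1)] by auto
  have A'[measurable]: "?A \<in> events" unfolding AB by measurable
  let ?p = "prob {\<omega>\<in>space M. X n \<omega> \<in> B n}"
  define \<theta> where "\<theta> u \<omega> = (\<Sum>k<n. u k * X k \<omega>)" for u \<omega>
  have [measurable]: "\<theta> u \<in> borel_measurable M" for u
    unfolding \<theta>_def by measurable
  have bd: "integrable M (\<lambda>\<omega>. indicator A \<omega> * iexp (f \<omega>))" if [measurable]: "f \<in> borel_measurable M" for f
    by (rule integrable_const_bound[where B=1]) (auto simp: norm_mult indicator_def)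
  have bdr: "integrable M (\<lambda>\<omega>. indicator A \<omega> * g (f \<omega>))"
    if [measurable]: "f \<in> borel_measurable M" "g \<in> borel_measurable borel" and "\<And>x. \<bar>g x\<bar> \<le> 1" for f :: "'a \<Rightarrow> real" and g :: "real \<Rightarrow> real"
    by (rule integrable_const_bound[where B=1]) (auto simp: abs_mult indicator_def that)
  have i1: "integrable M (indicat_real E)" if [measurable]: "E \<in> events" for E
    by (rule integrable_const_bound[where B=1]) (auto simp: indicator_def)
  define C where "C u = (\<Prod>k<n. c k (u k))" for u
  have J: "(LINT \<omega>|M. indicator A \<omega> * iexp (v * X n \<omega> + \<theta> u \<omega>)) = complex_of_real (prob A * C u * c n v)" for u v
    using Suc.prems(2)[of "u(n := v)"] by (simp add: \<theta>_def C_def algebra_simps)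
  have Cm: "C (\<lambda>k. - u k) = C u" for u by (simp add: C_def c(2))
  have tm: "\<theta> (\<lambda>k. - u k) \<omega> = - \<theta> u \<omega>" for u \<omega> by (simp add: \<theta>_def sum_negf)
  have J': "(LINT \<omega>|M. indicator A \<omega> * iexp (v * X n \<omega> - \<theta> u \<omega>)) = complex_of_real (prob A * C u * c n v)" for u v
    using J[of v "\<lambda>k. - u k"] by (simp add: Cm tm)
  have J0: "(LINT \<omega>|M. indicator A \<omega> * iexp (v * X n \<omega>)) = complex_of_real (prob A * c n v)" for v
    using J[of v "\<lambda>k. 0"] by (simp add: \<theta>_def C_def c0)
  have ecos: "(LINT \<omega>|M. indicat_real A \<omega> * cos (\<theta> u \<omega>)) = prob A * C u"
    and esin: "(LINT \<omega>|M. indicat_real A \<omega> * sin (\<theta> u \<omega>)) = 0" for u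
  proof -
    have *: "(LINT \<omega>|M. indicator A \<omega> * iexp (\<theta> u \<omega>)) = complex_of_real (prob A * C u)"
      using J[of 0 u] by (simp add: c0)
    have iRe: "Re (indicator A \<omega> * iexp x) = indicat_real A \<omega> * cos x"
      and iIm: "Im (indicator A \<omega> * iexp x) = indicat_real A \<omega> * sin x" for \<omega> x
      by (auto simp: Re_exp Im_exp split: split_indicator)
    have "(LINT \<omega>|M. Re (indicator A \<omega> * iexp (\<theta> u \<omega>))) = Re (complex_of_real (prob A * C u))"
      unfolding *[symmetric] by (rule integral_Re) (rule bd, measurable)
    then show "(LINT \<omega>|M. indicat_real A \<omega> * cos (\<theta> u \<omega>)) = prob A * C u"
      unfolding iRe by simp
    have "(LINT \<omega>|M. Im (indicator A \<omega> * iexp (\<theta> u \<omega>))) = Im (complex_of_real (prob A * C u))"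
      unfolding *[symmetric] by (rule integral_Im) (rule bd, measurable)
    then show "(LINT \<omega>|M. indicat_real A \<omega> * sin (\<theta> u \<omega>)) = 0"
      unfolding iIm by simp
  qed
  \<comment> \<open>The third choice, a constant weight, gives independence of A and the last variable.\<close>
  have e1: "(LINT \<omega>|M. indicat_real A \<omega> * (1 + g (\<theta> u \<omega>)) * indicat_real (B n) (X n \<omega>)) =
      (prob A + (LINT \<omega>|M. indicat_real A \<omega> * g (\<theta> u \<omega>))) * ?p"
    if g: "g = cos \<or> g = sin \<or> g = (\<lambda>_. 0)" for g u
  proof -
    have [measurable]: "g \<in> borel_measurable borel" and g1: "\<bar>g x\<bar> \<le> 1" for x using g by auto
    have gi: "integrable M (\<lambda>\<omega>. indicat_real A \<omega> * g (\<theta> u \<omega>))" by (rule bdr) (auto simp: g1)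
    have m: "(LINT \<omega>|M. indicat_real A \<omega> * (1 + g (\<theta> u \<omega>))) =
      prob A + (LINT \<omega>|M. indicat_real A \<omega> * g (\<theta> u \<omega>))"
      using Bochner_Integration.integral_add[OF i1[OF Suc.prems(1)] gi] Suc.prems(1) by (simp add: distrib_left)
    show ?thesis unfolding m[symmetric]
    proof (rule weighted_law_eqI)
      show "integrable M (\<lambda>\<omega>. indicat_real A \<omega> * (1 + g (\<theta> u \<omega>)))"
        using gi i1[OF Suc.prems(1)] by (simp add: distrib_left)
      have "- 1 \<le> g x" for x using g1[of x] by linarith
      then show "0 \<le> indicat_real A \<omega> * (1 + g (\<theta> u \<omega>))" for \<omega>
        by (auto simp: indicator_def) (smt (verit))
      fix v
      have "(LINT \<omega>|M. complex_of_real (indicat_real A \<omega> * (1 + g (\<theta> u \<omega>))) * iexp (v * X n \<omega>)) =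
        complex_of_real (prob A + (LINT \<omega>|M. indicat_real A \<omega> * g (\<theta> u \<omega>))) * complex_of_real (c n v)"
        using g
      proof (elim disjE)
        assume [simp]: "g = cos"
        have "(LINT \<omega>|M. complex_of_real (indicat_real A \<omega> * (1 + g (\<theta> u \<omega>))) * iexp (v * X n \<omega>)) =
          (LINT \<omega>|M. indicator A \<omega> * iexp (v * X n \<omega>) +
            ((indicator A \<omega> * iexp (v * X n \<omega> + \<theta> u \<omega>)) / 2 + (indicator A \<omega> * iexp (v * X n \<omega> - \<theta> u \<omega>)) / 2))"
          by (intro Bochner_Integration.integral_cong)
            (auto simp: indicator_def cos_of_real[symmetric] cos_exp_eq exp_add exp_diff exp_minus field_simps)
        also have "\<dots> = complex_of_real (prob A * c n v) + (complex_of_real (prob A * C u * c n v) / 2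
            + complex_of_real (prob A * C u * c n v) / 2)"
          using bd[of "\<lambda>\<omega>. v * X n \<omega>"] bd[of "\<lambda>\<omega>. v * X n \<omega> + \<theta> u \<omega>"] bd[of "\<lambda>\<omega>. v * X n \<omega> - \<theta> u \<omega>"]
          by (simp add: J J' J0 del: of_real_add of_real_mult of_real_diff)
        finally show ?thesis by (simp add: ecos field_simps)
      next
        assume [simp]: "g = sin"
        have "(LINT \<omega>|M. complex_of_real (indicat_real A \<omega> * (1 + g (\<theta> u \<omega>))) * iexp (v * X n \<omega>)) =
          (LINT \<omega>|M. indicator A \<omega> * iexp (v * X n \<omega>) +
            ((indicator A \<omega> * iexp (v * X n \<omega> + \<theta> u \<omega>)) / (2*\<i>) - (indicator A \<omega> * iexp (v * X n \<omega> - \<theta> u \<omega>)) / (2*\<i>)))"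
          by (intro Bochner_Integration.integral_cong)
            (auto simp: indicator_def sin_of_real[symmetric] sin_exp_eq exp_add exp_diff exp_minus field_simps)
        also have "\<dots> = complex_of_real (prob A * c n v) + (complex_of_real (prob A * C u * c n v) / (2*\<i>)
            - complex_of_real (prob A * C u * c n v) / (2*\<i>))"
          using bd[of "\<lambda>\<omega>. v * X n \<omega>"] bd[of "\<lambda>\<omega>. v * X n \<omega> + \<theta> u \<omega>"] bd[of "\<lambda>\<omega>. v * X n \<omega> - \<theta> u \<omega>"]
          by (simp add: J J' J0 del: of_real_add of_real_mult of_real_diff)
        finally show ?thesis by (simp add: esin field_simps)
      next
        assume [simp]: "g = (\<lambda>_. 0)"
        have "(\<lambda>\<omega>. complex_of_real (indicat_real A \<omega>) * iexp (v * X n \<omega>)) = (\<lambda>\<omega>. indicator A \<omega> * iexp (v * X n \<omega>))"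
          by (auto simp: indicator_def)
        then show ?thesis using J0[of v] by simp
      qed
      then show "(LINT \<omega>|M. complex_of_real (indicat_real A \<omega> * (1 + g (\<theta> u \<omega>))) * iexp (v * X n \<omega>)) =
        complex_of_real (LINT \<omega>|M. indicat_real A \<omega> * (1 + g (\<theta> u \<omega>))) * (LINT \<omega>|M. iexp (v * X n \<omega>))"
        unfolding c m .
    qed measurable
  qed
  have ind: "indicat_real A \<omega> * indicat_real (B n) (X n \<omega>) = indicat_real ?A \<omega>" for \<omega>
    by (auto simp: indicator_def)
  have pA: "prob ?A = prob A * ?p"
    using e1[of "\<lambda>_. 0" "\<lambda>_. 0"] by (simp add: ind)
  have gA: "(LINT \<omega>|M. indicat_real ?A \<omega> * g (\<theta> u \<omega>)) = (LINT \<omega>|M. indicat_real A \<omega> * g (\<theta> u \<omega>)) * ?p"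
    if g: "g = cos \<or> g = sin" for g u
  proof -
    have [measurable]: "g \<in> borel_measurable borel" and g1: "\<bar>g x\<bar> \<le> 1" for x using g by auto
    have i: "integrable M (\<lambda>\<omega>. indicat_real ?A \<omega> * g (\<theta> u \<omega>))"
      by (rule integrable_const_bound[where B=1]) (auto simp: abs_mult indicator_def g1)
    have "(LINT \<omega>|M. indicat_real A \<omega> * (1 + g (\<theta> u \<omega>)) * indicat_real (B n) (X n \<omega>)) =
      (LINT \<omega>|M. indicat_real ?A \<omega> + indicat_real ?A \<omega> * g (\<theta> u \<omega>))"
      unfolding ind[symmetric] by (simp add: algebra_simps)
    also have "\<dots> = prob ?A + (LINT \<omega>|M. indicat_real ?A \<omega> * g (\<theta> u \<omega>))"
      using Bochner_Integration.integral_add[OF i1[OF A'] i] A' by simp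
    finally show ?thesis using e1[of g u] g by (auto simp: pA algebra_simps)
  qed
  have "prob {\<omega>\<in>?A. \<forall>k<n. X k \<omega> \<in> B k} = prob ?A * (\<Prod>k<n. prob {\<omega>\<in>space M. X k \<omega> \<in> B k})"
  proof (rule Suc.IH[OF A'])
    fix u
    have "(\<lambda>\<omega>. indicator ?A \<omega> * iexp (\<theta> u \<omega>)) =
      (\<lambda>\<omega>. complex_of_real (indicat_real ?A \<omega> * cos (\<theta> u \<omega>)) + \<i> * complex_of_real (indicat_real ?A \<omega> * sin (\<theta> u \<omega>)))"
      by (auto simp: indicator_def exp_Euler cos_of_real sin_of_real)
    moreover have "integrable M (\<lambda>\<omega>. complex_of_real (indicat_real ?A \<omega> * cos (\<theta> u \<omega>)))"
      "integrable M (\<lambda>\<omega>. complex_of_real (indicat_real ?A \<omega> * sin (\<theta> u \<omega>)))"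
      by (rule integrable_const_bound[where B=1]; auto simp: abs_mult indicator_def)+
    ultimately have "(LINT \<omega>|M. indicator ?A \<omega> * iexp (\<theta> u \<omega>)) =
      complex_of_real (LINT \<omega>|M. indicat_real ?A \<omega> * cos (\<theta> u \<omega>)) + \<i> * complex_of_real (LINT \<omega>|M. indicat_real ?A \<omega> * sin (\<theta> u \<omega>))"
      by (simp only: Bochner_Integration.integral_add integrable_mult_right integral_complex_of_real integral_mult_right_zero)
    then have "(LINT \<omega>|M. indicator ?A \<omega> * iexp (\<theta> u \<omega>)) = complex_of_real (prob ?A * C u)"
      by (simp add: gA ecos esin pA)
    then show "(LINT \<omega>|M. indicator ?A \<omega> * iexp (\<Sum>k<n. u k * X k \<omega>)) =
      complex_of_real (prob ?A * (\<Prod>k<n. c k (u k)))"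
      by (simp add: \<theta>_def C_def)
  qed
  moreover have "{\<omega>\<in>?A. \<forall>k<n. X k \<omega> \<in> B k} = {\<omega>\<in>A. \<forall>k<Suc n. X k \<omega> \<in> B k}"
    by (auto simp: less_Suc_eq)
  ultimately show ?case by (simp add: pA algebra_simps)
qed

section \<open>Orthogonality of the increments of a Wiener process\<close>

text \<open>
  A stochastic basis with a Wiener process on it.
\<close>
locale wiener_basis = prob_space M for M :: "'w measure" +
  fixes F :: "real \<Rightarrow> 'w measure" and W :: "nat \<Rightarrow> real \<Rightarrow> 'w \<Rightarrow> real"
  assumes basis: "stochastic_basis M F" and wiener: "wiener_process M F W"
begin

lemma filtration: "\<forall>t\<ge>0. space (F t) = space M \<and> sets (F t) \<subseteq> sets M"
    "\<forall>s\<ge>0. \<forall>t\<ge>s. sets (F s) \<subseteq> sets (F t)"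
  by (rule basis[unfolded stochastic_basis_def, THEN conjunct2, THEN conjunct2, THEN conjunct1],
      rule basis[unfolded stochastic_basis_def, THEN conjunct2, THEN conjunct2, THEN conjunct2, THEN conjunct1])

lemma space_F: "0 \<le> t \<Longrightarrow> space (F t) = space M"
  and sets_F: "0 \<le> t \<Longrightarrow> sets (F t) \<subseteq> sets M"
  and mono_F: "0 \<le> s \<Longrightarrow> s \<le> t \<Longrightarrow> sets (F s) \<subseteq> sets (F t)"
  using filtration by simp_all

lemma measurable_F_mono:
  assumes "f \<in> F s \<rightarrow>\<^sub>M N" "0 \<le> s" "s \<le> t"
  shows "f \<in> F t \<rightarrow>\<^sub>M N"
proof -
  have "space (F s) = space (F t)" using assms by (simp add: space_F)
  then show ?thesis using assms(1) mono_F[OF assms(2,3)] by (auto simp: measurable_def)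
qed

lemma measurable_F_M:
  assumes "f \<in> F s \<rightarrow>\<^sub>M N" "0 \<le> s"
  shows "f \<in> M \<rightarrow>\<^sub>M N"
  using assms(1) sets_F[OF assms(2)] space_F[OF assms(2)] by (auto simp: measurable_def)

lemma brownian: "brownian_motion M F (W k)"
  using wiener by (auto simp: wiener_process_def)

lemma adapted: "0 \<le> t \<Longrightarrow> W k t \<in> borel_measurable (F t)"
  and start_zero: "\<omega> \<in> space M \<Longrightarrow> W k 0 \<omega> = 0"
  and continuous: "\<omega> \<in> space M \<Longrightarrow> continuous_on {0..} (\<lambda>t. W k t \<omega>)"
  using brownian[of k] by (auto simp: brownian_motion_def)

lemma measurable_W: "0 \<le> t \<Longrightarrow> W k t \<in> borel_measurable M"
  by (rule measurable_F_M[OF adapted])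

lemma increment_distributed:
  "0 \<le> s \<Longrightarrow> s < t \<Longrightarrow> distributed M lborel (\<lambda>\<omega>. W k t \<omega> - W k s \<omega>) (normal_density 0 (sqrt (t - s)))"
  using brownian[of k] unfolding brownian_motion_def by blast

lemma increment_adapted:
  "0 \<le> s \<Longrightarrow> s \<le> t \<Longrightarrow> t \<le> r \<Longrightarrow> (\<lambda>\<omega>. W k t \<omega> - W k s \<omega>) \<in> borel_measurable (F r)"
  by (intro borel_measurable_diff measurable_F_mono[OF adapted]) auto

text \<open>
  The function \<open>g\<close> is there because independence of two variables is only defined for values in a common
  type; the past \<open>Z\<close> will be complex-valued.
\<close>
lemma indep_past_increment:
  assumes "0 \<le> s" "s < t" and Z: "Z \<in> F s \<rightarrow>\<^sub>M N" and g: "g \<in> borel \<rightarrow>\<^sub>M N'"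
  shows "indep_var N Z N' (\<lambda>\<omega>. g (W k t \<omega> - W k s \<omega>))"
proof -
  let ?D = "\<lambda>\<omega>. W k t \<omega> - W k s \<omega>"
  have ind: "indep_set (sets (F s)) {?D -` A \<inter> space M |A. A \<in> sets borel}"
    using brownian[of k] assms(1,2) unfolding brownian_motion_def by blast
  have sp: "space (F s) = space M" using assms by (simp add: space_F)
  have a: "indep_set (sigma_sets (space M) (sets (F s))) (sigma_sets (space M) {?D -` A \<inter> space M |A. A \<in> sets borel})"
  proof (rule indep_set_sigma_sets[OF ind])
    show "Int_stable (sets (F s))" by (auto simp: Int_stable_def)
    show "Int_stable {?D -` A \<inter> space M |A. A \<in> sets borel}"
      unfolding Int_stable_def
    proof safe
      fix A B :: "real set" assume "A \<in> sets borel" "B \<in> sets borel"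
      then show "\<exists>C. ?D -` A \<inter> space M \<inter> (?D -` B \<inter> space M) = ?D -` C \<inter> space M \<and> C \<in> sets borel"
        by (intro exI[of _ "A \<inter> B"]) auto
    qed
  qed
  have b: "sigma_sets (space M) {(\<lambda>\<omega>. g (?D \<omega>)) -` A \<inter> space M |A. A \<in> sets N'} \<subseteq>
      sigma_sets (space M) {?D -` A \<inter> space M |A. A \<in> sets borel}"
  proof (intro sigma_sets_subseteq subsetI, clarify)
    fix A assume "A \<in> sets N'"
    then show "\<exists>B. (\<lambda>\<omega>. g (?D \<omega>)) -` A \<inter> space M = ?D -` B \<inter> space M \<and> B \<in> sets borel"
      using measurable_sets[OF g] by (intro exI[of _ "g -` A"]) auto
  qed
  have c: "sigma_sets (space M) (sets (F s)) = sets (F s)"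
    using sets.sigma_sets_eq[of "F s"] sp by simp
  have d: "sigma_sets (space M) {Z -` A \<inter> space M |A. A \<in> sets N} \<subseteq> sets (F s)"
    unfolding sp[symmetric] using Z by (intro sets.sigma_sets_subset) auto
  have mono: "indep_set A' B'" if "indep_set A B" "A' \<subseteq> A" "B' \<subseteq> B" for A B A' B'
    using that unfolding indep_sets2_eq by (meson subset_iff)
  have "indep_set (sigma_sets (space M) {Z -` A \<inter> space M |A. A \<in> sets N})
      (sigma_sets (space M) {(\<lambda>\<omega>. g (?D \<omega>)) -` A \<inter> space M |A. A \<in> sets N'})"
    using mono[OF a _ b] d unfolding c .
  moreover have "Z \<in> M \<rightarrow>\<^sub>M N" by (rule measurable_F_M[OF Z assms(1)])
  moreover have "(\<lambda>\<omega>. g (?D \<omega>)) \<in> M \<rightarrow>\<^sub>M N'"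
    using assms by (intro measurable_compose[OF _ g] borel_measurable_diff measurable_W) auto
  ultimately show ?thesis by (simp add: indep_var_eq)
qed

lemma
  fixes Z :: "'w \<Rightarrow> complex" and g :: "real \<Rightarrow> complex"
  assumes "0 \<le> s" "s < t" and Z: "Z \<in> borel_measurable (F s)" "integrable M Z"
    and g: "g \<in> borel_measurable borel" "integrable M (\<lambda>\<omega>. g (W k t \<omega> - W k s \<omega>))"
  shows integrable_past_times_increment: "integrable M (\<lambda>\<omega>. Z \<omega> * g (W k t \<omega> - W k s \<omega>))"
    and expectation_past_times_increment:
      "(LINT \<omega>|M. Z \<omega> * g (W k t \<omega> - W k s \<omega>)) = (LINT \<omega>|M. Z \<omega>) * (LINT \<omega>|M. g (W k t \<omega> - W k s \<omega>))"
proof -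
  have i: "indep_var borel Z borel (\<lambda>\<omega>. g (W k t \<omega> - W k s \<omega>))"
    by (rule indep_past_increment[OF assms(1,2) Z(1) g(1)])
  show "integrable M (\<lambda>\<omega>. Z \<omega> * g (W k t \<omega> - W k s \<omega>))"
    by (rule indep_var_integrable[OF i Z(2) g(2)])
  show "(LINT \<omega>|M. Z \<omega> * g (W k t \<omega> - W k s \<omega>)) = (LINT \<omega>|M. Z \<omega>) * (LINT \<omega>|M. g (W k t \<omega> - W k s \<omega>))"
    by (rule indep_var_lebesgue_integral[OF i Z(2) g(2)])
qed

lemma
  assumes "0 \<le> s" "s < t"
  shows integrable_increment_power: "integrable M (\<lambda>\<omega>. (W k t \<omega> - W k s \<omega>) ^ p)"
    and integrable_increment_abs_power: "integrable M (\<lambda>\<omega>. \<bar>W k t \<omega> - W k s \<omega>\<bar> ^ p)"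
    and expectation_increment: "expectation (\<lambda>\<omega>. W k t \<omega> - W k s \<omega>) = 0"
    and expectation_increment_square: "expectation (\<lambda>\<omega>. (W k t \<omega> - W k s \<omega>)\<^sup>2) = t - s"
    and expectation_increment_cube:
      "expectation (\<lambda>\<omega>. \<bar>W k t \<omega> - W k s \<omega>\<bar> ^ 3) = 2 * sqrt (2 / pi) * sqrt (t - s) ^ 3"
proof -
  note D = increment_distributed[OF assms, of k]
  have s: "0 < sqrt (t - s)" using assms by simp
  show "integrable M (\<lambda>\<omega>. (W k t \<omega> - W k s \<omega>) ^ p)"
    using distributed_integrable[OF D, of "\<lambda>x. x ^ p"] integrable_normal_moment[OF s, of 0 p] by simp
  show "integrable M (\<lambda>\<omega>. \<bar>W k t \<omega> - W k s \<omega>\<bar> ^ p)"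
    using distributed_integrable[OF D, of "\<lambda>x. \<bar>x\<bar> ^ p"] integrable_normal_moment_abs[OF s, of 0 p] by simp
  show "expectation (\<lambda>\<omega>. W k t \<omega> - W k s \<omega>) = 0"
    using distributed_integral[OF D, of "\<lambda>x. x"] integral_normal_moment_nz_1[OF s, of 0] by simp
  show "expectation (\<lambda>\<omega>. (W k t \<omega> - W k s \<omega>)\<^sup>2) = t - s"
    using distributed_integral[OF D, of "\<lambda>x. x\<^sup>2"] integral_normal_moment_even[OF s, of 0 1] assms by simp
  show "expectation (\<lambda>\<omega>. \<bar>W k t \<omega> - W k s \<omega>\<bar> ^ 3) = 2 * sqrt (2 / pi) * sqrt (t - s) ^ 3"
    using distributed_integral[OF D, of "\<lambda>x. \<bar>x\<bar> ^ 3"] integral_normal_moment_abs_odd[OF s, of 0 1] assms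
    by (simp add: eval_nat_numeral algebra_simps)
qed

lemma
  fixes Z :: "'w \<Rightarrow> complex"
  assumes "0 \<le> s" "s < t" and Z: "Z \<in> borel_measurable (F s)" "integrable M Z"
  shows integrable_past_times_increment1: "integrable M (\<lambda>\<omega>. Z \<omega> * complex_of_real (W k t \<omega> - W k s \<omega>))"
    and expectation_past_times_increment1: "(LINT \<omega>|M. Z \<omega> * complex_of_real (W k t \<omega> - W k s \<omega>)) = 0"
    and expectation_past_times_increment2: "(LINT \<omega>|M. Z \<omega> * complex_of_real ((W k t \<omega> - W k s \<omega>)\<^sup>2)) =
      (LINT \<omega>|M. Z \<omega>) * complex_of_real (t - s)"
proof -
  have i: "integrable M (\<lambda>\<omega>. complex_of_real (W k t \<omega> - W k s \<omega>))"
    using integrable_increment_power[OF assms(1,2), of k 1] by (simp del: of_real_diff)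
  have i2: "integrable M (\<lambda>\<omega>. complex_of_real ((W k t \<omega> - W k s \<omega>)\<^sup>2))"
    using integrable_increment_power[OF assms(1,2), of k 2] by (simp del: of_real_diff of_real_power)
  show "integrable M (\<lambda>\<omega>. Z \<omega> * complex_of_real (W k t \<omega> - W k s \<omega>))"
    by (rule integrable_past_times_increment[where g=complex_of_real and k=k, OF assms _ i]) simp
  show "(LINT \<omega>|M. Z \<omega> * complex_of_real (W k t \<omega> - W k s \<omega>)) = 0"
    by (subst expectation_past_times_increment[where g=complex_of_real and k=k, OF assms _ i])
      (simp_all add: expectation_increment[OF assms(1,2)] del: of_real_diff)
  show "(LINT \<omega>|M. Z \<omega> * complex_of_real ((W k t \<omega> - W k s \<omega>)\<^sup>2)) = (LINT \<omega>|M. Z \<omega>) * complex_of_real (t - s)"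
    by (subst expectation_past_times_increment[where g="\<lambda>x. complex_of_real (x\<^sup>2)" and k=k, OF assms _ i2])
      (simp_all add: expectation_increment_square[OF assms(1,2)] del: of_real_diff of_real_power)
qed

lemma
  assumes "k \<noteq> l" and t: "0 \<le> s1" "0 \<le> t1" "0 \<le> s2" "0 \<le> t2"
    and i: "\<And>m. integrable M (\<lambda>\<omega>. (W m t1 \<omega> - W m s1 \<omega>) * (W m t2 \<omega> - W m s2 \<omega>))"
  shows integrable_two_motions: "integrable M (\<lambda>\<omega>. ((W k t1 \<omega> - W k s1 \<omega>) * (W k t2 \<omega> - W k s2 \<omega>)) *
        ((W l t1 \<omega> - W l s1 \<omega>) * (W l t2 \<omega> - W l s2 \<omega>)))"
    and expectation_two_motions: "expectation (\<lambda>\<omega>. ((W k t1 \<omega> - W k s1 \<omega>) * (W k t2 \<omega> - W k s2 \<omega>)) *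
        ((W l t1 \<omega> - W l s1 \<omega>) * (W l t2 \<omega> - W l s2 \<omega>))) =
      expectation (\<lambda>\<omega>. (W k t1 \<omega> - W k s1 \<omega>) * (W k t2 \<omega> - W k s2 \<omega>)) *
      expectation (\<lambda>\<omega>. (W l t1 \<omega> - W l s1 \<omega>) * (W l t2 \<omega> - W l s2 \<omega>))"
proof -
  define Y :: "nat \<Rightarrow> (real \<Rightarrow> real) \<Rightarrow> real" where "Y m x = (x t1 - x s1) * (x t2 - x s2)" for m x
  have Y: "Y m \<in> borel_measurable (PiM {0..} (\<lambda>t. borel))" for m
    unfolding Y_def using t
    by (intro borel_measurable_times borel_measurable_diff measurable_component_singleton) auto
  have "indep_vars (\<lambda>k. PiM {0..} (\<lambda>t. borel)) (\<lambda>k \<omega>. \<lambda>t\<in>{0..}. W k t \<omega>) UNIV"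
    using wiener by (simp add: wiener_process_def)
  from indep_vars_compose2[OF this, of Y "\<lambda>_. borel"] Y
  have "indep_vars (\<lambda>_. borel) (\<lambda>m \<omega>. Y m (\<lambda>t\<in>{0..}. W m t \<omega>)) UNIV" by simp
  moreover define X where "X m \<omega> = Y m (\<lambda>t\<in>{0..}. W m t \<omega>)" for m \<omega>
  ultimately have "indep_vars (\<lambda>_. borel) X UNIV" by (simp add: X_def[abs_def])
  then have v: "indep_vars (\<lambda>_. borel) X {k, l}"
    by (rule indep_vars_subset) simp
  have X: "X m \<omega> = (W m t1 \<omega> - W m s1 \<omega>) * (W m t2 \<omega> - W m s2 \<omega>)" for m \<omega>
    using t by (simp add: X_def Y_def)
  have Xi: "integrable M (X m)" for m
    using i[of m] by (simp add: X[abs_def])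
  show "integrable M (\<lambda>\<omega>. ((W k t1 \<omega> - W k s1 \<omega>) * (W k t2 \<omega> - W k s2 \<omega>)) *
        ((W l t1 \<omega> - W l s1 \<omega>) * (W l t2 \<omega> - W l s2 \<omega>)))"
    unfolding X[symmetric] using indep_vars_integrable[of "{k, l}" X] v Xi \<open>k \<noteq> l\<close> by simp
  show "expectation (\<lambda>\<omega>. ((W k t1 \<omega> - W k s1 \<omega>) * (W k t2 \<omega> - W k s2 \<omega>)) *
        ((W l t1 \<omega> - W l s1 \<omega>) * (W l t2 \<omega> - W l s2 \<omega>))) =
      expectation (\<lambda>\<omega>. (W k t1 \<omega> - W k s1 \<omega>) * (W k t2 \<omega> - W k s2 \<omega>)) *
      expectation (\<lambda>\<omega>. (W l t1 \<omega> - W l s1 \<omega>) * (W l t2 \<omega> - W l s2 \<omega>))"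
    unfolding X[symmetric] using indep_vars_lebesgue_integral[of "{k, l}" X] v Xi \<open>k \<noteq> l\<close> by simp
qed

text \<open>
  Simultaneous increments of different motions are uncorrelated given the past. After splitting the
  interval into \<open>N\<close> parts, products of increments over different parts vanish in mean, and the sum of
  the remaining products has second moment \<open>(t - s)\<^sup>2 / N\<close>, by the mutual independence of the motions.
\<close>
lemma orthogonal_increments:
  fixes Z :: "'w \<Rightarrow> complex"
  assumes "k \<noteq> l" and st: "0 \<le> s" "s < t" and Z: "Z \<in> borel_measurable (F s)" and Z1: "\<And>\<omega>. norm (Z \<omega>) \<le> 1"
  shows "(LINT \<omega>|M. Z \<omega> * complex_of_real ((W k t \<omega> - W k s \<omega>) * (W l t \<omega> - W l s \<omega>))) = 0"
    (is "?E = 0")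
proof -
  have ZM[measurable]: "Z \<in> borel_measurable M" by (rule measurable_F_M[OF Z st(1)])
  \<comment> \<open>A bound that tends to 0 with the mesh of a partition into N equal parts.\<close>
  have bound: "(norm ?E)\<^sup>2 \<le> (t - s)\<^sup>2 / real N" if "N > 0" for N
  proof -
    define d where "d = (t - s) / real N"
    have d: "d > 0" and Nd: "real N * d = t - s" using that st by (auto simp: d_def)
    define r where "r j = s + real j * d" for j :: nat
    have r0: "r 0 = s" and rN: "r N = t" using Nd by (auto simp: r_def)
    have rpos: "0 \<le> r j" and rS: "r j < r (Suc j)" and rd: "r (Suc j) - r j = d" and sr: "s \<le> r j" for j
      using d st by (auto simp: r_def algebra_simps)
    have rm: "i \<le> j \<Longrightarrow> r i \<le> r j" for i j using d by (auto simp: r_def)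
    define a where "a k j \<omega> = W k (r (Suc j)) \<omega> - W k (r j) \<omega>" for k j \<omega>
    have am[measurable]: "a k j \<in> borel_measurable M" for k j
      unfolding a_def by (intro borel_measurable_diff measurable_W rpos)
    have amF: "i < j \<Longrightarrow> a k i \<in> borel_measurable (F (r j))" for k i j
      unfolding a_def using rpos rS rm[of "Suc i" j] by (intro increment_adapted) (auto simp: less_imp_le)
    have a1: "integrable M (a k j)" and a2: "integrable M (\<lambda>\<omega>. (a k j \<omega>)\<^sup>2)"
      and ea2: "expectation (\<lambda>\<omega>. (a k j \<omega>)\<^sup>2) = d" for k j
      using integrable_increment_power[OF rpos rS, of k j 1] integrable_increment_power[OF rpos rS, of k j 2]
        expectation_increment_square[OF rpos rS, of k j]
      by (auto simp: a_def[abs_def] rd)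
    have aa: "integrable M (\<lambda>\<omega>. a k i \<omega> * a l j \<omega>)" for k i l j
    proof (rule Bochner_Integration.integrable_bound)
      show "integrable M (\<lambda>\<omega>. (a k i \<omega>)\<^sup>2 + (a l j \<omega>)\<^sup>2)" using a2 by simp
      show "AE \<omega> in M. norm (a k i \<omega> * a l j \<omega>) \<le> norm ((a k i \<omega>)\<^sup>2 + (a l j \<omega>)\<^sup>2)"
      proof (rule AE_I2)
        fix \<omega>
        have "2 * (\<bar>a k i \<omega>\<bar> * \<bar>a l j \<omega>\<bar>) \<le> (a k i \<omega>)\<^sup>2 + (a l j \<omega>)\<^sup>2"
          using sum_squares_bound[of "\<bar>a k i \<omega>\<bar>" "\<bar>a l j \<omega>\<bar>"] by (simp add: algebra_simps)
        moreover have "0 \<le> \<bar>a k i \<omega>\<bar> * \<bar>a l j \<omega>\<bar>" by simp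
        ultimately show "norm (a k i \<omega> * a l j \<omega>) \<le> norm ((a k i \<omega>)\<^sup>2 + (a l j \<omega>)\<^sup>2)"
          unfolding real_norm_def abs_mult by linarith
      qed
    qed measurable
    have Zaa: "integrable M (\<lambda>\<omega>. Y \<omega> * complex_of_real (a k i \<omega> * a l j \<omega>))"
      if [measurable]: "Y \<in> borel_measurable M" and "\<And>\<omega>. norm (Y \<omega>) \<le> 1" for Y :: "'w \<Rightarrow> complex" and k i l j
    proof (rule Bochner_Integration.integrable_bound)
      show "integrable M (\<lambda>\<omega>. a k i \<omega> * a l j \<omega>)" by (rule aa)
      show "AE \<omega> in M. norm (Y \<omega> * complex_of_real (a k i \<omega> * a l j \<omega>)) \<le> norm (a k i \<omega> * a l j \<omega>)"
        using that(2) by (auto simp: norm_mult simp del: of_real_mult intro!: AE_I2 mult_left_le_one_le)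
    qed measurable
    have cross: "(LINT \<omega>|M. Y \<omega> * complex_of_real (a k i \<omega> * a l j \<omega>)) = 0"
      if Y: "Y \<in> borel_measurable (F s)" and "\<And>\<omega>. norm (Y \<omega>) \<le> 1" and "i < j" for Y :: "'w \<Rightarrow> complex" and k l i j
    proof -
      have YM[measurable]: "Y \<in> borel_measurable M" by (rule measurable_F_M[OF Y st(1)])
      have "(LINT \<omega>|M. (Y \<omega> * complex_of_real (a k i \<omega>)) * complex_of_real (W l (r (Suc j)) \<omega> - W l (r j) \<omega>)) = 0"
      proof (rule expectation_past_times_increment1[OF rpos rS])
        show "(\<lambda>\<omega>. Y \<omega> * complex_of_real (a k i \<omega>)) \<in> borel_measurable (F (r j))"
          by (intro borel_measurable_times measurable_F_mono[OF Y st(1) sr] measurable_compose[OF amF[OF \<open>i < j\<close>]]) auto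
        show "integrable M (\<lambda>\<omega>. Y \<omega> * complex_of_real (a k i \<omega>))"
        proof (rule Bochner_Integration.integrable_bound[OF a1[of k i]])
          show "AE \<omega> in M. norm (Y \<omega> * complex_of_real (a k i \<omega>)) \<le> norm (a k i \<omega>)"
            using that(2) by (auto simp: norm_mult intro!: AE_I2 mult_left_le_one_le)
        qed measurable
      qed
      then show ?thesis by (simp add: a_def mult.assoc)
    qed
    have cross': "(LINT \<omega>|M. Y \<omega> * complex_of_real (a k i \<omega> * a l j \<omega>)) = 0"
      if "Y \<in> borel_measurable (F s)" "\<And>\<omega>. norm (Y \<omega>) \<le> 1" "i \<noteq> j" for Y :: "'w \<Rightarrow> complex" and k l i j
    proof (cases "i < j")
      case True
      then show ?thesis using cross that by blast
    next
      case False
      then have "(LINT \<omega>|M. Y \<omega> * complex_of_real (a l j \<omega> * a k i \<omega>)) = 0"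
        using that by (intro cross) auto
      then show ?thesis by (simp add: mult.commute)
    qed
    have eaa: "expectation (\<lambda>\<omega>. a k i \<omega> * a k j \<omega>) = (if i = j then d else 0)" for k i j
    proof (cases "i = j")
      case True then show ?thesis using ea2[of k j] by (simp add: power2_eq_square)
    next
      case False
      then have "(LINT \<omega>|M. 1 * complex_of_real (a k i \<omega> * a k j \<omega>)) = 0"
        by (intro cross') auto
      then show ?thesis using False by (simp del: of_real_mult)
    qed
    define S where "S \<omega> = (\<Sum>j<N. a k j \<omega> * a l j \<omega>)" for \<omega>
    have [measurable]: "S \<in> borel_measurable M" unfolding S_def by measurable
    have tele: "W m t \<omega> - W m s \<omega> = (\<Sum>j<N. a m j \<omega>)" for m \<omega>
      unfolding a_def using sum_lessThan_telescope[of "\<lambda>j. W m (r j) \<omega>" N] by (simp add: r0 rN)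
    have "?E = (LINT \<omega>|M. (\<Sum>i<N. \<Sum>j<N. Z \<omega> * complex_of_real (a k i \<omega> * a l j \<omega>)))"
      unfolding tele sum_product by (simp add: sum_distrib_left)
    also have "\<dots> = (\<Sum>i<N. \<Sum>j<N. (LINT \<omega>|M. Z \<omega> * complex_of_real (a k i \<omega> * a l j \<omega>)))"
      using Zaa[OF ZM Z1] by (simp del: of_real_mult)
    also have "\<dots> = (\<Sum>i<N. \<Sum>j<N. if i = j then (LINT \<omega>|M. Z \<omega> * complex_of_real (a k i \<omega> * a l i \<omega>)) else 0)"
      using cross'[OF Z Z1] by (intro sum.cong) (auto simp del: of_real_mult)
    also have "\<dots> = (\<Sum>i<N. (LINT \<omega>|M. Z \<omega> * complex_of_real (a k i \<omega> * a l i \<omega>)))"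
      by simp
    also have "\<dots> = (LINT \<omega>|M. Z \<omega> * complex_of_real (S \<omega>))"
      unfolding S_def using Zaa[OF ZM Z1] by (simp add: sum_distrib_left del: of_real_mult)
    finally have E: "?E = (LINT \<omega>|M. Z \<omega> * complex_of_real (S \<omega>))" .
    have S1: "integrable M S" unfolding S_def using aa by simp
    have "norm ?E \<le> expectation (\<lambda>\<omega>. \<bar>S \<omega>\<bar>)"
      unfolding E
    proof (rule order_trans[OF integral_norm_bound integral_mono])
      show "integrable M (\<lambda>\<omega>. norm (Z \<omega> * complex_of_real (S \<omega>)))"
      proof (rule Bochner_Integration.integrable_bound[OF S1])
        show "AE \<omega> in M. norm (norm (Z \<omega> * complex_of_real (S \<omega>))) \<le> norm (S \<omega>)"
           using Z1 by (auto simp: norm_mult intro!: AE_I2 mult_left_le_one_le)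
      qed measurable
      show "integrable M (\<lambda>\<omega>. \<bar>S \<omega>\<bar>)" using S1 by simp
      show "norm (Z \<omega> * complex_of_real (S \<omega>)) \<le> \<bar>S \<omega>\<bar>" for \<omega>
        using Z1 by (auto simp: norm_mult intro!: mult_left_le_one_le)
    qed
    then have "(norm ?E)\<^sup>2 \<le> (expectation (\<lambda>\<omega>. \<bar>S \<omega>\<bar>))\<^sup>2"
      by (intro power_mono) auto
    also have "\<dots> \<le> expectation (\<lambda>\<omega>. (S \<omega>)\<^sup>2)"
    proof -
      have S2: "integrable M (\<lambda>\<omega>. (S \<omega>)\<^sup>2)"
        unfolding S_def power2_eq_square sum_product
        using integrable_two_motions[OF assms(1) rpos rpos rpos rpos, OF aa[unfolded a_def]]
        by (intro Bochner_Integration.integrable_sum) (simp add: a_def algebra_simps)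
      have "0 \<le> variance (\<lambda>\<omega>. \<bar>S \<omega>\<bar>)" by (rule variance_positive)
      also have "\<dots> = expectation (\<lambda>\<omega>. (S \<omega>)\<^sup>2) - (expectation (\<lambda>\<omega>. \<bar>S \<omega>\<bar>))\<^sup>2"
        using S1 S2 by (subst variance_eq) auto
      finally show ?thesis by simp
    qed
    also have "expectation (\<lambda>\<omega>. (S \<omega>)\<^sup>2) =
        expectation (\<lambda>\<omega>. \<Sum>i<N. \<Sum>j<N. (a k i \<omega> * a k j \<omega>) * (a l i \<omega> * a l j \<omega>))"
      unfolding S_def power2_eq_square sum_product by (simp add: algebra_simps)
    also have "\<dots> = (\<Sum>i<N. \<Sum>j<N. expectation (\<lambda>\<omega>. a k i \<omega> * a k j \<omega>) * expectation (\<lambda>\<omega>. a l i \<omega> * a l j \<omega>))"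
      using integrable_two_motions[OF assms(1) rpos rpos rpos rpos, OF aa[unfolded a_def]]
        expectation_two_motions[OF assms(1) rpos rpos rpos rpos, OF aa[unfolded a_def]]
      by (simp add: a_def[abs_def])
    also have "\<dots> = (\<Sum>i<N. \<Sum>j<N. if i = j then d * d else 0)"
      unfolding eaa by (intro sum.cong) auto
    also have "\<dots> = real N * d\<^sup>2" by (simp add: power2_eq_square)
    also have "\<dots> = (t - s)\<^sup>2 / real N" using that by (simp add: d_def power2_eq_square)
    finally show ?thesis .
  qed
  have "(\<lambda>N. (t - s)\<^sup>2 / real N) \<longlonglongrightarrow> 0"
    by (intro tendsto_divide_0[OF tendsto_const] filterlim_at_top_imp_at_infinity filterlim_real_sequentially)
  moreover have "\<forall>\<^sub>F N in sequentially. (norm ?E)\<^sup>2 \<le> (t - s)\<^sup>2 / real N"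
    using bound by (auto simp: eventually_sequentially intro!: exI[of _ 1])
  ultimately have "(norm ?E)\<^sup>2 \<le> 0"
    by (intro tendsto_lowerbound[of "\<lambda>N. (t - s)\<^sup>2 / real N"]) auto
  then show ?thesis by simp
qed

end

section \<open>Independence of the joint increments from the past\<close>

text \<open>
  A crude bound; it avoids mixed third moments, about which nothing is known conditionally.
\<close>
lemma sum_cubed_le:
  fixes x :: "nat \<Rightarrow> real"
  assumes "\<And>k. 0 \<le> x k"
  shows "(\<Sum>k<n. x k) ^ 3 \<le> (\<Sum>k<n. (real n * x k) ^ 3)"
proof (cases "n = 0")
  case False
  then have fin: "finite (x ` {..<n})" "x ` {..<n} \<noteq> {}" by auto
  from Max_in[OF this] obtain m where m: "m < n" "x m = Max (x ` {..<n})" by auto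
  then have "x k \<le> x m" if "k < n" for k using that fin by simp
  then have "(\<Sum>k<n. x k) \<le> real n * x m"
    using sum_bounded_above[of "{..<n}" x "x m"] by simp
  then have "(\<Sum>k<n. x k) ^ 3 \<le> (real n * x m) ^ 3"
    using assms by (intro power_mono sum_nonneg) auto
  also have "\<dots> \<le> (\<Sum>k<n. (real n * x k) ^ 3)"
    using m(1) assms by (intro member_le_sum) auto
  finally show ?thesis .
qed simp

context wiener_basis
begin

text \<open>
  Second order expansion of the conditional joint characteristic function, with an error that is
  uniform in the interval and in the weight \<open>Z\<close> from the past.
\<close>
lemma joint_char_expansion:
  fixes u :: "nat \<Rightarrow> real" and n :: nat
  shows "\<exists>C\<ge>0. \<forall>s t (Z :: 'w \<Rightarrow> complex). 0 \<le> s \<longrightarrow> s < t \<longrightarrow> Z \<in> borel_measurable (F s) \<longrightarrow> (\<forall>\<omega>. norm (Z \<omega>) \<le> 1) \<longrightarrow>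
    norm ((LINT \<omega>|M. Z \<omega> * iexp (\<Sum>k<n. u k * (W k t \<omega> - W k s \<omega>)))
      - (LINT \<omega>|M. Z \<omega>) * complex_of_real (1 - (t - s) * (\<Sum>k<n. (u k)\<^sup>2) / 2)) \<le> C * sqrt (t - s) ^ 3"
proof (intro exI conjI allI impI)
  let ?c = "2 * sqrt (2 / pi)"
  define C where "C = (\<Sum>k<n. (real n * \<bar>u k\<bar>) ^ 3 * ?c) / 6"
  show "0 \<le> C" unfolding C_def by (intro divide_nonneg_nonneg sum_nonneg mult_nonneg_nonneg) auto
  fix s t :: real and Z :: "'w \<Rightarrow> complex"
  assume st: "0 \<le> s" "s < t" and Z: "Z \<in> borel_measurable (F s)" and "\<forall>\<omega>. norm (Z \<omega>) \<le> 1"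
  then have Z1: "norm (Z \<omega>) \<le> 1" for \<omega> by blast
  have ZM[measurable]: "Z \<in> borel_measurable M" by (rule measurable_F_M[OF Z st(1)])
  have Zi: "integrable M Z" by (rule integrable_const_bound[where B=1]) (auto simp: Z1)
  define D where "D k \<omega> = W k t \<omega> - W k s \<omega>" for k \<omega>
  have [measurable]: "D k \<in> borel_measurable M" for k
    unfolding D_def using st by (intro borel_measurable_diff measurable_W) auto
  have D1: "integrable M (D k)" and D2: "integrable M (\<lambda>\<omega>. (D k \<omega>)\<^sup>2)" and D3: "integrable M (\<lambda>\<omega>. \<bar>D k \<omega>\<bar> ^ 3)" for k
    using integrable_increment_power[OF st, of k 1] integrable_increment_power[OF st, of k 2]
      integrable_increment_abs_power[OF st, of k 3] by (simp_all add: D_def[abs_def])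
  have D3e: "expectation (\<lambda>\<omega>. \<bar>D k \<omega>\<bar> ^ 3) = ?c * sqrt (t - s) ^ 3" for k
    using expectation_increment_cube[OF st, of k] by (simp add: D_def)
  have ZD: "integrable M (\<lambda>\<omega>. Z \<omega> * complex_of_real (D k \<omega>))"
    "(LINT \<omega>|M. Z \<omega> * complex_of_real (D k \<omega>)) = 0" for k
    unfolding D_def by (rule integrable_past_times_increment1[OF st Z Zi] expectation_past_times_increment1[OF st Z Zi])+
  have DD: "integrable M (\<lambda>\<omega>. D k \<omega> * D l \<omega>)" for k l
  proof (rule Bochner_Integration.integrable_bound)
    show "integrable M (\<lambda>\<omega>. (D k \<omega>)\<^sup>2 + (D l \<omega>)\<^sup>2)" using D2 by simp
    show "AE \<omega> in M. norm (D k \<omega> * D l \<omega>) \<le> norm ((D k \<omega>)\<^sup>2 + (D l \<omega>)\<^sup>2)"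
    proof (rule AE_I2)
      fix \<omega>
      have "2 * (\<bar>D k \<omega>\<bar> * \<bar>D l \<omega>\<bar>) \<le> (D k \<omega>)\<^sup>2 + (D l \<omega>)\<^sup>2"
        using sum_squares_bound[of "\<bar>D k \<omega>\<bar>" "\<bar>D l \<omega>\<bar>"] by (simp add: algebra_simps)
      moreover have "0 \<le> \<bar>D k \<omega>\<bar> * \<bar>D l \<omega>\<bar>" by simp
      ultimately show "norm (D k \<omega> * D l \<omega>) \<le> norm ((D k \<omega>)\<^sup>2 + (D l \<omega>)\<^sup>2)"
        unfolding real_norm_def abs_mult by linarith
    qed
  qed measurable
  have ZDD: "integrable M (\<lambda>\<omega>. Z \<omega> * complex_of_real (D k \<omega> * D l \<omega>))" for k l
  proof (rule Bochner_Integration.integrable_bound[OF DD[of k l]])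
    show "AE \<omega> in M. norm (Z \<omega> * complex_of_real (D k \<omega> * D l \<omega>)) \<le> norm (D k \<omega> * D l \<omega>)"
      using Z1 by (auto simp: norm_mult simp del: of_real_mult intro!: AE_I2 mult_left_le_one_le)
  qed measurable
  have ZDDe: "(LINT \<omega>|M. Z \<omega> * complex_of_real (D k \<omega> * D l \<omega>)) =
      (if k = l then (LINT \<omega>|M. Z \<omega>) * complex_of_real (t - s) else 0)" for k l
  proof (cases "k = l")
    case True
    then show ?thesis
      using expectation_past_times_increment2[OF st Z Zi, of k] by (simp add: D_def power2_eq_square)
  next
    case False
    then show ?thesis
      using orthogonal_increments[OF False st Z Z1] by (simp add: D_def)
  qed
  define U where "U \<omega> = (\<Sum>k<n. u k * D k \<omega>)" for \<omega>
  have [measurable]: "U \<in> borel_measurable M" unfolding U_def by measurable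
  have ZU: "integrable M (\<lambda>\<omega>. Z \<omega> * complex_of_real (U \<omega>))" "(LINT \<omega>|M. Z \<omega> * complex_of_real (U \<omega>)) = 0"
  proof -
    have *: "Z \<omega> * complex_of_real (U \<omega>) = (\<Sum>k<n. complex_of_real (u k) * (Z \<omega> * complex_of_real (D k \<omega>)))" for \<omega>
      by (simp add: U_def sum_distrib_left algebra_simps)
    show "integrable M (\<lambda>\<omega>. Z \<omega> * complex_of_real (U \<omega>))" unfolding * using ZD by simp
    show "(LINT \<omega>|M. Z \<omega> * complex_of_real (U \<omega>)) = 0" unfolding * using ZD by simp
  qed
  have ZUU: "integrable M (\<lambda>\<omega>. Z \<omega> * complex_of_real ((U \<omega>)\<^sup>2))"
    "(LINT \<omega>|M. Z \<omega> * complex_of_real ((U \<omega>)\<^sup>2)) = (LINT \<omega>|M. Z \<omega>) * complex_of_real ((t - s) * (\<Sum>k<n. (u k)\<^sup>2))"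
  proof -
    have *: "Z \<omega> * complex_of_real ((U \<omega>)\<^sup>2) =
      (\<Sum>k<n. \<Sum>l<n. complex_of_real (u k * u l) * (Z \<omega> * complex_of_real (D k \<omega> * D l \<omega>)))" for \<omega>
      unfolding U_def power2_eq_square sum_product by (simp add: sum_distrib_left algebra_simps)
    show "integrable M (\<lambda>\<omega>. Z \<omega> * complex_of_real ((U \<omega>)\<^sup>2))" unfolding *
      using ZDD by (intro Bochner_Integration.integrable_sum integrable_mult_right)
    have "(LINT \<omega>|M. Z \<omega> * complex_of_real ((U \<omega>)\<^sup>2)) =
      (\<Sum>k<n. \<Sum>l<n. complex_of_real (u k * u l) * (LINT \<omega>|M. Z \<omega> * complex_of_real (D k \<omega> * D l \<omega>)))"
      unfolding * using ZDD by (simp del: of_real_mult)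
    also have "\<dots> = (\<Sum>k<n. \<Sum>l<n. if k = l then complex_of_real (u k * u k) * ((LINT \<omega>|M. Z \<omega>) * complex_of_real (t - s)) else 0)"
      unfolding ZDDe by (intro sum.cong) auto
    also have "\<dots> = (LINT \<omega>|M. Z \<omega>) * complex_of_real ((t - s) * (\<Sum>k<n. (u k)\<^sup>2))"
      by (simp add: sum_distrib_left power2_eq_square algebra_simps)
    finally show "(LINT \<omega>|M. Z \<omega> * complex_of_real ((U \<omega>)\<^sup>2)) = (LINT \<omega>|M. Z \<omega>) * complex_of_real ((t - s) * (\<Sum>k<n. (u k)\<^sup>2))" .
  qed
  define T where "T x = 1 + \<i> * complex_of_real x - complex_of_real (x\<^sup>2) / 2" for x :: real
  have T: "norm (iexp x - T x) \<le> \<bar>x\<bar> ^ 3 / 6" for x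
    using iexp_approx1[of x 2] by (simp add: T_def eval_nat_numeral algebra_simps)
  have ZT: "Z \<omega> * T (U \<omega>) = Z \<omega> + \<i> * (Z \<omega> * complex_of_real (U \<omega>)) - (Z \<omega> * complex_of_real ((U \<omega>)\<^sup>2)) / 2" for \<omega>
    by (simp add: T_def algebra_simps)
  have ZTi: "integrable M (\<lambda>\<omega>. Z \<omega> * T (U \<omega>))"
    unfolding ZT using Zi ZU ZUU by (intro Bochner_Integration.integrable_diff Bochner_Integration.integrable_add) auto
  have ZTe: "(LINT \<omega>|M. Z \<omega> * T (U \<omega>)) = (LINT \<omega>|M. Z \<omega>) * complex_of_real (1 - (t - s) * (\<Sum>k<n. (u k)\<^sup>2) / 2)"
  proof -
    have "(LINT \<omega>|M. Z \<omega> * T (U \<omega>)) = (LINT \<omega>|M. Z \<omega>) + \<i> * (LINT \<omega>|M. Z \<omega> * complex_of_real (U \<omega>)) -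
      (LINT \<omega>|M. Z \<omega> * complex_of_real ((U \<omega>)\<^sup>2)) / 2"
      unfolding ZT using Zi ZU(1) ZUU(1) by (simp del: of_real_power)
    then show ?thesis unfolding ZU(2) ZUU(2) by (simp add: algebra_simps)
  qed
  have Zexp: "integrable M (\<lambda>\<omega>. Z \<omega> * iexp (U \<omega>))"
    by (rule integrable_const_bound[where B=1]) (auto simp: norm_mult Z1)
  define R where "R \<omega> = (\<Sum>k<n. (real n * \<bar>u k\<bar>) ^ 3 * \<bar>D k \<omega>\<bar> ^ 3) / 6" for \<omega>
  have Ri: "integrable M R" unfolding R_def using D3 by simp
  have UR: "\<bar>U \<omega>\<bar> ^ 3 / 6 \<le> R \<omega>" for \<omega>
  proof -
    have "\<bar>U \<omega>\<bar> \<le> (\<Sum>k<n. \<bar>u k * D k \<omega>\<bar>)" unfolding U_def by (rule sum_abs)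
    then have "\<bar>U \<omega>\<bar> ^ 3 \<le> (\<Sum>k<n. \<bar>u k * D k \<omega>\<bar>) ^ 3" by (intro power_mono) auto
    also have "\<dots> \<le> (\<Sum>k<n. (real n * \<bar>u k * D k \<omega>\<bar>) ^ 3)" by (rule sum_cubed_le) simp
    finally show ?thesis by (simp add: R_def abs_mult power_mult_distrib mult.assoc)
  qed
  have "(LINT \<omega>|M. Z \<omega> * iexp (\<Sum>k<n. u k * (W k t \<omega> - W k s \<omega>)))
      - (LINT \<omega>|M. Z \<omega>) * complex_of_real (1 - (t - s) * (\<Sum>k<n. (u k)\<^sup>2) / 2) =
    (LINT \<omega>|M. Z \<omega> * iexp (U \<omega>)) - (LINT \<omega>|M. Z \<omega> * T (U \<omega>))"
    unfolding ZTe by (simp add: U_def D_def)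
  also have "\<dots> = (LINT \<omega>|M. Z \<omega> * (iexp (U \<omega>) - T (U \<omega>)))"
    using Zexp ZTi by (simp add: right_diff_distrib)
  also have "norm \<dots> \<le> expectation R"
  proof (rule order_trans[OF integral_norm_bound integral_mono])
    show "integrable M (\<lambda>\<omega>. norm (Z \<omega> * (iexp (U \<omega>) - T (U \<omega>))))"
      using Zexp ZTi by (intro integrable_norm) (simp add: right_diff_distrib)
    show "norm (Z \<omega> * (iexp (U \<omega>) - T (U \<omega>))) \<le> R \<omega>" for \<omega>
    proof -
      have "norm (Z \<omega> * (iexp (U \<omega>) - T (U \<omega>))) \<le> norm (iexp (U \<omega>) - T (U \<omega>))"
        unfolding norm_mult by (rule mult_left_le_one_le) (auto simp: Z1)
      also have "\<dots> \<le> R \<omega>" using T UR order_trans by blast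
      finally show ?thesis .
    qed
  qed (rule Ri)
  also have "expectation R = C * sqrt (t - s) ^ 3"
    unfolding R_def C_def using D3 by (simp add: D3e sum_distrib_right mult.assoc)
  finally show "norm ((LINT \<omega>|M. Z \<omega> * iexp (\<Sum>k<n. u k * (W k t \<omega> - W k s \<omega>)))
      - (LINT \<omega>|M. Z \<omega>) * complex_of_real (1 - (t - s) * (\<Sum>k<n. (u k)\<^sup>2) / 2)) \<le> C * sqrt (t - s) ^ 3" .
qed

text \<open>
  The expansion is applied on each of \<open>N\<close> equal parts of the interval. The errors add up to order
  \<open>N * (1 / N) powr (3 / 2)\<close>, and the main terms to \<open>(1 - x / N) ^ N\<close>.
\<close>
lemma joint_char_increments:
  fixes Z :: "'w \<Rightarrow> complex"
  assumes st: "0 \<le> s" "s < t" and Z: "Z \<in> borel_measurable (F s)" and Z1: "\<And>\<omega>. norm (Z \<omega>) \<le> 1"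
  shows "(LINT \<omega>|M. Z \<omega> * iexp (\<Sum>k<n. u k * (W k t \<omega> - W k s \<omega>))) =
    (LINT \<omega>|M. Z \<omega>) * complex_of_real (exp (- (t - s) * (\<Sum>k<n. (u k)\<^sup>2) / 2))"
proof -
  define q where "q = (\<Sum>k<n. (u k)\<^sup>2)"
  have q: "0 \<le> q" unfolding q_def by (intro sum_nonneg) auto
  obtain C where C: "0 \<le> C" and exp: "\<And>s t (Z :: 'w \<Rightarrow> complex). 0 \<le> s \<Longrightarrow> s < t \<Longrightarrow> Z \<in> borel_measurable (F s) \<Longrightarrow>
    (\<And>\<omega>. norm (Z \<omega>) \<le> 1) \<Longrightarrow> norm ((LINT \<omega>|M. Z \<omega> * iexp (\<Sum>k<n. u k * (W k t \<omega> - W k s \<omega>)))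
      - (LINT \<omega>|M. Z \<omega>) * complex_of_real (1 - (t - s) * q / 2)) \<le> C * sqrt (t - s) ^ 3"
    using joint_char_expansion[where u=u and n=n] unfolding q_def by auto
  define h where "h = t - s"
  have h: "h > 0" using st by (simp add: h_def)
  define \<Phi> where "\<Phi> r = (LINT \<omega>|M. Z \<omega> * iexp (\<Sum>k<n. u k * (W k r \<omega> - W k s \<omega>)))" for r
  define c where "c N = 1 - (h / real N) * q / 2" for N :: nat
  have bound: "norm (\<Phi> t - (LINT \<omega>|M. Z \<omega>) * complex_of_real (c N ^ N)) \<le> real N * (C * sqrt (h / real N) ^ 3)"
    if N: "N > 0" "h * q / 2 \<le> real N" for N
  proof -
    define d where "d = h / real N"
    have d: "d > 0" using h N by (simp add: d_def)
    define r where "r j = s + real j * d" for j :: nat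
    have r0: "r 0 = s" and rN: "r N = t" using N by (auto simp: r_def d_def h_def)
    have rpos: "0 \<le> r j" and rS: "r j < r (Suc j)" and rd: "r (Suc j) - r j = d" and sr: "s \<le> r j" for j
      using d st by (auto simp: r_def algebra_simps)
    \<comment> \<open>For large N the factor does not exceed 1 in absolute value, so earlier errors are not amplified.\<close>
    have c1: "\<bar>c N\<bar> \<le> 1"
      using N q h d unfolding c_def by (auto simp: abs_le_iff field_simps)
    have "norm (\<Phi> (r j) - (LINT \<omega>|M. Z \<omega>) * complex_of_real (c N ^ j)) \<le> real j * (C * sqrt d ^ 3)" for j
    proof (induction j)
      case 0
      then show ?case by (simp add: \<Phi>_def r0)
    next
      case (Suc j)
      define Y where "Y \<omega> = Z \<omega> * iexp (\<Sum>k<n. u k * (W k (r j) \<omega> - W k s \<omega>))" for \<omega>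
      have Y: "Y \<in> borel_measurable (F (r j))"
      proof -
        have [measurable]: "Z \<in> borel_measurable (F (r j))" by (rule measurable_F_mono[OF Z st(1) sr])
        have [measurable]: "(\<lambda>\<omega>. W k (r j) \<omega> - W k s \<omega>) \<in> borel_measurable (F (r j))" for k
          by (rule increment_adapted[OF st(1) sr order_refl])
        show ?thesis unfolding Y_def by measurable
      qed
      have Y1: "norm (Y \<omega>) \<le> 1" for \<omega> using Z1 by (simp add: Y_def norm_mult)
      have Ye: "(LINT \<omega>|M. Y \<omega>) = \<Phi> (r j)" by (simp add: Y_def \<Phi>_def)
      have YS: "Y \<omega> * iexp (\<Sum>k<n. u k * (W k (r (Suc j)) \<omega> - W k (r j) \<omega>)) =
          Z \<omega> * iexp (\<Sum>k<n. u k * (W k (r (Suc j)) \<omega> - W k s \<omega>))" for \<omega>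
      proof -
        have "(\<Sum>k<n. u k * (W k (r (Suc j)) \<omega> - W k s \<omega>)) =
          (\<Sum>k<n. u k * (W k (r j) \<omega> - W k s \<omega>)) + (\<Sum>k<n. u k * (W k (r (Suc j)) \<omega> - W k (r j) \<omega>))"
          unfolding sum.distrib[symmetric] by (simp add: algebra_simps)
        then show ?thesis unfolding Y_def by (simp only: of_real_add distrib_left exp_add mult.assoc)
      qed
      have "norm (\<Phi> (r (Suc j)) - \<Phi> (r j) * complex_of_real (c N)) \<le> C * sqrt d ^ 3"
        using exp[OF rpos rS Y Y1] unfolding YS Ye rd by (simp add: \<Phi>_def c_def d_def)
      moreover have "norm (\<Phi> (r j) * complex_of_real (c N) - (LINT \<omega>|M. Z \<omega>) * complex_of_real (c N ^ Suc j)) \<le>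
        real j * (C * sqrt d ^ 3)"
      proof -
        have "\<Phi> (r j) * complex_of_real (c N) - (LINT \<omega>|M. Z \<omega>) * complex_of_real (c N ^ Suc j) =
          complex_of_real (c N) * (\<Phi> (r j) - (LINT \<omega>|M. Z \<omega>) * complex_of_real (c N ^ j))"
          by (simp add: algebra_simps)
        then have "norm (\<Phi> (r j) * complex_of_real (c N) - (LINT \<omega>|M. Z \<omega>) * complex_of_real (c N ^ Suc j)) =
          \<bar>c N\<bar> * norm (\<Phi> (r j) - (LINT \<omega>|M. Z \<omega>) * complex_of_real (c N ^ j))"
          by (simp add: norm_mult)
        also have "\<dots> \<le> norm (\<Phi> (r j) - (LINT \<omega>|M. Z \<omega>) * complex_of_real (c N ^ j))"
          using c1 by (intro mult_left_le_one_le) auto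
        finally show ?thesis using Suc.IH by linarith
      qed
      ultimately have "norm ((\<Phi> (r (Suc j)) - \<Phi> (r j) * complex_of_real (c N)) +
          (\<Phi> (r j) * complex_of_real (c N) - (LINT \<omega>|M. Z \<omega>) * complex_of_real (c N ^ Suc j))) \<le>
        C * sqrt d ^ 3 + real j * (C * sqrt d ^ 3)"
        by (intro norm_triangle_mono)
      then show ?case by (simp add: algebra_simps)
    qed
    from this[of N] show ?thesis by (simp add: rN d_def)
  qed
  have "(\<lambda>N. \<Phi> t - (LINT \<omega>|M. Z \<omega>) * complex_of_real (c N ^ N)) \<longlonglongrightarrow> 0"
  proof (rule Lim_null_comparison)
    show "\<forall>\<^sub>F N in sequentially. norm (\<Phi> t - (LINT \<omega>|M. Z \<omega>) * complex_of_real (c N ^ N)) \<le>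
      (C * sqrt h ^ 3) / sqrt (real N)"
      using eventually_gt_at_top[of 0] eventually_ge_at_top[of "nat \<lceil>h * q / 2\<rceil>"]
    proof eventually_elim
      case (elim N)
      have "real N * (C * sqrt (h / real N) ^ 3) = (C * sqrt h ^ 3) / sqrt (real N)"
        using elim by (simp add: real_sqrt_divide power_divide field_simps eval_nat_numeral)
      moreover have "h * q / 2 \<le> real N" using elim by linarith
      ultimately show ?case using bound[of N] elim by simp
    qed
    show "(\<lambda>N. (C * sqrt h ^ 3) / sqrt (real N)) \<longlonglongrightarrow> 0"
      by (intro tendsto_divide_0[OF tendsto_const] filterlim_at_top_imp_at_infinity
          filterlim_compose[OF sqrt_at_top] filterlim_real_sequentially)
  qed
  moreover have "(\<lambda>N. \<Phi> t - (LINT \<omega>|M. Z \<omega>) * complex_of_real (c N ^ N)) \<longlonglongrightarrow>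
      \<Phi> t - (LINT \<omega>|M. Z \<omega>) * complex_of_real (exp (- (h * q / 2)))"
  proof -
    have "(\<lambda>N. c N ^ N) \<longlonglongrightarrow> exp (- (h * q / 2))"
      using tendsto_exp_limit_sequentially[of "- (h * q / 2)"] by (simp add: c_def field_simps)
    then show ?thesis by (intro tendsto_intros)
  qed
  ultimately have "\<Phi> t - (LINT \<omega>|M. Z \<omega>) * complex_of_real (exp (- (h * q / 2))) = 0"
    by (rule LIMSEQ_unique[symmetric])
  moreover have "- (h * q / 2) = - (t - s) * (\<Sum>k<n. (u k)\<^sup>2) / 2"
    unfolding h_def q_def by (simp only: mult_minus_left minus_divide_left)
  ultimately show ?thesis unfolding \<Phi>_def by simp
qed

text \<open>
  Given the past, the increments of the first \<open>n\<close> motions over an interval are independent centred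
  normal variables.
\<close>
lemma indep_step:
  assumes st: "0 \<le> s" "s < t" and A: "A \<in> sets (F s)" and B: "\<And>k. B k \<in> sets borel"
  shows "prob {\<omega>\<in>A. \<forall>k<n. W k t \<omega> - W k s \<omega> \<in> B k} =
    prob A * (\<Prod>k<n. measure (density lborel (normal_density 0 (sqrt (t - s)))) (B k))"
proof -
  have AM: "A \<in> events" using A sets_F st by auto
  have Dm[measurable]: "(\<lambda>\<omega>. W k t \<omega> - W k s \<omega>) \<in> borel_measurable M" for k
    using st by (intro borel_measurable_diff measurable_W) auto
  \<comment> \<open>The joint formula with all frequencies except that of index k set to 0.\<close>
  have char: "(LINT \<omega>|M. iexp (v * (W k t \<omega> - W k s \<omega>))) = complex_of_real (exp (- (t - s) * v\<^sup>2 / 2))" for k v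
  proof -
    have *: "(\<Sum>j<Suc k. (if j = k then v else 0) * x j) = v * x k" for x :: "nat \<Rightarrow> real"
      by (simp add: if_distrib[of "\<lambda>a. a * _"] cong: if_cong)
    have **: "(\<Sum>j<Suc k. (if j = k then v else 0)\<^sup>2) = v\<^sup>2"
      by (simp add: if_distrib[of "\<lambda>a. a\<^sup>2"] cong: if_cong)
    show ?thesis
      using joint_char_increments[OF st, where Z="\<lambda>_. 1" and n="Suc k" and u="\<lambda>j. if j = k then v else 0"]
      unfolding * ** by (simp add: prob_space)
  qed
  have "prob {\<omega>\<in>A. \<forall>k<n. W k t \<omega> - W k s \<omega> \<in> B k} =
    prob A * (\<Prod>k<n. prob {\<omega>\<in>space M. W k t \<omega> - W k s \<omega> \<in> B k})"
  proof (rule indep_from_joint_char[where c="\<lambda>k v. exp (- (t - s) * v\<^sup>2 / 2)"])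
    fix u
    have "(\<lambda>\<omega>. indicator A \<omega> :: complex) \<in> borel_measurable (F s)" using A by simp
    from joint_char_increments[OF st this, where n=n and u=u]
    have "(LINT \<omega>|M. indicator A \<omega> * iexp (\<Sum>k<n. u k * (W k t \<omega> - W k s \<omega>))) =
      (LINT \<omega>|M. indicator A \<omega>) * complex_of_real (exp (- (t - s) * (\<Sum>k<n. (u k)\<^sup>2) / 2))"
      by (simp add: indicator_def)
    moreover have "(LINT \<omega>|M. indicator A \<omega>) = complex_of_real (prob A)"
    proof -
      have "(LINT \<omega>|M. indicator A \<omega>) = (LINT \<omega>|M. complex_of_real (indicat_real A \<omega>))"
        by (intro Bochner_Integration.integral_cong) (auto simp: indicator_def)
      then show ?thesis using AM by (simp add: Int_absorb1[OF sets.sets_into_space] Int_commute)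
    qed
    moreover have "exp (- (t - s) * (\<Sum>k<n. (u k)\<^sup>2) / 2) = (\<Prod>k<n. exp (- (t - s) * (u k)\<^sup>2 / 2))"
      by (simp add: exp_sum[symmetric] sum_distrib_left sum_divide_distrib)
    ultimately show "(LINT \<omega>|M. indicator A \<omega> * iexp (\<Sum>k<n. u k * (W k t \<omega> - W k s \<omega>))) =
      complex_of_real (prob A * (\<Prod>k<n. exp (- (t - s) * (u k)\<^sup>2 / 2)))" by simp
  qed (use char AM B in auto)
  moreover have "prob {\<omega>\<in>space M. W k t \<omega> - W k s \<omega> \<in> B k} =
      measure (density lborel (normal_density 0 (sqrt (t - s)))) (B k)" for k
  proof -
    have "measure (distr M lborel (\<lambda>\<omega>. W k t \<omega> - W k s \<omega>)) (B k) =
      measure (density lborel (normal_density 0 (sqrt (t - s)))) (B k)"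
      using distributed_distr_eq_density[OF increment_distributed[OF st, of k]] by simp
    then show ?thesis using B[of k]
      by (subst (asm) measure_distr) (auto simp: vimage_def Int_def conj_commute)
  qed
  ultimately show ?thesis by simp
qed

end

section \<open>The law of the dyadic values\<close>

text \<open>
  The law of an increment over a dyadic interval of level \<open>N\<close>.
\<close>
definition gauss :: "nat \<Rightarrow> real measure" where
  "gauss N = density lborel (normal_density 0 (sqrt (1 / 2 ^ N)))"

definition dyadic_increment :: "(nat \<Rightarrow> real \<Rightarrow> 'a \<Rightarrow> real) \<Rightarrow> nat \<Rightarrow> nat \<Rightarrow> nat \<Rightarrow> 'a \<Rightarrow> real" where
  "dyadic_increment X N k j \<omega> = X k (real (Suc j) / 2 ^ N) \<omega> - X k (real j / 2 ^ N) \<omega>"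

text \<open>
  A family of processes started at zero whose increments over the dyadic intervals of each level are
  independent and distributed as those of independent Brownian motions. The filtration no longer
  appears, so the notion survives conditioning on an initial event.
\<close>
definition gaussian_grid :: "'a measure \<Rightarrow> (nat \<Rightarrow> real \<Rightarrow> 'a \<Rightarrow> real) \<Rightarrow> bool" where
  "gaussian_grid P X \<longleftrightarrow> prob_space P \<and>
     (\<forall>k. \<forall>t\<ge>0. X k t \<in> borel_measurable P) \<and> (\<forall>\<omega>\<in>space P. \<forall>k. X k 0 \<omega> = 0) \<and>
     (\<forall>N m n B. (\<forall>k j. B k j \<in> sets borel) \<longrightarrow>
        measure P {\<omega>\<in>space P. \<forall>j<m. \<forall>k<n. dyadic_increment X N k j \<omega> \<in> B k j} =
        (\<Prod>j<m. \<Prod>k<n. measure (gauss N) (B k j)))"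

lemma prob_space_gauss: "prob_space (gauss N)"
  unfolding gauss_def by (rule prob_space_normal_density) simp

lemma sets_gauss [measurable_cong, simp]: "sets (gauss N) = sets borel"
  by (simp add: gauss_def)

lemma space_gauss [simp]: "space (gauss N) = UNIV"
  by (simp add: gauss_def)

context wiener_basis
begin

lemma dyadic_increments_indep:
  assumes A: "A \<in> sets (F 0)" and B: "\<And>k j. B k j \<in> sets borel"
  shows "prob {\<omega>\<in>A. \<forall>j<m. \<forall>k<n. dyadic_increment W N k j \<omega> \<in> B k j} =
    prob A * (\<Prod>j<m. \<Prod>k<n. measure (gauss N) (B k j))"
proof -
  define E where "E m = {\<omega>\<in>A. \<forall>j<m. \<forall>k<n. dyadic_increment W N k j \<omega> \<in> B k j}" for m
  define r where "r j = real j / 2 ^ N" for j :: nat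
  have r: "0 \<le> r j" "r j < r (Suc j)" "r (Suc j) - r j = 1 / 2 ^ N" for j
    by (auto simp: r_def field_simps)
  have ES: "E (Suc m) = {\<omega>\<in>E m. \<forall>k<n. W k (r (Suc m)) \<omega> - W k (r m) \<omega> \<in> B k m}" for m
    by (auto simp: E_def dyadic_increment_def r_def less_Suc_eq)
  have EF: "E m \<in> sets (F (r m))" for m
  proof (induction m)
    case 0
    then show ?case using A by (simp add: E_def r_def)
  next
    case (Suc m)
    have sp: "E m \<subseteq> space M" using sets.sets_into_space[OF Suc] space_F[OF r(1)] by simp
    note [measurable] = B
    have [measurable]: "(\<lambda>\<omega>. W k (r (Suc m)) \<omega> - W k (r m) \<omega>) \<in> borel_measurable (F (r (Suc m)))" for k
      using r by (intro increment_adapted) (auto simp: less_imp_le)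
    have "{\<omega>\<in>space (F (r (Suc m))). \<forall>k<n. W k (r (Suc m)) \<omega> - W k (r m) \<omega> \<in> B k m} \<in> sets (F (r (Suc m)))"
      by measurable
    moreover have "E m \<in> sets (F (r (Suc m)))"
      using Suc mono_F[OF r(1) less_imp_le[OF r(2)]] by auto
    ultimately have "E m \<inter> {\<omega>\<in>space (F (r (Suc m))). \<forall>k<n. W k (r (Suc m)) \<omega> - W k (r m) \<omega> \<in> B k m} \<in> sets (F (r (Suc m)))"
      by (rule sets.Int[rotated])
    moreover have "E (Suc m) = E m \<inter> {\<omega>\<in>space (F (r (Suc m))). \<forall>k<n. W k (r (Suc m)) \<omega> - W k (r m) \<omega> \<in> B k m}"
      unfolding ES using sp space_F[OF r(1)] by auto
    ultimately show ?case by simp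
  qed
  have "prob (E m) = prob A * (\<Prod>j<m. \<Prod>k<n. measure (gauss N) (B k j))"
  proof (induction m)
    case 0
    then show ?case by (simp add: E_def)
  next
    case (Suc m)
    show ?case
      unfolding ES using indep_step[OF r(1,2) EF, where B="\<lambda>k. B k m" and n=n] B Suc
      by (simp add: r(3) gauss_def mult.assoc)
  qed
  then show ?thesis by (simp add: E_def)
qed

lemma gaussian_grid_W: "gaussian_grid M W"
proof -
  have "space M \<in> sets (F 0)" using space_F[of 0] sets.top[of "F 0"] by simp
  from dyadic_increments_indep[OF this] show ?thesis
    unfolding gaussian_grid_def using prob_space_axioms measurable_W start_zero by (auto simp: prob_space)
qed

text \<open>
  Conditioning on an event at time zero preserves the law of the increments. In combination with
  \<open>law_dyadic_values_unique\<close> this expresses the independence of the whole family \<open>W\<close> from the initial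
  sigma-algebra.
\<close>
lemma gaussian_grid_conditioned:
  assumes A: "A \<in> sets (F 0)" "prob A > 0"
  shows "gaussian_grid (uniform_measure M A) W"
proof -
  have AM: "A \<in> events" using A sets_F[of 0] by auto
  then have p: "emeasure M A \<noteq> 0" "emeasure M A \<noteq> \<infinity>" using A by (auto simp: emeasure_eq_measure)
  have "measure (uniform_measure M A) {\<omega>\<in>space M. \<forall>j<m. \<forall>k<n. dyadic_increment W N k j \<omega> \<in> B k j} =
      (\<Prod>j<m. \<Prod>k<n. measure (gauss N) (B k j))" (is "measure _ ?E = _") if B: "\<And>k j. B k j \<in> sets borel" for N m n B
  proof -
    note [measurable] = B
    have [measurable]: "dyadic_increment W N k j \<in> borel_measurable M" for k j
      unfolding dyadic_increment_def by (intro borel_measurable_diff measurable_W) auto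
    have E: "?E \<in> events" by measurable
    have "A \<inter> ?E = {\<omega>\<in>A. \<forall>j<m. \<forall>k<n. dyadic_increment W N k j \<omega> \<in> B k j}"
      using sets.sets_into_space[OF AM] by auto
    then show ?thesis
      using dyadic_increments_indep[OF A(1), where B=B and m=m and n=n and N=N] B A(2) p E by simp
  qed
  then show ?thesis
    unfolding gaussian_grid_def using prob_space_uniform_measure[OF p] measurable_W start_zero by auto
qed

end

text \<open>
  The values at the times \<open>j / 2 ^ N\<close>, indexed by motion, level and position. Times occur repeatedly
  in this indexing, which does no harm.
\<close>
definition dyadic_values :: "(nat \<Rightarrow> real \<Rightarrow> real) \<Rightarrow> nat \<times> nat \<times> nat \<Rightarrow> real" where
  "dyadic_values x = (\<lambda>(k, N, j). x k (real j / 2 ^ N))"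

lemma distr_dyadic_increments:
  assumes "gaussian_grid P X"
  shows "distr P (PiM UNIV (\<lambda>_. borel)) (\<lambda>\<omega>. \<lambda>(k, j). dyadic_increment X N k j \<omega>) = PiM UNIV (\<lambda>_. gauss N)"
    and "(\<lambda>\<omega>. \<lambda>(k, j). dyadic_increment X N k j \<omega>) \<in> P \<rightarrow>\<^sub>M PiM UNIV (\<lambda>_. borel)"
proof -
  interpret prob_space P using assms by (simp add: gaussian_grid_def)
  interpret gaussN: prob_space "gauss N" by (rule prob_space_gauss)
  interpret G: product_prob_space "\<lambda>_. gauss N" UNIV ..
  have X[measurable]: "dyadic_increment X N k j \<in> borel_measurable P" for k j
    using assms unfolding dyadic_increment_def gaussian_grid_def by (intro borel_measurable_diff) auto
  let ?Y = "\<lambda>\<omega>. \<lambda>(k, j). dyadic_increment X N k j \<omega>"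
  show Y: "?Y \<in> P \<rightarrow>\<^sub>M PiM UNIV (\<lambda>_. borel)"
    using X by (intro measurable_PiM_single') (auto simp: split_beta)
  show "distr P (PiM UNIV (\<lambda>_. borel)) ?Y = PiM UNIV (\<lambda>_. gauss N)"
  proof (rule G.PiM_eq)
    show "sets (distr P (PiM UNIV (\<lambda>_. borel)) ?Y) = sets (PiM UNIV (\<lambda>_. gauss N))"
      by (simp cong: sets_PiM_cong)
    fix J :: "(nat \<times> nat) set" and C assume J: "finite J" and C: "\<And>j. j \<in> J \<Longrightarrow> C j \<in> sets (gauss N)"
    obtain n where n: "\<And>x. x \<in> J \<Longrightarrow> fst x < n" using finite_nat_bounded[of "fst ` J"] J by auto
    obtain m where m: "\<And>x. x \<in> J \<Longrightarrow> snd x < m" using finite_nat_bounded[of "snd ` J"] J by auto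
    \<comment> \<open>The box over J is a box over a full rectangle of indices, with no constraint outside J.\<close>
    define B where "B k j = (if (k, j) \<in> J then C (k, j) else UNIV)" for k j
    have B: "\<forall>k j. B k j \<in> sets borel" using C by (auto simp: B_def)
    have emb: "prod_emb UNIV (\<lambda>_. gauss N) J (Pi\<^sub>E J C) = {y. \<forall>x\<in>J. y x \<in> C x}"
      by (auto simp: prod_emb_def PiE_def Pi_def)
    have "{y. \<forall>x\<in>J. y x \<in> C x} \<in> sets (PiM UNIV (\<lambda>_. gauss N))"
      unfolding emb[symmetric] using J C by (intro sets_PiM_I) auto
    then have mS: "{y. \<forall>x\<in>J. y x \<in> C x} \<in> sets (PiM UNIV (\<lambda>_. borel))"
      by (simp cong: sets_PiM_cong)
    have "measure (distr P (PiM UNIV (\<lambda>_. borel)) ?Y) {y. \<forall>x\<in>J. y x \<in> C x} =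
        prob {\<omega>\<in>space P. \<forall>j<m. \<forall>k<n. dyadic_increment X N k j \<omega> \<in> B k j}"
    proof -
      have "(\<forall>x\<in>J. ?Y \<omega> x \<in> C x) \<longleftrightarrow> (\<forall>j<m. \<forall>k<n. dyadic_increment X N k j \<omega> \<in> B k j)" for \<omega>
        using n m by (force simp: B_def)
      then show ?thesis
        unfolding measure_distr[OF Y mS] by (simp add: vimage_def Int_def conj_commute)
    qed
    also have "\<dots> = (\<Prod>j<m. \<Prod>k<n. measure (gauss N) (B k j))"
      using assms B unfolding gaussian_grid_def by blast
    also have "\<dots> = (\<Prod>x\<in>{..<n} \<times> {..<m}. measure (gauss N) (B (fst x) (snd x)))"
      by (subst prod.swap) (simp add: prod.cartesian_product split_beta)
    also have "\<dots> = (\<Prod>x\<in>J. measure (gauss N) (C x))"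
      using n m J prob_space.prob_space[OF prob_space_gauss, of N] by (intro prod.mono_neutral_cong_right) (auto simp: B_def)
    finally have eq: "measure (distr P (PiM UNIV (\<lambda>_. borel)) ?Y) {y. \<forall>x\<in>J. y x \<in> C x} = (\<Prod>x\<in>J. measure (gauss N) (C x))" .
    interpret D: prob_space "distr P (PiM UNIV (\<lambda>_. borel)) ?Y"
      by (rule prob_space_distr[OF Y])
    from eq show "emeasure (distr P (PiM UNIV (\<lambda>_. borel)) ?Y) (prod_emb UNIV (\<lambda>_. gauss N) J (Pi\<^sub>E J C)) =
        (\<Prod>j\<in>J. emeasure (gauss N) (C j))"
      unfolding emb by (simp add: D.emeasure_eq_measure gaussN.emeasure_eq_measure prod_ennreal)
  qed
qed

lemma measurable_dyadic_values:
  assumes "gaussian_grid P X"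
  shows "(\<lambda>\<omega>. dyadic_values (\<lambda>k t. X k t \<omega>)) \<in> P \<rightarrow>\<^sub>M PiM UNIV (\<lambda>_. borel)"
  using assms unfolding gaussian_grid_def dyadic_values_def
  by (intro measurable_PiM_single') (auto simp: split_beta)

text \<open>
  Finitely many dyadic values are sums of increments of one common level, whose joint law is a product
  measure.
\<close>
lemma law_dyadic_values_unique:
  assumes X: "gaussian_grid P X" and X': "gaussian_grid P' X'"
  shows "distr P (PiM UNIV (\<lambda>_. borel)) (\<lambda>\<omega>. dyadic_values (\<lambda>k t. X k t \<omega>)) =
    distr P' (PiM UNIV (\<lambda>_. borel)) (\<lambda>\<omega>. dyadic_values (\<lambda>k t. X' k t \<omega>))"
proof (rule measure_eqI_PiM_infinite[where I=UNIV and M="\<lambda>_. borel"])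
  fix J :: "(nat \<times> nat \<times> nat) set" and C :: "nat \<times> nat \<times> nat \<Rightarrow> real set"
  assume J: "finite J" and C: "\<And>j. j \<in> J \<Longrightarrow> C j \<in> sets borel"
  obtain N where N: "\<And>x. x \<in> J \<Longrightarrow> fst (snd x) < N"
    using finite_nat_bounded[of "(fst \<circ> snd) ` J"] J by auto
  have emb: "prod_emb UNIV (\<lambda>_. borel) J (Pi\<^sub>E J C) = {y. \<forall>x\<in>J. y x \<in> C x}"
    by (auto simp: prod_emb_def PiE_def Pi_def)
  have mS: "{y. \<forall>x\<in>J. y x \<in> C x} \<in> sets (PiM UNIV (\<lambda>_. borel))"
    unfolding emb[symmetric] using J C by (intro sets_PiM_I) auto
  define S where "S = {y :: nat \<times> nat \<Rightarrow> real. \<forall>x\<in>J. (\<Sum>i<snd (snd x) * 2 ^ (N - fst (snd x)). y (fst x, i)) \<in> C x}"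
  have S: "S \<in> sets (PiM UNIV (\<lambda>_. borel))"
  proof -
    have "{y \<in> space (PiM UNIV (\<lambda>_. borel)). (\<Sum>i<snd (snd x) * 2 ^ (N - fst (snd x)). y (fst x, i)) \<in> C x}
        \<in> sets (PiM UNIV (\<lambda>_::nat \<times> nat. borel))" if "x \<in> J" for x
    proof -
      have [measurable]: "C x \<in> sets borel" using C that by simp
      show ?thesis by measurable
    qed
    then have "{y \<in> space (PiM UNIV (\<lambda>_::nat \<times> nat. borel)). \<forall>x\<in>J. (\<Sum>i<snd (snd x) * 2 ^ (N - fst (snd x)). y (fst x, i)) \<in> C x}
        \<in> sets (PiM UNIV (\<lambda>_. borel))"
      by (rule sets.sets_Collect_finite_All[OF _ J])
    then show ?thesis by (simp add: S_def space_PiM)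
  qed
  have "emeasure (distr Q (PiM UNIV (\<lambda>_. borel)) (\<lambda>\<omega>. dyadic_values (\<lambda>k t. Z k t \<omega>))) {y. \<forall>x\<in>J. y x \<in> C x} =
      emeasure (PiM UNIV (\<lambda>_. gauss N)) S" if Z: "gaussian_grid Q Z" for Q :: "'x measure" and Z
  proof -
    have tele: "Z k (real j / 2 ^ l) \<omega> = (\<Sum>i<j * 2 ^ (N - l). dyadic_increment Z N k i \<omega>)"
      if "l < N" "\<omega> \<in> space Q" for k j l \<omega>
    proof -
      have "(\<Sum>i<j * 2 ^ (N - l). dyadic_increment Z N k i \<omega>) = Z k (real (j * 2 ^ (N - l)) / 2 ^ N) \<omega> - Z k (0 / 2 ^ N) \<omega>"
        unfolding dyadic_increment_def
        using sum_lessThan_telescope[of "\<lambda>i. Z k (real i / 2 ^ N) \<omega>"] by simp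
      moreover have "Z k 0 \<omega> = 0" using Z that by (auto simp: gaussian_grid_def)
      moreover have "real (j * 2 ^ (N - l)) / 2 ^ N = real j / 2 ^ l"
      proof -
        have "(2::real) ^ N = 2 ^ l * 2 ^ (N - l)" using that by (simp flip: power_add)
        then show ?thesis by simp
      qed
      ultimately show ?thesis by simp
    qed
    have "emeasure (distr Q (PiM UNIV (\<lambda>_. borel)) (\<lambda>\<omega>. dyadic_values (\<lambda>k t. Z k t \<omega>))) {y. \<forall>x\<in>J. y x \<in> C x} =
      emeasure Q {\<omega>\<in>space Q. \<forall>x\<in>J. dyadic_values (\<lambda>k t. Z k t \<omega>) x \<in> C x}"
      unfolding emeasure_distr[OF measurable_dyadic_values[OF Z] mS]
      by (simp add: vimage_def Int_def conj_commute)
    also have "{\<omega>\<in>space Q. \<forall>x\<in>J. dyadic_values (\<lambda>k t. Z k t \<omega>) x \<in> C x} =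
      (\<lambda>\<omega>. \<lambda>(k, j). dyadic_increment Z N k j \<omega>) -` S \<inter> space Q"
      using N tele by (auto simp: S_def dyadic_values_def split_beta)
    also have "emeasure Q \<dots> = emeasure (PiM UNIV (\<lambda>_. gauss N)) S"
      unfolding distr_dyadic_increments(1)[OF Z, symmetric]
      by (rule emeasure_distr[OF distr_dyadic_increments(2)[OF Z] S, symmetric])
    finally show ?thesis .
  qed
  note * = this
  show "emeasure (distr P (PiM UNIV (\<lambda>_. borel)) (\<lambda>\<omega>. dyadic_values (\<lambda>k t. X k t \<omega>))) (prod_emb UNIV (\<lambda>_. borel) J (Pi\<^sub>E J C)) =
      emeasure (distr P' (PiM UNIV (\<lambda>_. borel)) (\<lambda>\<omega>. dyadic_values (\<lambda>k t. X' k t \<omega>))) (prod_emb UNIV (\<lambda>_. borel) J (Pi\<^sub>E J C))"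
    unfolding emb using *[OF X] *[OF X'] by simp
next
  show "finite_measure (distr P (PiM UNIV (\<lambda>_. borel)) (\<lambda>\<omega>. dyadic_values (\<lambda>k t. X k t \<omega>)))"
    using X measurable_dyadic_values[OF X]
    by (auto simp: gaussian_grid_def intro!: prob_space.finite_measure prob_space.prob_space_distr)
qed auto

section \<open>The law of the cylindrical process\<close>

text \<open>
  Events of the cylindrical process are events of the dyadic values.
\<close>
lemma path_sum_preimage:
  fixes J :: "'u \<Rightarrow> 'k::{banach, second_countable_topology}"
  assumes B: "B \<in> sets wiener_borel"
  shows "\<exists>S\<in>sets (PiM UNIV (\<lambda>_. borel)). \<forall>x\<in>start_zero_paths. path_sum J e x \<in> B \<longleftrightarrow> dyadic_values x \<in> S"
proof -
  define N where "N = vimage_algebra start_zero_paths dyadic_values (PiM UNIV (\<lambda>_. borel))"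
  have D: "dyadic_values \<in> start_zero_paths \<rightarrow> space (PiM UNIV (\<lambda>_. borel))"
    by (simp add: space_PiM)
  have DN: "dyadic_values \<in> N \<rightarrow>\<^sub>M PiM UNIV (\<lambda>_. borel)"
    unfolding N_def by (rule measurable_vimage_algebra1[OF D])
  have "(\<lambda>x. x k (real j / 2 ^ l)) \<in> borel_measurable N" for k l j
    using measurable_compose[OF DN measurable_component_singleton[of "(k, l, j)"]]
    by (simp add: dyadic_values_def)
  then have "path_sum J e \<in> N \<rightarrow>\<^sub>M wiener_borel"
    by (intro measurable_path_sum) (simp add: N_def)
  from measurable_sets[OF this B]
  have "path_sum J e -` B \<inter> start_zero_paths \<in> {dyadic_values -` S \<inter> start_zero_paths |S. S \<in> sets (PiM UNIV (\<lambda>_. borel))}"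
    unfolding N_def sets_vimage_algebra2[OF D] by simp
  then obtain S where S: "S \<in> sets (PiM UNIV (\<lambda>_. borel))"
    and eq: "path_sum J e -` B \<inter> start_zero_paths = dyadic_values -` S \<inter> start_zero_paths" by auto
  have "path_sum J e x \<in> B \<longleftrightarrow> dyadic_values x \<in> S" if "x \<in> start_zero_paths" for x
    using eq that by (metis Int_iff vimage_eq)
  then show ?thesis using S by (intro bexI[of _ S]) simp_all
qed

lemma
  fixes J :: "'u \<Rightarrow> 'k::{banach, second_countable_topology}"
  assumes X: "gaussian_grid P X" and paths: "\<And>\<omega>. \<omega> \<in> space P \<Longrightarrow> (\<lambda>k t. X k t \<omega>) \<in> start_zero_paths"
  shows measurable_cyl_wiener: "cyl_wiener J e X \<in> P \<rightarrow>\<^sub>M wiener_borel"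
    and law_cyl_wiener_unique: "gaussian_grid P' X' \<Longrightarrow> (\<And>\<omega>. \<omega> \<in> space P' \<Longrightarrow> (\<lambda>k t. X' k t \<omega>) \<in> start_zero_paths) \<Longrightarrow>
      distr P wiener_borel (cyl_wiener J e X) = distr P' wiener_borel (cyl_wiener J e X')"
proof -
  let ?D = "\<lambda>Z \<omega>. dyadic_values (\<lambda>k t. Z k t \<omega>)"
  have pre: "cyl_wiener J e Z -` B \<inter> space Q = ?D Z -` S \<inter> space Q"
    if "\<And>\<omega>. \<omega> \<in> space Q \<Longrightarrow> (\<lambda>k t. Z k t \<omega>) \<in> start_zero_paths"
      "\<forall>x\<in>start_zero_paths. path_sum J e x \<in> B \<longleftrightarrow> dyadic_values x \<in> S" for Q :: "'x measure" and Z B S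
    using that by (auto simp: cyl_wiener_path_sum)
  have meas: "cyl_wiener J e Z \<in> Q \<rightarrow>\<^sub>M wiener_borel"
    if Z: "gaussian_grid Q Z" and p: "\<And>\<omega>. \<omega> \<in> space Q \<Longrightarrow> (\<lambda>k t. Z k t \<omega>) \<in> start_zero_paths" for Q :: "'x measure" and Z
  proof (rule measurableI)
    show "cyl_wiener J e Z \<omega> \<in> space wiener_borel" if "\<omega> \<in> space Q" for \<omega>
      using path_sum_in_wiener_space[OF p[OF that]] by (simp add: cyl_wiener_path_sum)
    fix B :: "(real \<Rightarrow> 'k) set" assume B: "B \<in> sets wiener_borel"
    then obtain S where S: "S \<in> sets (PiM UNIV (\<lambda>_. borel))"
      "\<forall>x\<in>start_zero_paths. path_sum J e x \<in> B \<longleftrightarrow> dyadic_values x \<in> S" using path_sum_preimage[OF B, of J e] by (elim bexE)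
    show "cyl_wiener J e Z -` B \<inter> space Q \<in> sets Q"
      using measurable_sets[OF measurable_dyadic_values[OF Z] S(1)] pre[of Q Z, OF p S(2)] by simp
  qed
  show "cyl_wiener J e X \<in> P \<rightarrow>\<^sub>M wiener_borel" by (rule meas[OF X paths])
  assume X': "gaussian_grid P' X'" and paths': "\<And>\<omega>. \<omega> \<in> space P' \<Longrightarrow> (\<lambda>k t. X' k t \<omega>) \<in> start_zero_paths"
  show "distr P wiener_borel (cyl_wiener J e X) = distr P' wiener_borel (cyl_wiener J e X')"
  proof (rule measure_eqI)
    fix B assume "B \<in> sets (distr P wiener_borel (cyl_wiener J e X))"
    then have B: "B \<in> sets wiener_borel" by simp
    then obtain S where S: "S \<in> sets (PiM UNIV (\<lambda>_. borel))"
      "\<forall>x\<in>start_zero_paths. path_sum J e x \<in> B \<longleftrightarrow> dyadic_values x \<in> S" using path_sum_preimage[OF B, of J e] by (elim bexE)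
    have *: "emeasure (distr Q wiener_borel (cyl_wiener J e Z)) B = emeasure (distr Q (PiM UNIV (\<lambda>_. borel)) (?D Z)) S"
      if Z: "gaussian_grid Q Z" and p: "\<And>\<omega>. \<omega> \<in> space Q \<Longrightarrow> (\<lambda>k t. Z k t \<omega>) \<in> start_zero_paths" for Q :: "'x measure" and Z
      using emeasure_distr[OF meas[OF Z p] B] emeasure_distr[OF measurable_dyadic_values[OF Z] S(1)]
        pre[of Q Z, OF p S(2)] by simp
    show "emeasure (distr P wiener_borel (cyl_wiener J e X)) B = emeasure (distr P' wiener_borel (cyl_wiener J e X')) B"
      using *[of P X, OF X paths] *[of P' X', OF X' paths'] law_dyadic_values_unique[OF X X'] by simp
  qed simp
qed

context wiener_basis
begin

lemma W_paths: "\<omega> \<in> space M \<Longrightarrow> (\<lambda>k t. W k t \<omega>) \<in> start_zero_paths"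
  using start_zero continuous by (simp add: start_zero_paths_def)

lemma measurable_cyl_wiener_W:
  fixes J :: "'u \<Rightarrow> 'k::{banach, second_countable_topology}"
  shows "cyl_wiener J e W \<in> M \<rightarrow>\<^sub>M wiener_borel"
  by (rule measurable_cyl_wiener[OF gaussian_grid_W W_paths])

text \<open>
  The law of the cylindrical process does not change under conditioning on an event at time zero.
\<close>
lemma initial_indep_cyl_wiener:
  fixes J :: "'u \<Rightarrow> 'k::{banach, second_countable_topology}"
  assumes A: "A \<in> sets (F 0)" and B: "B \<in> sets wiener_borel"
  shows "prob (A \<inter> (cyl_wiener J e W -` B \<inter> space M)) = prob A * prob (cyl_wiener J e W -` B \<inter> space M)"
proof (cases "prob A = 0")
  case True
  have AM: "A \<in> events" using A sets_F[of 0] by auto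
  have "prob (A \<inter> (cyl_wiener J e W -` B \<inter> space M)) \<le> prob A"
    using AM by (intro finite_measure_mono) auto
  then show ?thesis using True measure_nonneg[of M "A \<inter> (cyl_wiener J e W -` B \<inter> space M)"] by simp
next
  case False
  then have pA: "prob A > 0" by (simp add: zero_less_measure_iff)
  have AM: "A \<in> events" using A sets_F[of 0] by auto
  let ?Q = "uniform_measure M A"
  have Q: "gaussian_grid ?Q W" by (rule gaussian_grid_conditioned[OF A pA])
  have pQ: "\<And>\<omega>. \<omega> \<in> space ?Q \<Longrightarrow> (\<lambda>k t. W k t \<omega>) \<in> start_zero_paths"
    using W_paths by simp
  have "measure (distr ?Q wiener_borel (cyl_wiener J e W)) B = measure (distr M wiener_borel (cyl_wiener J e W)) B"
    using law_cyl_wiener_unique[OF Q pQ gaussian_grid_W W_paths, of J e] by simp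
  then have "measure ?Q (cyl_wiener J e W -` B \<inter> space M) = prob (cyl_wiener J e W -` B \<inter> space M)"
    using measurable_cyl_wiener[OF Q pQ, of J e] measurable_cyl_wiener_W[of J e] B by (simp add: measure_distr)
  moreover have "measure ?Q (cyl_wiener J e W -` B \<inter> space M) =
      prob (A \<inter> (cyl_wiener J e W -` B \<inter> space M)) / prob A"
    using pA measurable_sets[OF measurable_cyl_wiener_W[of J e] B] AM
    by (intro measure_uniform_measure) (auto simp: emeasure_eq_measure)
  ultimately show ?thesis using pA by (simp add: field_simps)
qed

lemma law_initial_cyl_wiener:
  fixes J :: "'u \<Rightarrow> 'k::{banach, second_countable_topology}" and \<xi> :: "'w \<Rightarrow> 'h::topological_space"
  assumes \<xi>: "\<xi> \<in> borel_measurable (F 0)"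
  shows "distr M (borel \<Otimes>\<^sub>M wiener_borel) (\<lambda>\<omega>. (\<xi> \<omega>, cyl_wiener J e W \<omega>)) =
    distr M borel \<xi> \<Otimes>\<^sub>M distr M wiener_borel (cyl_wiener J e W)"
proof (rule pair_measure_eqI[symmetric])
  have \<xi>M[measurable]: "\<xi> \<in> borel_measurable M" using measurable_F_M[OF \<xi>] by simp
  note [measurable] = measurable_cyl_wiener_W[of J e]
  interpret A: prob_space "distr M borel \<xi>" by (rule prob_space_distr) measurable
  interpret B: prob_space "distr M wiener_borel (cyl_wiener J e W)" by (rule prob_space_distr) measurable
  show "sigma_finite_measure (distr M borel \<xi>)" "sigma_finite_measure (distr M wiener_borel (cyl_wiener J e W))"
    by unfold_locales
  show "sets (distr M borel \<xi> \<Otimes>\<^sub>M distr M wiener_borel (cyl_wiener J e W)) =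
      sets (distr M (borel \<Otimes>\<^sub>M wiener_borel) (\<lambda>\<omega>. (\<xi> \<omega>, cyl_wiener J e W \<omega>)))"
    by (simp cong: sets_pair_measure_cong)
  fix A B assume "A \<in> sets (distr M borel \<xi>)" "B \<in> sets (distr M wiener_borel (cyl_wiener J e W))"
  then have AB: "A \<in> sets borel" "B \<in> sets wiener_borel" by auto
  have "\<xi> -` A \<inter> space M \<in> sets (F 0)"
    using measurable_sets[OF \<xi> AB(1)] space_F[of 0] by simp
  from initial_indep_cyl_wiener[OF this AB(2), of J e]
  have "emeasure M ((\<xi> -` A \<inter> space M) \<inter> (cyl_wiener J e W -` B \<inter> space M)) =
    emeasure M (\<xi> -` A \<inter> space M) * emeasure M (cyl_wiener J e W -` B \<inter> space M)"
    by (simp add: emeasure_eq_measure ennreal_mult)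
  moreover have "(\<lambda>\<omega>. (\<xi> \<omega>, cyl_wiener J e W \<omega>)) -` (A \<times> B) \<inter> space M =
      (\<xi> -` A \<inter> space M) \<inter> (cyl_wiener J e W -` B \<inter> space M)" by auto
  ultimately show "emeasure (distr M borel \<xi>) A * emeasure (distr M wiener_borel (cyl_wiener J e W)) B =
      emeasure (distr M (borel \<Otimes>\<^sub>M wiener_borel) (\<lambda>\<omega>. (\<xi> \<omega>, cyl_wiener J e W \<omega>))) (A \<times> B)"
    using AB by (simp add: emeasure_distr)
qed

end

section \<open>Transport of a stochastic basis to the canonical sample space\<close>

text \<open>
  The largest sigma-algebra on the image of \<open>T\<close> that makes \<open>T\<close> measurable. With this choice the image of
  a complete measure is complete, and the images of a right-continuous filtration form a
  right-continuous filtration.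
\<close>
definition final_algebra :: "('a \<Rightarrow> 'b) \<Rightarrow> 'a measure \<Rightarrow> 'b measure" where
  "final_algebra T N = sigma (T ` space N) {B. B \<subseteq> T ` space N \<and> T -` B \<inter> space N \<in> sets N}"

lemma
  shows space_final_algebra: "space (final_algebra T N) = T ` space N"
    and sets_final_algebra: "sets (final_algebra T N) = {B. B \<subseteq> T ` space N \<and> T -` B \<inter> space N \<in> sets N}"
proof -
  let ?A = "{B. B \<subseteq> T ` space N \<and> T -` B \<inter> space N \<in> sets N}"
  have "sigma_algebra (T ` space N) ?A"
    unfolding sigma_algebra_iff2
  proof (intro conjI allI ballI impI)
    fix B assume B: "B \<in> ?A"
    have "T -` (T ` space N - B) \<inter> space N = space N - (T -` B \<inter> space N)" by auto
    then show "T ` space N - B \<in> ?A" using B by auto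
  next
    fix A :: "nat \<Rightarrow> _" assume A: "range A \<subseteq> ?A"
    have Ai: "A i \<in> ?A" for i using A by blast
    then have "(\<Union>i. T -` A i \<inter> space N) \<in> sets N" by (intro sets.countable_nat_UN) auto
    moreover have "T -` (\<Union>i. A i) \<inter> space N = (\<Union>i. T -` A i \<inter> space N)" by auto
    moreover have "(\<Union>i. A i) \<subseteq> T ` space N" using Ai by blast
    ultimately show "(\<Union>i. A i) \<in> ?A" by simp
  qed auto
  then show "sets (final_algebra T N) = ?A" "space (final_algebra T N) = T ` space N"
    unfolding final_algebra_def
    by (auto simp: sigma_algebra.sets_measure_of_eq sigma_algebra.space_measure_of_eq)
qed

lemma measurable_final_algebra: "T \<in> N \<rightarrow>\<^sub>M final_algebra T N"
  by (rule measurableI) (auto simp: space_final_algebra sets_final_algebra)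

lemma measurable_from_final_algebra:
  assumes "(\<lambda>x. f (T x)) \<in> N \<rightarrow>\<^sub>M K"
  shows "f \<in> final_algebra T N \<rightarrow>\<^sub>M K"
proof (rule measurableI)
  show "f y \<in> space K" if "y \<in> space (final_algebra T N)" for y
    using that measurable_space[OF assms] by (auto simp: space_final_algebra)
  fix A assume "A \<in> sets K"
  from measurable_sets[OF assms this]
  have "(\<lambda>x. f (T x)) -` A \<inter> space N \<in> sets N" .
  moreover have "T -` (f -` A \<inter> T ` space N) \<inter> space N = (\<lambda>x. f (T x)) -` A \<inter> space N" by auto
  ultimately show "f -` A \<inter> space (final_algebra T N) \<in> sets (final_algebra T N)"
    by (simp add: space_final_algebra sets_final_algebra)
qed

context wiener_basis
begin

text \<open>
  The coordinate process is a Wiener process on the image basis. Hence every basis with a Wiener process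
  yields one on the sample type used in the definition of the Wiener law.
\<close>
lemma canonical_wiener_basis:
  defines "T \<equiv> \<lambda>\<omega> k t. W k t \<omega>"
  shows "wiener_basis (distr M (final_algebra T M) T) (\<lambda>t. final_algebra T (F t)) (\<lambda>k t x. x k t)"
proof -
  define M' where "M' = distr M (final_algebra T M) T"
  define F' where "F' t = final_algebra T (F t)" for t
  have T[measurable]: "T \<in> M \<rightarrow>\<^sub>M final_algebra T M" by (rule measurable_final_algebra)
  have spM': "space M' = T ` space M" and stM': "sets M' = {B. B \<subseteq> T ` space M \<and> T -` B \<inter> space M \<in> events}"
    by (simp_all add: M'_def space_final_algebra sets_final_algebra)
  have spF': "space (F' t) = T ` space M" and stF': "sets (F' t) = {B. B \<subseteq> T ` space M \<and> T -` B \<inter> space M \<in> sets (F t)}"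
    if "0 \<le> t" for t
    using that by (simp_all add: F'_def space_final_algebra sets_final_algebra space_F)
  have em: "emeasure M' B = emeasure M (T -` B \<inter> space M)" and mm: "measure M' B = measure M (T -` B \<inter> space M)"
    if "B \<in> sets M'" for B
    using that by (simp_all add: M'_def emeasure_distr measure_distr)
  have P': "prob_space M'" unfolding M'_def by (rule prob_space_distr[OF T])
  interpret P': prob_space M' by (rule P')
  have complete: "\<And>A B. B \<subseteq> A \<Longrightarrow> A \<in> null_sets M \<Longrightarrow> B \<in> sets M"
    using basis[unfolded stochastic_basis_def, THEN conjunct2, THEN conjunct1]
    by (rule complete_measure.complete)
  have right: "sets (F t) = (\<Inter>u\<in>{t<..}. sets (F u))" if "0 \<le> t" for t
    using basis[unfolded stochastic_basis_def, THEN conjunct2, THEN conjunct2, THEN conjunct2, THEN conjunct2, THEN conjunct1] that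
    by blast
  have null: "null_sets M \<subseteq> sets (F 0)"
    using basis[unfolded stochastic_basis_def, THEN conjunct2, THEN conjunct2, THEN conjunct2, THEN conjunct2, THEN conjunct2] .
  have nullT: "T -` A \<inter> space M \<in> null_sets M" if "A \<in> null_sets M'" for A
    using that em[OF null_setsD2[OF that]] null_setsD2[OF that] null_setsD1[OF that] unfolding stM'
    by (intro null_setsI) simp_all
  have "stochastic_basis M' F'"
    unfolding stochastic_basis_def
  proof (intro conjI allI impI)
    show "complete_measure M'"
    proof
      fix A B assume "B \<subseteq> A" "A \<in> null_sets M'"
      then have "T -` B \<inter> space M \<subseteq> T -` A \<inter> space M" "A \<subseteq> T ` space M" by (auto simp: null_sets_def stM')
      then show "B \<in> sets M'" using complete nullT[OF \<open>A \<in> null_sets M'\<close>] \<open>B \<subseteq> A\<close> unfolding stM' by blast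
    qed
    show "space (F' t) = space M'" if "0 \<le> t" for t using that by (simp add: spF' spM')
    show "sets (F' t) \<subseteq> sets M'" if "0 \<le> t" for t using sets_F[OF that] by (auto simp: stF'[OF that] stM')
    show "sets (F' s) \<subseteq> sets (F' t)" if "0 \<le> s" "s \<le> t" for s t
      using mono_F[OF that] that by (auto simp: stF')
    show "sets (F' t) = (\<Inter>u\<in>{t<..}. sets (F' u))" if "0 \<le> t" for t
    proof -
      have "B \<in> sets (F' t) \<longleftrightarrow> (\<forall>u\<in>{t<..}. B \<in> sets (F' u))" for B
      proof -
        have "B \<in> sets (F' t) \<longleftrightarrow> B \<subseteq> T ` space M \<and> (\<forall>u\<in>{t<..}. T -` B \<inter> space M \<in> sets (F u))"
          unfolding stF'[OF that] by (subst right[OF that]) simp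
        also have "\<dots> \<longleftrightarrow> (\<forall>u\<in>{t<..}. B \<subseteq> T ` space M \<and> T -` B \<inter> space M \<in> sets (F u))"
          using greaterThan_non_empty[of t] by blast
        also have "\<dots> \<longleftrightarrow> (\<forall>u\<in>{t<..}. B \<in> sets (F' u))"
          using that by (intro ball_cong refl) (simp add: stF')
        finally show ?thesis .
      qed
      then show ?thesis by blast
    qed
    show "null_sets M' \<subseteq> sets (F' 0)"
    proof
      fix A assume "A \<in> null_sets M'"
      with nullT[OF this] null show "A \<in> sets (F' 0)" by (auto simp: stF' null_sets_def stM')
    qed
  qed (rule P')
  moreover have "wiener_process M' F' (\<lambda>k t x. x k t)"
    unfolding wiener_process_def
  proof (intro conjI allI)
    fix k
    show "brownian_motion M' F' (\<lambda>t x. x k t)"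
      unfolding brownian_motion_def
    proof (intro conjI allI impI ballI)
      show "(\<lambda>x. x k t) \<in> borel_measurable (F' t)" if "0 \<le> t" for t
        unfolding F'_def by (rule measurable_from_final_algebra) (simp add: T_def adapted[OF that])
      show "x k 0 = 0" if "x \<in> space M'" for x
        using that start_zero by (auto simp: spM' T_def)
      show "continuous_on {0..} (\<lambda>t. x k t)" if "x \<in> space M'" for x
        using that continuous by (auto simp: spM' T_def)
      fix s t :: real assume st: "0 \<le> s" "s < t"
      have D: "(\<lambda>x. x k t - x k s) \<in> borel_measurable (final_algebra T M)"
        using st by (intro measurable_from_final_algebra) (auto simp: T_def intro!: borel_measurable_diff measurable_W)
      then have D': "(\<lambda>x. x k t - x k s) \<in> borel_measurable M'" by (simp add: M'_def)
      have "distr M' lborel (\<lambda>x. x k t - x k s) = distr M lborel (\<lambda>\<omega>. W k t \<omega> - W k s \<omega>)"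
        unfolding M'_def using D by (subst distr_distr[OF _ T]) (simp_all add: comp_def T_def)
      then show "distributed M' lborel (\<lambda>x. x k t - x k s) (normal_density 0 (sqrt (t - s)))"
        using increment_distributed[OF st, of k] D' by (simp add: distributed_def)
      have ind: "indep_set (sets (F s)) {(\<lambda>\<omega>. W k t \<omega> - W k s \<omega>) -` A \<inter> space M |A. A \<in> sets borel}"
        using brownian[of k] st unfolding brownian_motion_def by blast
      show "P'.indep_set (sets (F' s)) {(\<lambda>x. x k t - x k s) -` A \<inter> space M' |A. A \<in> sets borel}"
        unfolding P'.indep_sets2_eq
      proof (intro conjI ballI)
        show sub: "sets (F' s) \<subseteq> sets M'" using sets_F[OF st(1)] by (auto simp: stF'[OF st(1)] stM')
        show sub2: "{(\<lambda>x. x k t - x k s) -` A \<inter> space M' |A. A \<in> sets borel} \<subseteq> sets M'"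
          using measurable_sets[OF D'] by blast
        fix a b assume a: "a \<in> sets (F' s)" and b: "b \<in> {(\<lambda>x. x k t - x k s) -` A \<inter> space M' |A. A \<in> sets borel}"
        then obtain A where A: "A \<in> sets borel" "b = (\<lambda>x. x k t - x k s) -` A \<inter> space M'" by blast
        have Tb: "T -` b \<inter> space M = (\<lambda>\<omega>. W k t \<omega> - W k s \<omega>) -` A \<inter> space M"
          unfolding A(2) by (auto simp: spM' T_def)
        have Ta: "T -` a \<inter> space M \<in> sets (F s)" using a by (simp add: stF'[OF st(1)])
        have aM: "a \<in> sets M'" and bM: "b \<in> sets M'" using a b sub sub2 by blast+
        have "prob ((T -` a \<inter> space M) \<inter> (T -` b \<inter> space M)) = prob (T -` a \<inter> space M) * prob (T -` b \<inter> space M)"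
          using ind Ta A(1) unfolding indep_sets2_eq Tb by blast
        moreover have "(T -` a \<inter> space M) \<inter> (T -` b \<inter> space M) = T -` (a \<inter> b) \<inter> space M" by blast
        ultimately show "P'.prob (a \<inter> b) = P'.prob a * P'.prob b"
          using aM bM by (simp add: mm sets.Int)
      qed
    qed
  next
    let ?X = "\<lambda>k x. \<lambda>t\<in>{0..}. x k t" and ?N = "\<lambda>k::nat. PiM {0::real..} (\<lambda>t. borel :: real measure)"
    have X: "?X k \<in> final_algebra T M \<rightarrow>\<^sub>M ?N k" for k
      by (rule measurable_from_final_algebra, rule measurable_restrict) (simp add: T_def measurable_W)
    then have X': "?X k \<in> M' \<rightarrow>\<^sub>M ?N k" for k by (simp add: M'_def)
    have XW: "(\<lambda>\<omega>. \<lambda>t\<in>{0..}. W k t \<omega>) \<in> M \<rightarrow>\<^sub>M ?N k" for k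
      by (rule measurable_restrict) (simp add: measurable_W)
    have "indep_vars ?N (\<lambda>k \<omega>. \<lambda>t\<in>{0..}. W k t \<omega>) UNIV"
      using wiener by (simp add: wiener_process_def)
    then have "distr M (PiM UNIV ?N) (\<lambda>\<omega>. \<lambda>k\<in>UNIV. \<lambda>t\<in>{0..}. W k t \<omega>) =
        PiM UNIV (\<lambda>k. distr M (?N k) (\<lambda>\<omega>. \<lambda>t\<in>{0..}. W k t \<omega>))"
      using indep_vars_iff_distr_eq_PiM[where I=UNIV and M'="?N" and X="\<lambda>k \<omega>. \<lambda>t\<in>{0..}. W k t \<omega>"] XW by blast
    moreover have "distr M' (PiM UNIV ?N) (\<lambda>x. \<lambda>k\<in>UNIV. ?X k x) = distr M (PiM UNIV ?N) (\<lambda>\<omega>. \<lambda>k\<in>UNIV. \<lambda>t\<in>{0..}. W k t \<omega>)"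
      unfolding M'_def using measurable_restrict[of UNIV ?X, OF X] by (subst distr_distr[OF _ T]) (simp_all add: comp_def T_def)
    moreover have "distr M' (?N k) (?X k) = distr M (?N k) (\<lambda>\<omega>. \<lambda>t\<in>{0..}. W k t \<omega>)" for k
      unfolding M'_def using X[of k] by (subst distr_distr[OF _ T]) (simp_all add: comp_def T_def)
    ultimately show "P'.indep_vars ?N ?X UNIV"
      using P'.indep_vars_iff_distr_eq_PiM[where I=UNIV and M'="?N" and X="?X"] X' by simp
  qed
  ultimately have "wiener_basis M' F' (\<lambda>k t x. x k t)"
    using P' by (simp add: wiener_basis_def wiener_basis_axioms_def)
  then show ?thesis unfolding M'_def F'_def .
qed

text \<open>
  The definite description in \<open>wiener_law\<close> is meaningful as soon as some Wiener process exists, and it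
  then equals the law of the cylindrical process on every basis.
\<close>
lemma wiener_law_eq:
  fixes J :: "'u \<Rightarrow> 'k::{banach, second_countable_topology}"
  shows "wiener_law J e = distr M wiener_borel (cyl_wiener J e W)"
  unfolding wiener_law_def
proof (rule the_equality)
  let ?T = "\<lambda>\<omega> k t. W k t \<omega>"
  let ?M = "distr M (final_algebra ?T M) ?T" and ?F = "\<lambda>t. final_algebra ?T (F t)"
  interpret c: wiener_basis ?M ?F "\<lambda>k t x. x k t" by (rule canonical_wiener_basis)
  have eq: "distr M wiener_borel (cyl_wiener J e W) = distr ?M wiener_borel (cyl_wiener J e (\<lambda>k t x. x k t))"
    by (rule law_cyl_wiener_unique[OF gaussian_grid_W W_paths c.gaussian_grid_W c.W_paths])
  show "\<exists>(M' :: (nat \<Rightarrow> real \<Rightarrow> real) measure) F' W'. stochastic_basis M' F' \<and> wiener_process M' F' W' \<and>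
      distr M wiener_borel (cyl_wiener J e W) = distr M' wiener_borel (cyl_wiener J e W')"
    by (rule exI[of _ ?M], rule exI[of _ ?F], rule exI[of _ "\<lambda>k t x. x k t"]) (intro conjI c.basis c.wiener eq)
next
  fix P assume "\<exists>(M' :: (nat \<Rightarrow> real \<Rightarrow> real) measure) F' W'. stochastic_basis M' F' \<and> wiener_process M' F' W' \<and>
      P = distr M' wiener_borel (cyl_wiener J e W')"
  then obtain M' :: "(nat \<Rightarrow> real \<Rightarrow> real) measure" and F' W' where
    M': "stochastic_basis M' F'" "wiener_process M' F' W'" "P = distr M' wiener_borel (cyl_wiener J e W')" by blast
  interpret c: wiener_basis M' F' W'
    using M'(1)[unfolded stochastic_basis_def, THEN conjunct1] M'(1,2)
    by (simp add: wiener_basis_def wiener_basis_axioms_def)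
  show "P = distr M wiener_borel (cyl_wiener J e W)"
    unfolding M'(3) by (rule law_cyl_wiener_unique[OF c.gaussian_grid_W c.W_paths gaussian_grid_W W_paths])
qed

end

section \<open>Solutions as functionals of the initial value and the noise\<close>

lemma space_path_borel [simp]: "space (path_borel iV) = path_space iV"
  unfolding path_borel_def metric_borel_def by (intro space_measure_of) auto

text \<open>
  Only the supremum part of the metric is used; its integral part is nonnegative.
\<close>
lemma norm_lt_if_path_dist_lt:
  assumes x: "x \<in> path_space iV" "y \<in> path_space iV" and s: "0 \<le> s" "s \<le> real (Suc j)"
    and d: "path_dist iV x y < (1/2) ^ Suc j * min 1 \<epsilon>"
  shows "norm (y s - x s) < \<epsilon>"
proof -
  define S where "S k = (SUP t\<in>{0..real k}. norm (y t - x t))" for k :: nat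
  define c where "c k = enn2real (\<integral>\<^sup>+s\<in>{0..real k}. vnorm iV (y s - x s) \<partial>lborel)" for k :: nat
  define a where "a i = (1/2) ^ Suc i * min 1 (c (Suc i) + S (Suc i))" for i
  have S: "norm (y t - x t) \<le> S k" if "0 \<le> t" "t \<le> real k" for t k
  proof -
    have "continuous_on {0..real k} (\<lambda>t. norm (y t - x t))"
      using x unfolding path_space_def
      by (intro continuous_intros) (auto intro: continuous_on_subset)
    then have "compact ((\<lambda>t. norm (y t - x t)) ` {0..real k})"
      by (rule compact_continuous_image) simp
    then have "bdd_above ((\<lambda>t. norm (y t - x t)) ` {0..real k})"
      by (rule bounded_imp_bdd_above[OF compact_imp_bounded])
    then show ?thesis unfolding S_def using that by (intro cSUP_upper) auto
  qed
  have S0: "0 \<le> S k" for k using order_trans[OF norm_ge_zero S[of 0 k]] by simp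
  have c0: "0 \<le> c k" for k by (simp add: c_def)
  have a0: "0 \<le> a i" and a1: "a i \<le> (1/2) ^ Suc i" for i
    using S0[of "Suc i"] c0[of "Suc i"] unfolding a_def by (auto intro!: mult_left_le)
  have half: "(\<lambda>j. (1/2 :: real) ^ Suc j) sums 1" by (rule power_half_series)
  have sa: "summable a"
    using a0 a1 by (intro summable_comparison_test'[OF sums_summable[OF half], of 0]) auto
  have "path_dist iV x y = suminf a"
    unfolding path_dist_def a_def c_def S_def Let_def ..
  moreover have "a j \<le> suminf a"
    using sum_le_suminf[OF sa, of "{j}"] a0 by simp
  ultimately have "(1/2) ^ Suc j * min 1 (c (Suc j) + S (Suc j)) < (1/2) ^ Suc j * min 1 \<epsilon>"
    using d unfolding a_def by linarith
  then have "min 1 (c (Suc j) + S (Suc j)) < min 1 \<epsilon>"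
    by (rule mult_left_less_imp_less) simp
  then have "S (Suc j) < \<epsilon>" using c0[of "Suc j"] by linarith
  then show ?thesis using S[OF s] by linarith
qed

lemma measurable_path_eval:
  fixes iV :: "'v::real_normed_vector \<Rightarrow> 'h::real_normed_vector"
  assumes s: "0 \<le> s"
  shows "(\<lambda>x. x s) \<in> borel_measurable (path_borel iV)"
proof (rule borel_measurableI)
  fix G :: "'h set" assume G: "open G"
  let ?U = "(\<lambda>x. x s) -` G \<inter> path_space iV"
  have "\<exists>r>0. \<forall>y\<in>path_space iV. path_dist iV x y < r \<longrightarrow> y \<in> ?U" if x: "x \<in> ?U" for x
  proof -
    obtain \<epsilon> where e: "\<epsilon> > 0" "\<And>z. dist z (x s) < \<epsilon> \<Longrightarrow> z \<in> G"
      using G x unfolding open_dist by blast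
    obtain j where j: "s \<le> real (Suc j)" using real_arch_simple[of s] by (meson le_SucI of_nat_mono order_trans order_refl)
    show ?thesis
    proof (intro exI[of _ "(1/2) ^ Suc j * min 1 \<epsilon>"] conjI ballI impI)
      show "0 < (1/2) ^ Suc j * min 1 \<epsilon>" using e(1) by (intro mult_pos_pos) auto
      fix y assume y: "y \<in> path_space iV" "path_dist iV x y < (1/2) ^ Suc j * min 1 \<epsilon>"
      then have "norm (y s - x s) < \<epsilon>" using x by (intro norm_lt_if_path_dist_lt[OF _ y(1) s j y(2)]) auto
      then show "y \<in> ?U" using e(2) y(1) by (simp add: dist_norm)
    qed
  qed
  then have "?U \<in> sets (path_borel iV)"
    unfolding path_borel_def metric_borel_def
    by (subst sets_measure_of) (auto intro!: sigma_sets.Basic)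
  then show "(\<lambda>x. x s) -` G \<inter> space (path_borel iV) \<in> sets (path_borel iV)" by simp
qed

lemma weak_solutionD:
  assumes "weak_solution iV iE J e b \<sigma> M F X W"
  shows "stochastic_basis M F" "wiener_process M F W"
    "\<And>\<omega>. \<omega> \<in> space M \<Longrightarrow> X \<omega> \<in> path_space iV"
    "\<And>t. 0 \<le> t \<Longrightarrow> (\<lambda>\<omega>. X \<omega> t) \<in> borel_measurable (F t)"
  using assms unfolding weak_solution_def by blast+

lemma wiener_basisI:
  assumes "stochastic_basis M F" "wiener_process M F W"
  shows "wiener_basis M F W"
  using assms(1)[unfolded stochastic_basis_def, THEN conjunct1] assms
  by (simp add: wiener_basis_def wiener_basis_axioms_def)

context wiener_basis
begin

text \<open>
  A weak solution with initial law \<open>\<mu>\<close> equals the strong solution \<open>S \<xi> C\<close> with the same initial value and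
  noise. It suffices to compare the events \<open>{X t \<in> G}\<close> and \<open>{Z t \<in> G}\<close> for dyadic \<open>t\<close> and \<open>G\<close> in
  a countable basis. Up to a null set, the preimage of \<open>{x. x t \<in> G}\<close> under \<open>S\<close> is a measurable
  set \<open>B\<close> of initial values and noise paths, so \<open>Z t \<in> G\<close> iff \<open>(Z 0, C) \<in> B\<close> almost surely, and
  joint uniqueness in law transfers this equivalence to \<open>X\<close>.
\<close>
lemma weak_solution_eq_functional:
  fixes iV :: "'v::real_normed_vector \<Rightarrow> 'h::{real_inner, second_countable_topology}"
    and iE :: "'h \<Rightarrow> 'e::{banach, second_countable_topology}"
    and J :: "'u::real_inner \<Rightarrow> 'k::{real_inner, banach, second_countable_topology}"
  assumes S: "(\<lambda>(h, w). S h w) \<in> completion (\<mu> \<Otimes>\<^sub>M wiener_law J e) \<rightarrow>\<^sub>M path_borel iV"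
    and unique: "joint_uniqueness_given TYPE('w) iV iE J e b \<sigma> \<mu>"
    and X: "weak_solution iV iE J e b \<sigma> M F X W" and X\<mu>: "distr M borel (\<lambda>\<omega>. X \<omega> 0) = \<mu>"
    and \<xi>: "\<xi> \<in> borel_measurable (F 0)" "AE \<omega> in M. X \<omega> 0 = \<xi> \<omega>" and \<xi>\<mu>: "distr M borel \<xi> = \<mu>"
    and Z: "weak_solution iV iE J e b \<sigma> M F (\<lambda>\<omega>. S (\<xi> \<omega>) (cyl_wiener J e W \<omega>)) W"
    and Z0: "AE \<omega> in M. S (\<xi> \<omega>) (cyl_wiener J e W \<omega>) 0 = \<xi> \<omega>"
  shows "AE \<omega> in M. \<forall>t\<ge>0. X \<omega> t = S (\<xi> \<omega>) (cyl_wiener J e W \<omega>) t"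
proof -
  define C where "C = cyl_wiener J e W"
  define Z where "Z \<omega> = S (\<xi> \<omega>) (C \<omega>)" for \<omega>
  note Zsol = Z[folded C_def, folded Z_def] and Z0' = Z0[folded C_def, folded Z_def]
  have [measurable]: "C \<in> M \<rightarrow>\<^sub>M wiener_borel" unfolding C_def by (rule measurable_cyl_wiener_W)
  have \<xi>M[measurable]: "\<xi> \<in> borel_measurable M" using measurable_F_M[OF \<xi>(1)] by simp
  have Xm: "(\<lambda>\<omega>. X \<omega> t) \<in> borel_measurable M" and Zm: "(\<lambda>\<omega>. Z \<omega> t) \<in> borel_measurable M" if "0 \<le> t" for t
    using measurable_F_M[OF weak_solutionD(4)[OF X that] that] measurable_F_M[OF weak_solutionD(4)[OF Zsol that] that] .
  have X0[measurable]: "(\<lambda>\<omega>. X \<omega> 0) \<in> borel_measurable M" and Z0m[measurable]: "(\<lambda>\<omega>. Z \<omega> 0) \<in> borel_measurable M"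
    using Xm[of 0] Zm[of 0] by auto
  have law: "distr M (borel \<Otimes>\<^sub>M wiener_borel) (\<lambda>\<omega>. (\<xi> \<omega>, C \<omega>)) = \<mu> \<Otimes>\<^sub>M wiener_law J e"
    unfolding C_def wiener_law_eq law_initial_cyl_wiener[OF \<xi>(1)] \<xi>\<mu> ..
  have sets_\<mu>: "sets \<mu> = sets borel" using \<xi>\<mu> by auto
  have sets_P: "sets (\<mu> \<Otimes>\<^sub>M wiener_law J e) = sets (borel \<Otimes>\<^sub>M wiener_borel)"
    unfolding law[symmetric] by simp
  have Z\<mu>: "distr M borel (\<lambda>\<omega>. Z \<omega> 0) = \<mu>"
    unfolding \<xi>\<mu>[symmetric] using Z0' by (intro distr_cong_AE) auto
  have one: "AE \<omega> in M. X \<omega> t \<in> G \<longleftrightarrow> Z \<omega> t \<in> G" if t: "0 \<le> t" and G: "open G" for t G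
  proof -
    have "{x \<in> space (path_borel iV). x t \<in> G} \<in> sets (path_borel iV)"
      using measurable_sets[OF measurable_path_eval[OF t, of iV] borel_open[OF G]]
      by (simp add: vimage_def Int_def conj_commute)
    from measurable_sets[OF S this] obtain B N N' where BN:
      "(\<lambda>(h, w). S h w) -` {x \<in> space (path_borel iV). x t \<in> G} \<inter> space (completion (\<mu> \<Otimes>\<^sub>M wiener_law J e)) = B \<union> N"
      "N \<subseteq> N'" "N' \<in> null_sets (\<mu> \<Otimes>\<^sub>M wiener_law J e)" "B \<in> sets (\<mu> \<Otimes>\<^sub>M wiener_law J e)"
      by (rule sets_completionE)
    have B[measurable]: "B \<in> sets (borel \<Otimes>\<^sub>M wiener_borel)" using BN(4) sets_P by simp
    have "AE p in distr M (borel \<Otimes>\<^sub>M wiener_borel) (\<lambda>\<omega>. (\<xi> \<omega>, C \<omega>)). p \<notin> N'"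
      unfolding law by (rule AE_not_in[OF BN(3)])
    then have "AE \<omega> in M. (\<xi> \<omega>, C \<omega>) \<notin> N'"
      by (rule AE_distrD[rotated]) measurable
    then have ZB: "AE \<omega> in M. Z \<omega> t \<in> G \<longleftrightarrow> (\<xi> \<omega>, C \<omega>) \<in> B"
      using AE_space
    proof eventually_elim
      case (elim \<omega>)
      have "(\<xi> \<omega>, C \<omega>) \<in> space (borel \<Otimes>\<^sub>M wiener_borel)"
        using elim(2) measurable_space[of C M wiener_borel \<omega>] by (simp add: space_pair_measure)
      then have "(\<xi> \<omega>, C \<omega>) \<in> space (completion (\<mu> \<Otimes>\<^sub>M wiener_law J e))"
        using sets_eq_imp_space_eq[OF sets_P] by simp
      then have "Z \<omega> t \<in> G \<longleftrightarrow> (\<xi> \<omega>, C \<omega>) \<in> B \<union> N"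
        unfolding BN(1)[symmetric] using weak_solutionD(3)[OF Zsol elim(2)] by (simp add: Z_def)
      then show ?case using elim(1) BN(2) by auto
    qed
    \<comment> \<open>The event that the path is not in G at time t as predicted by its initial value and the noise.\<close>
    define A where "A = {p \<in> space (path_borel iV \<Otimes>\<^sub>M (wiener_borel :: (real \<Rightarrow> 'k) measure)).
      (fst p t \<in> G) \<noteq> ((fst p 0, snd p) \<in> B)}"
    have A: "A \<in> sets (path_borel iV \<Otimes>\<^sub>M wiener_borel)"
    proof -
      have [measurable]: "(\<lambda>p :: (real \<Rightarrow> 'h) \<times> (real \<Rightarrow> 'k). fst p t) \<in> path_borel iV \<Otimes>\<^sub>M wiener_borel \<rightarrow>\<^sub>M borel"
        "(\<lambda>p :: (real \<Rightarrow> 'h) \<times> (real \<Rightarrow> 'k). fst p 0) \<in> path_borel iV \<Otimes>\<^sub>M wiener_borel \<rightarrow>\<^sub>M borel"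
        using measurable_compose[OF measurable_fst measurable_path_eval[OF t, of iV]]
          measurable_compose[OF measurable_fst measurable_path_eval[OF order_refl, of iV]] by auto
      have [measurable]: "G \<in> sets borel" using G by simp
      show ?thesis unfolding A_def by measurable
    qed
    have pre: "(\<lambda>\<omega>. (Y \<omega>, C \<omega>)) -` A \<inter> space M = {\<omega>\<in>space M. (Y \<omega> t \<in> G) \<noteq> ((Y \<omega> 0, C \<omega>) \<in> B)}"
      if "weak_solution iV iE J e b \<sigma> M F Y W" for Y
      using weak_solutionD(3)[OF that] measurable_space[of C M wiener_borel]
      by (auto simp: A_def space_pair_measure)
    have "joint_law J e M X W A = joint_law J e M Z W A"
      using unique X Zsol X\<mu> Z\<mu> A unfolding joint_uniqueness_given_def by blast
    then have eq: "emeasure M {\<omega>\<in>space M. (X \<omega> t \<in> G) \<noteq> ((X \<omega> 0, C \<omega>) \<in> B)} =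
        emeasure M {\<omega>\<in>space M. (Z \<omega> t \<in> G) \<noteq> ((Z \<omega> 0, C \<omega>) \<in> B)}"
      unfolding joint_law_def C_def[symmetric] pre[OF X] pre[OF Zsol] .
    note [measurable] = Xm[OF t] Zm[OF t]
    have [measurable]: "G \<in> sets borel" using G by simp
    have "AE \<omega> in M. \<not> ((Z \<omega> t \<in> G) \<noteq> ((Z \<omega> 0, C \<omega>) \<in> B))"
      using ZB Z0' by eventually_elim auto
    moreover have "{\<omega>\<in>space M. (Z \<omega> t \<in> G) \<noteq> ((Z \<omega> 0, C \<omega>) \<in> B)} \<in> sets M"
      "{\<omega>\<in>space M. (X \<omega> t \<in> G) \<noteq> ((X \<omega> 0, C \<omega>) \<in> B)} \<in> sets M" by measurable
    ultimately have "AE \<omega> in M. \<not> ((X \<omega> t \<in> G) \<noteq> ((X \<omega> 0, C \<omega>) \<in> B))"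
      using eq by (simp add: AE_iff_measurable[OF _ refl])
    then show ?thesis
      using ZB \<xi>(2) by eventually_elim auto
  qed
  obtain \<G> :: "'h set set" where \<G>: "countable \<G>" "topological_basis \<G>"
    using ex_countable_basis by blast
  have "AE \<omega> in M. \<forall>l j. \<forall>G\<in>\<G>. X \<omega> (real j / 2 ^ l) \<in> G \<longleftrightarrow> Z \<omega> (real j / 2 ^ l) \<in> G"
    unfolding AE_all_countable AE_ball_countable[OF \<G>(1)]
    using one topological_basis_open[OF \<G>(2)] by simp
  then show ?thesis
    using AE_space
  proof eventually_elim
    case (elim \<omega>)
    have dy: "X \<omega> (real j / 2 ^ l) = Z \<omega> (real j / 2 ^ l)" for j l
    proof (rule ccontr)
      assume ne: "X \<omega> (real j / 2 ^ l) \<noteq> Z \<omega> (real j / 2 ^ l)"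
      have "open (- {Z \<omega> (real j / 2 ^ l)})" by (rule open_Compl[OF closed_singleton])
      with ne obtain G where "G \<in> \<G>" "X \<omega> (real j / 2 ^ l) \<in> G" "G \<subseteq> - {Z \<omega> (real j / 2 ^ l)}"
        using topological_basisE[OF \<G>(2)] by (metis ComplI singletonD)
      then show False using elim(1) by blast
    qed
    have "continuous_on {0..} (X \<omega>)" "continuous_on {0..} (Z \<omega>)"
      using weak_solutionD(3)[OF X elim(2)] weak_solutionD(3)[OF Zsol elim(2)] by (auto simp: path_space_def)
    then have "continuous_on {0..} (\<lambda>t. norm (X \<omega> t - Z \<omega> t))" by (intro continuous_intros)
    then have "norm (X \<omega> t - Z \<omega> t) \<le> 0" if "0 \<le> t" for t
      by (rule le_from_dyadic[OF _ _ that order_refl]) (simp add: dy)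
    then show ?case by (simp add: Z_def C_def)
  qed
qed

end

lemma pathwise_uniqueness_given_if_strong_solution:
  fixes iV :: "'v::real_normed_vector \<Rightarrow> 'h::{real_inner, second_countable_topology}"
    and iE :: "'h \<Rightarrow> 'e::{banach, second_countable_topology}"
    and J :: "'u::real_inner \<Rightarrow> 'k::{real_inner, banach, second_countable_topology}"
  assumes strong: "has_strong_solution TYPE('w) iV iE J e b \<sigma>"
    and unique: "joint_uniqueness_given TYPE('w) iV iE J e b \<sigma> \<mu>"
  shows "pathwise_uniqueness_given TYPE('w) iV iE J e b \<sigma> \<mu>"
  unfolding pathwise_uniqueness_given_def
proof (intro allI impI, elim conjE)
  fix M :: "'w measure" and F X Y W
  assume X: "weak_solution iV iE J e b \<sigma> M F X W" and Y: "weak_solution iV iE J e b \<sigma> M F Y W"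
    and X\<mu>: "distr M borel (\<lambda>\<omega>. X \<omega> 0) = \<mu>" and Y\<mu>: "distr M borel (\<lambda>\<omega>. Y \<omega> 0) = \<mu>"
    and XY: "AE \<omega> in M. X \<omega> 0 = Y \<omega> 0"
  interpret wiener_basis M F W by (rule wiener_basisI[OF weak_solutionD(1,2)[OF X]])
  define \<xi> where "\<xi> \<omega> = X \<omega> 0" for \<omega>
  have \<xi>: "\<xi> \<in> borel_measurable (F 0)" unfolding \<xi>_def by (rule weak_solutionD(4)[OF X]) simp
  have \<xi>\<mu>: "distr M borel \<xi> = \<mu>" using X\<mu> by (simp add: \<xi>_def[abs_def])
  have "prob_space \<mu>" unfolding \<xi>\<mu>[symmetric] using measurable_F_M[OF \<xi>] by (intro prob_space_distr) simp
  moreover have "sets \<mu> = sets borel" using \<xi>\<mu> by auto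
  moreover obtain S S' where SS: "solution_map iV J e S S'"
    and sol: "\<And>(M :: 'w measure) F W \<xi>. stochastic_basis M F \<Longrightarrow> wiener_process M F W \<Longrightarrow> \<xi> \<in> borel_measurable (F 0) \<Longrightarrow>
      weak_solution iV iE J e b \<sigma> M F (\<lambda>\<omega>. S' (distr M borel \<xi>) (\<xi> \<omega>) (cyl_wiener J e W \<omega>)) W \<and>
      (AE \<omega> in M. S' (distr M borel \<xi>) (\<xi> \<omega>) (cyl_wiener J e W \<omega>) 0 = \<xi> \<omega>)"
    using strong unfolding has_strong_solution_def Let_def by blast
  ultimately have meas: "(\<lambda>(h, w). S' \<mu> h w) \<in> completion (\<mu> \<Otimes>\<^sub>M wiener_law J e) \<rightarrow>\<^sub>M path_borel iV"
    unfolding solution_map_def by blast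
  note Z = sol[OF basis wiener \<xi>, unfolded \<xi>\<mu>]
  have "AE \<omega> in M. \<forall>t\<ge>0. X \<omega> t = S' \<mu> (\<xi> \<omega>) (cyl_wiener J e W \<omega>) t"
    by (rule weak_solution_eq_functional[OF meas unique X X\<mu> \<xi> _ \<xi>\<mu> conjunct1[OF Z] conjunct2[OF Z]]) (simp add: \<xi>_def)
  moreover have "AE \<omega> in M. \<forall>t\<ge>0. Y \<omega> t = S' \<mu> (\<xi> \<omega>) (cyl_wiener J e W \<omega>) t"
    by (rule weak_solution_eq_functional[OF meas unique Y Y\<mu> \<xi> _ \<xi>\<mu> conjunct1[OF Z] conjunct2[OF Z]])
      (use XY in \<open>auto simp: \<xi>_def\<close>)
  ultimately show "AE \<omega> in M. \<forall>t\<ge>0. X \<omega> t = Y \<omega> t"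
    by eventually_elim simp
qed

text \<open>
  Two solutions that agree almost surely at time zero have the same initial law.
\<close>
lemma pathwise_uniqueness_if_given:
  fixes iV :: "'v::real_normed_vector \<Rightarrow> 'h::real_inner"
    and iE :: "'h \<Rightarrow> 'e::{banach, second_countable_topology}"
    and J :: "'u::real_inner \<Rightarrow> 'k::real_inner"
  assumes "\<And>\<mu> :: 'h measure. pathwise_uniqueness_given TYPE('w) iV iE J e b \<sigma> \<mu>"
  shows "pathwise_uniqueness TYPE('w) iV iE J e b \<sigma>"
  unfolding pathwise_uniqueness_def
proof (intro allI impI, elim conjE)
  fix M :: "'w measure" and F X Y W
  assume X: "weak_solution iV iE J e b \<sigma> M F X W" and Y: "weak_solution iV iE J e b \<sigma> M F Y W"
    and XY: "AE \<omega> in M. X \<omega> 0 = Y \<omega> 0"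
  interpret wiener_basis M F W by (rule wiener_basisI[OF weak_solutionD(1,2)[OF X]])
  have "(\<lambda>\<omega>. X \<omega> 0) \<in> borel_measurable M" "(\<lambda>\<omega>. Y \<omega> 0) \<in> borel_measurable M"
    using measurable_F_M[OF weak_solutionD(4)[OF X order_refl]] measurable_F_M[OF weak_solutionD(4)[OF Y order_refl]] by simp_all
  then have "distr M borel (\<lambda>\<omega>. Y \<omega> 0) = distr M borel (\<lambda>\<omega>. X \<omega> 0)"
    using XY by (intro distr_cong_AE) auto
  then show "AE \<omega> in M. \<forall>t\<ge>0. X \<omega> t = Y \<omega> t"
    using assms X Y XY unfolding pathwise_uniqueness_given_def by blast
qed

theorem theorem3p1:
  fixes iV :: "'v::{banach, second_countable_topology} \<Rightarrow> 'h::{real_inner, banach, second_countable_topology}"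
    and iE :: "'h \<Rightarrow> 'e::{banach, second_countable_topology}"
    and e :: "nat \<Rightarrow> 'u::{real_inner, banach, second_countable_topology}"
    and J :: "'u \<Rightarrow> 'k::{real_inner, banach, second_countable_topology}"
    and b :: "real \<Rightarrow> (real \<Rightarrow> 'h) \<Rightarrow> 'e"
    and \<sigma> :: "real \<Rightarrow> (real \<Rightarrow> 'h) \<Rightarrow> ('u \<Rightarrow>\<^sub>L 'h)"
  assumes "\<not> (\<exists>B :: 'h set. finite B \<and> span B = UNIV)"
    and "\<not> (\<exists>B :: 'u set. finite B \<and> span B = UNIV)"
    and "dense_continuous_embedding iV"
    and "dense_continuous_embedding iE"
    and "orthonormal_basis e"
    and "bounded_linear J" and "inj J" and "hs_norm_sq e J < \<infinity>"
    and "admissible_drift iV b"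
    and "admissible_diffusion iV e \<sigma>"
    and "has_strong_solution TYPE('w) iV iE J e b \<sigma>"
  shows "(\<forall>\<mu> :: 'h measure. prob_space \<mu> \<and> sets \<mu> = sets borel \<and>
            joint_uniqueness_given TYPE('w) iV iE J e b \<sigma> \<mu> \<longrightarrow>
            pathwise_uniqueness_given TYPE('w) iV iE J e b \<sigma> \<mu>)
       \<and> (joint_uniqueness TYPE('w) iV iE J e b \<sigma> \<longrightarrow>
            pathwise_uniqueness TYPE('w) iV iE J e b \<sigma>)"
proof (intro conjI allI impI)
  show "pathwise_uniqueness_given TYPE('w) iV iE J e b \<sigma> \<mu>"
    if "prob_space \<mu> \<and> sets \<mu> = sets borel \<and> joint_uniqueness_given TYPE('w) iV iE J e b \<sigma> \<mu>" for \<mu>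
    using pathwise_uniqueness_given_if_strong_solution[OF assms(11)] that by blast
  assume "joint_uniqueness TYPE('w) iV iE J e b \<sigma>"
  then have "joint_uniqueness_given TYPE('w) iV iE J e b \<sigma> \<mu>" for \<mu>
    unfolding joint_uniqueness_def joint_uniqueness_given_def by metis
  then show "pathwise_uniqueness TYPE('w) iV iE J e b \<sigma>"
    by (intro pathwise_uniqueness_if_given pathwise_uniqueness_given_if_strong_solution[OF assms(11)])
qed

end
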